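(* Let $\mathcal{F}\subset\mathcal{D}'$ be an $A$-submodule which is an injective cogenerator and satisfies the cutoff assumption (stated in the context). Let $\ell\geq k\geq 1$. Then the set of uncontrollable systems in $\mathcal{B}_{\ell,k}$ is open dense. In other words, uncontrollability is generic in $\mathcal{B}_{\ell,k}$ when $\ell\geq k$.
   Context: $A=\mathbb{C}[D_1,\ldots,D_n]$, $D_j=\frac{1}{\imath}\partial_j$, is the ring of constant coefficient partial differential operators on $\mathbb{R}^n$, acting by differentiation on the space $\mathcal{D}'$ of distributions on $\mathbb{R}^n$. For a submodule $P\subset A^k$, $\mathrm{Ker}_{\mathcal{F}}(P)=\{f\in\mathcal{F}^k : \sum_j p_j(D)f_j=0 \text{ for all } (p_1,\ldots,p_k)\in P\}$; such subspaces are called systems, and a sub-system of a system is a system contained in it. An injective $A$-module $\mathcal{F}$ is a cogenerator if $\mathrm{Hom}_A(M,\mathcal{F})\neq 0$ for every nonzero $A$-module $M$; in that case $P\mapsto\mathrm{Ker}_{\mathcal{F}}(P)$ is a bijection from submodules of $A^k$ to systems in $\mathcal{F}^k$. Topologies: let $M_{\ell,k}(d)$ be the set of $\ell\times k$ matrices with entries in $A$ of degree at most $d$, identified with the affine space $\mathbb{C}^{\ell k N(d)}$, $N(d)=\binom{n+d}{n}$, with the Zariski topology. $\mathcal{M}_{\ell,k}=\varinjlim_d M_{\ell,k}(d)$ is the set of all $\ell\times k$ matrices over $A$ with the direct limit topology (a subset is open iff its intersection with each $M_{\ell,k}(d)$ is open). $\mathcal{S}_{\ell,k}$ is the set of submodules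 of $A^k$ that can be generated by $\ell$ elements, with the quotient topology from the map $\mathcal{M}_{\ell,k}\to\mathcal{S}_{\ell,k}$ sending a matrix to the submodule generated by its rows. $\mathcal{B}_{\ell,k}$ is the set of systems $\mathrm{Ker}_{\mathcal{F}}(P)$, $P\in\mathcal{S}_{\ell,k}$, with the topology transported by the bijection $P\mapsto\mathrm{Ker}_{\mathcal{F}}(P)$. A subset is generic if it contains an open dense subset. A disjoint pair $U_1,U_2\subset\mathbb{R}^n$ with non-intersecting closures is admissible with respect to $\mathcal{F}$ if for any $f_1,f_2\in\mathcal{F}$ there is $f\in\mathcal{F}$ with $f=f_1$ on some neighbourhood of $U_1$ and $f=f_2$ on some neighbourhood of $U_2$. A system $B$ is controllable if for every admissible pair $U_1,U_2$ and any $f_1,f_2\in B$ there is $f\in B$ with $f=f_1$ on some neighbourhood of $U_1$ and $f=f_2$ on some neighbourhood of $U_2$. A system is uncontrollable if none of its nonzero sub-systems is controllable (the zero system is vacuously uncontrollable). Cutoff assumption on $\mathcal{F}$: for every bounded $V\subset\mathbb{R}^n$ with nonempty interior there is a nonempty subset $U$ whose closure is contained in the interior of $V$ such that the pair $U,\ \mathbb{R}^n\setminus V$ is admissible with respect to $\mathcal{F}$. *)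

theory Defs
  imports
    "HOL-Analysis.Analysis"
    "HOL-Library.Poly_Mapping"
    "HOL-Algebra.Module"
    "HOL-Algebra.Algebraic_Closure_Type"
begin

section \<open>Distributions\<close>

definition partial :: "'n::finite \<Rightarrow> (real^'n \<Rightarrow> complex) \<Rightarrow> real^'n \<Rightarrow> complex" where
  "partial j f = (\<lambda>x. frechet_derivative f (at x) (axis j 1))"

abbreviation partials :: "'n::finite list \<Rightarrow> (real^'n \<Rightarrow> complex) \<Rightarrow> real^'n \<Rightarrow> complex" where
  "partials js f \<equiv> foldr partial js f"

definition smooth :: "(real^'n::finite \<Rightarrow> complex) \<Rightarrow> bool" where
  "smooth f \<longleftrightarrow> (\<forall>js. partials js f differentiable_on UNIV)"

definition support :: "(real^'n::finite \<Rightarrow> complex) \<Rightarrow> (real^'n) set" where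
  "support f = closure {x. f x \<noteq> 0}"

definition test_fun :: "(real^'n::finite \<Rightarrow> complex) \<Rightarrow> bool" where
  "test_fun f \<longleftrightarrow> smooth f \<and> compact (support f)"

text \<open>The sum over lists of indices repeats each multi-index of order at most \<open>N\<close> finitely often, so
  that up to a constant factor this is the usual \<open>C\<^sup>N\<close>-norm.\<close>

definition seminorm :: "nat \<Rightarrow> (real^'n::finite \<Rightarrow> complex) \<Rightarrow> real" where
  "seminorm N f = (\<Sum>js | length js \<le> N. SUP x. cmod (partials js f x))"

lemma smooth_differentiable: "smooth f \<Longrightarrow> f differentiable at x"
  unfolding smooth_def differentiable_on_def by (drule spec[of _ "[]"]) auto

lemma smooth_partials: "smooth f \<Longrightarrow> smooth (partials js f)"
  unfolding smooth_def by (metis foldr_append comp_apply)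

lemma smooth_partial: "smooth f \<Longrightarrow> smooth (partial j f)"
  using smooth_partials[of f "[j]"] by simp

lemma smooth_continuous: "smooth f \<Longrightarrow> continuous_on UNIV f"
  by (meson differentiable_imp_continuous_on differentiable_at_imp_differentiable_on smooth_differentiable)

lemma partial_add:
  assumes "smooth f" "smooth g"
  shows "partial j (\<lambda>x. f x + g x) = (\<lambda>x. partial j f x + partial j g x)"
proof
  fix x
  have "((\<lambda>x. f x + g x) has_derivative
      (\<lambda>h. frechet_derivative f (at x) h + frechet_derivative g (at x) h)) (at x)"
    using assms smooth_differentiable[of _ x]
    by (intro has_derivative_add) (auto simp: frechet_derivative_works)
  from frechet_derivative_at[OF this]
  show "partial j (\<lambda>x. f x + g x) x = partial j f x + partial j g x"
    unfolding partial_def by (metis)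
qed

lemma partial_scale:
  assumes "smooth f"
  shows "partial j (\<lambda>x. c * f x) = (\<lambda>x. c * partial j f x)"
proof
  fix x
  have "((\<lambda>x. c * f x) has_derivative (\<lambda>h. c * frechet_derivative f (at x) h)) (at x)"
    using assms smooth_differentiable[of _ x]
    by (intro has_derivative_mult_right) (auto simp: frechet_derivative_works)
  from frechet_derivative_at[OF this]
  show "partial j (\<lambda>x. c * f x) x = c * partial j f x"
    unfolding partial_def by (metis)
qed

lemma partials_add:
  assumes "smooth f" "smooth g"
  shows "partials js (\<lambda>x. f x + g x) = (\<lambda>x. partials js f x + partials js g x)"
  by (induction js) (simp_all add: partial_add smooth_partials assms)

lemma partials_scale:
  assumes "smooth f"
  shows "partials js (\<lambda>x. c * f x) = (\<lambda>x. c * partials js f x)"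
  by (induction js) (simp_all add: partial_scale smooth_partials assms)

lemma smooth_add: "smooth f \<Longrightarrow> smooth g \<Longrightarrow> smooth (\<lambda>x. f x + g x)"
  using smooth_differentiable[OF smooth_partials, of f] smooth_differentiable[OF smooth_partials, of g]
  by (simp add: smooth_def[of "\<lambda>x. f x + g x"] partials_add differentiable_on_def differentiable_add)

lemma smooth_scale: "smooth f \<Longrightarrow> smooth (\<lambda>x. c * f x)"
  using smooth_differentiable[OF smooth_partials, of f]
  by (simp add: smooth_def[of "\<lambda>x. c * f x"] partials_scale differentiable_on_def)

lemma partial_zero_outside: "x \<notin> support f \<Longrightarrow> partial j f x = 0"
proof -
  assume x: "x \<notin> support f"
  have "(f has_derivative (\<lambda>h. 0)) (at x)"
  proof (rule has_derivative_transform_within_open[of "\<lambda>_. 0" _ _ _ "- support f"])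
    show "0 = f y" if "y \<in> - support f" for y
      using that closure_subset[of "{x. f x \<noteq> 0}"] by (auto simp: support_def)
  qed (use x in \<open>auto simp: support_def\<close>)
  from frechet_derivative_at[OF this] show ?thesis
    unfolding partial_def by metis
qed

lemma support_partial: "support (partial j f) \<subseteq> support f"
  unfolding support_def[of "partial j f"]
  by (rule closure_minimal) (use partial_zero_outside in \<open>auto simp: support_def\<close>)

lemma support_add: "support (\<lambda>x. f x + g x) \<subseteq> support f \<union> support g"
proof -
  have "support (\<lambda>x. f x + g x) \<subseteq> closure ({x. f x \<noteq> 0} \<union> {x. g x \<noteq> 0})"
    unfolding support_def by (rule closure_mono) auto
  then show ?thesis by (simp add: support_def)
qed

lemma support_scale: "support (\<lambda>x. c * f x) \<subseteq> support f"
  unfolding support_def by (rule closure_mono) auto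

lemma compact_support_subset: "compact (support f) \<Longrightarrow> support g \<subseteq> support f \<Longrightarrow> compact (support g)"
  by (metis compact_Int_closed inf.absorb2 support_def closed_closure)

lemma test_fun_partial: "test_fun f \<Longrightarrow> test_fun (partial j f)"
  unfolding test_fun_def using smooth_partial support_partial compact_support_subset by blast

lemma test_fun_partials: "test_fun f \<Longrightarrow> test_fun (partials js f)"
  by (induction js) (simp_all add: test_fun_partial)

lemma test_fun_add: "test_fun f \<Longrightarrow> test_fun g \<Longrightarrow> test_fun (\<lambda>x. f x + g x)"
proof -
  assume "test_fun f" "test_fun g"
  moreover have "compact (support (\<lambda>x. f x + g x))" if "compact (support f \<union> support g)"
    using compact_Int_closed[OF that, of "support (\<lambda>x. f x + g x)"] support_add[of f g]
    by (simp add: inf.absorb2 support_def)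
  ultimately show ?thesis
    unfolding test_fun_def by (simp add: smooth_add compact_Un)
qed

lemma test_fun_scale: "test_fun f \<Longrightarrow> test_fun (\<lambda>x. c * f x)"
  unfolding test_fun_def using smooth_scale support_scale compact_support_subset by blast

lemma test_fun_bdd: "test_fun f \<Longrightarrow> bdd_above (range (\<lambda>x. cmod (f x)))"
proof -
  assume f: "test_fun f"
  have "compact ((\<lambda>x. cmod (f x)) ` support f)"
    using f smooth_continuous unfolding test_fun_def
    by (intro compact_continuous_image continuous_on_norm) (auto intro: continuous_on_subset)
  then obtain B where B: "\<And>x. x \<in> support f \<Longrightarrow> cmod (f x) \<le> B"
    by (meson bdd_above.E bounded_imp_bdd_above compact_imp_bounded imageI)
  have "f x = 0" if "x \<notin> support f" for x
    using that closure_subset[of "{x. f x \<noteq> 0}"] by (auto simp: support_def)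
  then have "cmod (f x) \<le> max B 0" for x
    using B[of x] by (cases "x \<in> support f") auto
  then show ?thesis by (auto intro!: bdd_aboveI)
qed

lemma finite_lists_le: "finite {js :: 'n::finite list. length js \<le> N}"
  using finite_lists_length_le[of "UNIV :: 'n set" N] by simp

lemma sup_nonneg: "test_fun f \<Longrightarrow> 0 \<le> (SUP x. cmod (partials js f x))"
  by (rule cSUP_upper2[of _ _ undefined]) (auto intro: test_fun_bdd test_fun_partials)

lemma seminorm_mono: "test_fun f \<Longrightarrow> M \<le> N \<Longrightarrow> seminorm M f \<le> seminorm N f"
  unfolding seminorm_def
  by (rule sum_mono2) (auto simp: finite_lists_le sup_nonneg)

lemma seminorm_nonneg: "test_fun f \<Longrightarrow> 0 \<le> seminorm N f"
  unfolding seminorm_def by (auto intro!: sum_nonneg sup_nonneg)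

lemma seminorm_partial:
  assumes "test_fun f" shows "seminorm N (partial j f) \<le> seminorm (Suc N) f"
proof -
  have "seminorm N (partial j f) = (\<Sum>js\<in>(\<lambda>js. js @ [j]) ` {js. length js \<le> N}. SUP x. cmod (partials js f x))"
    unfolding seminorm_def by (subst sum.reindex) (auto simp: inj_on_def)
  also have "\<dots> \<le> seminorm (Suc N) f"
    unfolding seminorm_def
    by (rule sum_mono2) (auto simp: finite_lists_le sup_nonneg assms)
  finally show ?thesis .
qed

definition is_distribution :: "((real^'n::finite \<Rightarrow> complex) \<Rightarrow> complex) \<Rightarrow> bool" where
  "is_distribution u \<longleftrightarrow>
     (\<forall>\<phi> \<psi>. test_fun \<phi> \<and> test_fun \<psi> \<longrightarrow> u (\<lambda>x. \<phi> x + \<psi> x) = u \<phi> + u \<psi>) \<and>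
     (\<forall>c \<phi>. test_fun \<phi> \<longrightarrow> u (\<lambda>x. c * \<phi> x) = c * u \<phi>) \<and>
     (\<forall>K. compact K \<longrightarrow>
        (\<exists>C N. \<forall>\<phi>. test_fun \<phi> \<and> support \<phi> \<subseteq> K \<longrightarrow> cmod (u \<phi>) \<le> C * seminorm N \<phi>))"

text \<open>A distribution is represented by a functional on all functions which vanishes off the test
  functions, so that equality of distributions is equality of functionals on test functions.\<close>

typedef 'n distribution =
  "{u :: (real^'n::finite \<Rightarrow> complex) \<Rightarrow> complex. is_distribution u \<and> (\<forall>\<phi>. \<not> test_fun \<phi> \<longrightarrow> u \<phi> = 0)}"
  morphisms dist_apply Abs_distribution
  by (rule exI[of _ "\<lambda>_. 0"]) (auto simp: is_distribution_def intro!: exI[of _ 0])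

setup_lifting type_definition_distribution

lemma is_distribution_bound:
  fixes u :: "(real^'n::finite \<Rightarrow> complex) \<Rightarrow> complex"
  assumes "is_distribution u" "compact K"
  obtains C N where "C \<ge> 0"
    "\<And>\<phi> M. test_fun \<phi> \<Longrightarrow> support \<phi> \<subseteq> K \<Longrightarrow> N \<le> M \<Longrightarrow> cmod (u \<phi>) \<le> C * seminorm M \<phi>"
proof -
  obtain C N where CN: "\<And>\<phi>. test_fun \<phi> \<Longrightarrow> support \<phi> \<subseteq> K \<Longrightarrow> cmod (u \<phi>) \<le> C * seminorm N \<phi>"
    using assms unfolding is_distribution_def by metis
  have "cmod (u \<phi>) \<le> \<bar>C\<bar> * seminorm M \<phi>"
    if "test_fun \<phi>" "support \<phi> \<subseteq> K" "N \<le> M" for \<phi> M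
  proof -
    have "cmod (u \<phi>) \<le> C * seminorm N \<phi>" using CN that by blast
    also have "\<dots> \<le> \<bar>C\<bar> * seminorm N \<phi>"
      using seminorm_nonneg[OF that(1)] by (intro mult_right_mono) auto
    also have "\<dots> \<le> \<bar>C\<bar> * seminorm M \<phi>"
      using seminorm_mono that by (intro mult_left_mono) auto
    finally show ?thesis .
  qed
  then show thesis by (intro that[of "\<bar>C\<bar>"]) auto
qed

lemma is_distribution_add:
  fixes u v :: "(real^'n::finite \<Rightarrow> complex) \<Rightarrow> complex"
  assumes "is_distribution u" "is_distribution v"
  shows "is_distribution (\<lambda>\<phi>. u \<phi> + v \<phi>)"
  unfolding is_distribution_def
proof (intro conjI allI impI)
  fix K :: "(real^'n) set" assume K: "compact K"
  obtain C N where 1: "C \<ge> 0" "\<And>\<phi> M. test_fun \<phi> \<Longrightarrow> support \<phi> \<subseteq> K \<Longrightarrow> N \<le> M \<Longrightarrow> cmod (u \<phi>) \<le> C * seminorm M \<phi>"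
    using is_distribution_bound[OF assms(1) K] by blast
  obtain C' N' where 2: "C' \<ge> 0" "\<And>\<phi> M. test_fun \<phi> \<Longrightarrow> support \<phi> \<subseteq> K \<Longrightarrow> N' \<le> M \<Longrightarrow> cmod (v \<phi>) \<le> C' * seminorm M \<phi>"
    using is_distribution_bound[OF assms(2) K] by blast
  have "cmod (u \<phi> + v \<phi>) \<le> (C + C') * seminorm (max N N') \<phi>" if "test_fun \<phi>" "support \<phi> \<subseteq> K" for \<phi>
    using 1(2)[of \<phi> "max N N'"] 2(2)[of \<phi> "max N N'"] that norm_triangle_ineq[of "u \<phi>" "v \<phi>"]
    by (simp add: distrib_right)
  then show "\<exists>C N. \<forall>\<phi>. test_fun \<phi> \<and> support \<phi> \<subseteq> K \<longrightarrow> cmod (u \<phi> + v \<phi>) \<le> C * seminorm N \<phi>"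
    by blast
qed (use assms in \<open>auto simp: is_distribution_def algebra_simps\<close>)

lemma is_distribution_scale:
  fixes u :: "(real^'n::finite \<Rightarrow> complex) \<Rightarrow> complex"
  assumes "is_distribution u"
  shows "is_distribution (\<lambda>\<phi>. c * u \<phi>)"
  unfolding is_distribution_def
proof (intro conjI allI impI)
  fix K :: "(real^'n) set" assume K: "compact K"
  obtain C N where 1: "C \<ge> 0" "\<And>\<phi> M. test_fun \<phi> \<Longrightarrow> support \<phi> \<subseteq> K \<Longrightarrow> N \<le> M \<Longrightarrow> cmod (u \<phi>) \<le> C * seminorm M \<phi>"
    using is_distribution_bound[OF assms(1) K] by blast
  have "cmod (c * u \<phi>) \<le> (cmod c * C) * seminorm N \<phi>" if "test_fun \<phi>" "support \<phi> \<subseteq> K" for \<phi>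
    using mult_left_mono[OF 1(2)[of \<phi> N], of "cmod c"] that by (simp add: norm_mult mult.assoc)
  then show "\<exists>C N. \<forall>\<phi>. test_fun \<phi> \<and> support \<phi> \<subseteq> K \<longrightarrow> cmod (c * u \<phi>) \<le> C * seminorm N \<phi>"
    by blast
qed (use assms in \<open>auto simp: is_distribution_def algebra_simps\<close>)

lemma is_distribution_deriv:
  fixes u :: "(real^'n::finite \<Rightarrow> complex) \<Rightarrow> complex"
  assumes "is_distribution u"
  shows "is_distribution (\<lambda>\<phi>. u (partial j \<phi>))"
  unfolding is_distribution_def
proof (intro conjI allI impI)
  fix K :: "(real^'n) set" assume K: "compact K"
  obtain C N where 1: "C \<ge> 0" "\<And>\<phi> M. test_fun \<phi> \<Longrightarrow> support \<phi> \<subseteq> K \<Longrightarrow> N \<le> M \<Longrightarrow> cmod (u \<phi>) \<le> C * seminorm M \<phi>"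
    using is_distribution_bound[OF assms(1) K] by blast
  have "cmod (u (partial j \<phi>)) \<le> C * seminorm (Suc N) \<phi>" if "test_fun \<phi>" "support \<phi> \<subseteq> K" for \<phi>
  proof -
    have "cmod (u (partial j \<phi>)) \<le> C * seminorm N (partial j \<phi>)"
      using 1(2)[OF test_fun_partial[OF that(1)]] support_partial[of j \<phi>] that(2) by blast
    also have "\<dots> \<le> C * seminorm (Suc N) \<phi>"
      using seminorm_partial[OF that(1)] 1(1) by (rule mult_left_mono)
    finally show ?thesis .
  qed
  then show "\<exists>C N. \<forall>\<phi>. test_fun \<phi> \<and> support \<phi> \<subseteq> K \<longrightarrow> cmod (u (partial j \<phi>)) \<le> C * seminorm N \<phi>"
    by blast
next
  fix \<phi> \<psi> :: "real^'n \<Rightarrow> complex" assume "test_fun \<phi> \<and> test_fun \<psi>"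
  then show "u (partial j (\<lambda>x. \<phi> x + \<psi> x)) = u (partial j \<phi>) + u (partial j \<psi>)"
    using assms test_fun_partial[of _ j] by (auto simp: is_distribution_def partial_add test_fun_def)
next
  fix c and \<phi> :: "real^'n \<Rightarrow> complex" assume "test_fun \<phi>"
  then show "u (partial j (\<lambda>x. c * \<phi> x)) = c * u (partial j \<phi>)"
    using assms test_fun_partial[of _ j] by (auto simp: is_distribution_def partial_scale test_fun_def)
qed

instantiation distribution :: (finite) ab_group_add
begin

lift_definition zero_distribution :: "'a distribution" is "\<lambda>_. 0"
  by (auto simp: is_distribution_def intro!: exI[of _ 0])

lift_definition plus_distribution :: "'a distribution \<Rightarrow> 'a distribution \<Rightarrow> 'a distribution"
  is "\<lambda>u v \<phi>. u \<phi> + v \<phi>"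
  by (auto intro: is_distribution_add)

lift_definition uminus_distribution :: "'a distribution \<Rightarrow> 'a distribution" is "\<lambda>u \<phi>. - u \<phi>"
  using is_distribution_scale[of _ "-1"] by auto

definition minus_distribution :: "'a distribution \<Rightarrow> 'a distribution \<Rightarrow> 'a distribution" where
  "minus_distribution u v = u + (- v)"

instance
  by standard (transfer; force simp: minus_distribution_def fun_eq_iff | simp add: minus_distribution_def)+

end

lift_definition dist_scale :: "complex \<Rightarrow> 'n::finite distribution \<Rightarrow> 'n distribution"
  is "\<lambda>c u \<phi>. c * u \<phi>"
  by (auto intro: is_distribution_scale)

lift_definition dist_partial :: "'n::finite \<Rightarrow> 'n distribution \<Rightarrow> 'n distribution"
  is "\<lambda>j u \<phi>. if test_fun \<phi> then - u (partial j \<phi>) else 0"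
proof -
  fix j :: 'n and u :: "(real^'n \<Rightarrow> complex) \<Rightarrow> complex"
  assume u: "is_distribution u \<and> (\<forall>\<phi>. \<not> test_fun \<phi> \<longrightarrow> u \<phi> = 0)"
  have "is_distribution (\<lambda>\<phi>. (-1) * u (partial j \<phi>))"
    using u is_distribution_scale[OF is_distribution_deriv] by blast
  then show "is_distribution (\<lambda>\<phi>. if test_fun \<phi> then - u (partial j \<phi>) else 0) \<and>
      (\<forall>\<phi>. \<not> test_fun \<phi> \<longrightarrow> (if test_fun \<phi> then - u (partial j \<phi>) else 0) = 0)"
    unfolding is_distribution_def by (auto simp: test_fun_add test_fun_scale)
qed

text \<open>The operator \<open>D\<^sub>j = (1/\<i>) \<partial>\<^sub>j\<close>.\<close>

definition dist_D :: "'n::finite \<Rightarrow> 'n distribution \<Rightarrow> 'n distribution" where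
  "dist_D j u = dist_scale (1 / \<i>) (dist_partial j u)"


lemma has_derivative_partial:
  assumes "smooth f" "bounded_linear L"
  shows "((\<lambda>s. (L (f (x + s *\<^sub>R axis i 1)) :: real)) has_real_derivative L (partial i f (x + s *\<^sub>R axis i 1))) (at s)"
proof -
  let ?y = "x + s *\<^sub>R axis i (1::real)"
  have 1: "((\<lambda>s. x + s *\<^sub>R axis i (1::real)) has_derivative (\<lambda>h. h *\<^sub>R axis i 1)) (at s)"
    by (auto intro!: derivative_eq_intros)
  have f: "(f has_derivative frechet_derivative f (at ?y)) (at ?y)"
    using smooth_differentiable[OF assms(1)] by (simp add: frechet_derivative_works)
  have "((\<lambda>s. L (f (x + s *\<^sub>R axis i 1))) has_derivative
      (\<lambda>h. L (frechet_derivative f (at ?y) (h *\<^sub>R axis i 1)))) (at s)"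
    by (rule bounded_linear.has_derivative[OF assms(2)], rule has_derivative_compose[OF 1 f])
  moreover have "L (frechet_derivative f (at ?y) (h *\<^sub>R axis i 1)) = L (partial i f ?y) * h" for h
    using linear_cmul[OF has_derivative_linear[OF f]] linear_cmul[OF bounded_linear.linear[OF assms(2)]]
    by (simp add: partial_def)
  ultimately show ?thesis by (simp add: has_field_derivative_def)
qed

lemma partial_difference:
  assumes "smooth f" "bounded_linear L" "h > 0"
  shows "\<exists>s t. 0 < s \<and> s < h \<and> 0 < t \<and> t < h \<and>
    (L (f (x + h *\<^sub>R axis i 1 + h *\<^sub>R axis j 1)) - L (f (x + h *\<^sub>R axis i 1))
      - L (f (x + h *\<^sub>R axis j 1)) + L (f x) :: real)
    = h * h * L (partial j (partial i f) (x + s *\<^sub>R axis i 1 + t *\<^sub>R axis j 1))"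
proof -
  let ?e = "\<lambda>i. axis i (1::real)"
  have "((\<lambda>s. L (f ((x + h *\<^sub>R ?e j) + s *\<^sub>R ?e i)) - L (f (x + s *\<^sub>R ?e i))) has_real_derivative
     L (partial i f ((x + h *\<^sub>R ?e j) + s *\<^sub>R ?e i)) - L (partial i f (x + s *\<^sub>R ?e i))) (at s)" for s
    by (intro derivative_intros has_derivative_partial assms)
  from MVT2[OF assms(3), of "\<lambda>s. L (f ((x + h *\<^sub>R ?e j) + s *\<^sub>R ?e i)) - L (f (x + s *\<^sub>R ?e i))", OF this]
  obtain s where s: "0 < s" "s < h"
    "(L (f (x + h *\<^sub>R ?e j + h *\<^sub>R ?e i)) - L (f (x + h *\<^sub>R ?e i))) - (L (f (x + h *\<^sub>R ?e j)) - L (f x))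
     = h * (L (partial i f (x + h *\<^sub>R ?e j + s *\<^sub>R ?e i)) - L (partial i f (x + s *\<^sub>R ?e i)))"
    by auto
  have "((\<lambda>t. L (partial i f ((x + s *\<^sub>R ?e i) + t *\<^sub>R ?e j))) has_real_derivative
     L (partial j (partial i f) ((x + s *\<^sub>R ?e i) + t *\<^sub>R ?e j))) (at t)" for t
    by (intro has_derivative_partial assms smooth_partial)
  from MVT2[OF assms(3), of "\<lambda>t. L (partial i f ((x + s *\<^sub>R ?e i) + t *\<^sub>R ?e j))", OF this]
  obtain t where t: "0 < t" "t < h"
    "L (partial i f (x + s *\<^sub>R ?e i + h *\<^sub>R ?e j)) - L (partial i f (x + s *\<^sub>R ?e i))
     = h * L (partial j (partial i f) (x + s *\<^sub>R ?e i + t *\<^sub>R ?e j))"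
    by auto
  from s t show ?thesis
    by (intro exI[of _ s] exI[of _ t]) (simp add: algebra_simps)
qed

lemma partial_commute_functional:
  assumes "smooth f" "bounded_linear (L :: complex \<Rightarrow> real)"
  shows "L (partial j (partial i f) x) = L (partial i (partial j f) x)"
proof (rule ccontr)
  assume ne: "L (partial j (partial i f) x) \<noteq> L (partial i (partial j f) x)"
  define G where "G = (\<lambda>i j y. L (partial j (partial i f) y))"
  have cont: "isCont (G i j) x" for i j
    unfolding G_def
    using smooth_continuous[OF smooth_partial[OF smooth_partial[OF assms(1)]]]
    by (intro bounded_linear.isCont[OF assms(2)]) (simp add: continuous_on_eq_continuous_at)
  define \<epsilon> where "\<epsilon> = \<bar>G i j x - G j i x\<bar> / 2"
  have \<epsilon>: "\<epsilon> > 0" using ne by (simp add: \<epsilon>_def G_def)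
  obtain d1 where d1: "d1 > 0" "\<And>y. dist y x < d1 \<Longrightarrow> dist (G i j y) (G i j x) < \<epsilon>"
    using cont[of i j] \<epsilon> unfolding continuous_at_eps_delta by blast
  obtain d2 where d2: "d2 > 0" "\<And>y. dist y x < d2 \<Longrightarrow> dist (G j i y) (G j i x) < \<epsilon>"
    using cont[of j i] \<epsilon> unfolding continuous_at_eps_delta by blast
  define h where "h = min d1 d2 / 2"
  have h: "h > 0" "2 * h \<le> d1" "2 * h \<le> d2" using d1 d2 by (auto simp: h_def)
  have near: "dist (x + s *\<^sub>R axis i 1 + t *\<^sub>R axis j 1) x < 2 * h"
    if "0 < s" "s < h" "0 < t" "t < h" for s t and i j :: 'a
  proof -
    have "dist (x + s *\<^sub>R axis i 1 + t *\<^sub>R axis j 1) x \<le> norm (s *\<^sub>R axis i (1::real)) + norm (t *\<^sub>R axis j (1::real))"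
      using norm_triangle_ineq[of "s *\<^sub>R axis i (1::real)" "t *\<^sub>R axis j (1::real)"] by (simp add: dist_norm add.assoc)
    also have "\<dots> < 2 * h" using that by (simp add: norm_axis_1)
    finally show ?thesis .
  qed
  obtain s t where 1: "0 < s" "s < h" "0 < t" "t < h"
     "L (f (x + h *\<^sub>R axis i 1 + h *\<^sub>R axis j 1)) - L (f (x + h *\<^sub>R axis i 1))
      - L (f (x + h *\<^sub>R axis j 1)) + L (f x) = h * h * G i j (x + s *\<^sub>R axis i 1 + t *\<^sub>R axis j 1)"
    using partial_difference[OF assms h(1)] unfolding G_def by blast
  obtain s' t' where 2: "0 < s'" "s' < h" "0 < t'" "t' < h"
     "L (f (x + h *\<^sub>R axis j 1 + h *\<^sub>R axis i 1)) - L (f (x + h *\<^sub>R axis j 1))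
      - L (f (x + h *\<^sub>R axis i 1)) + L (f x) = h * h * G j i (x + s' *\<^sub>R axis j 1 + t' *\<^sub>R axis i 1)"
    using partial_difference[OF assms h(1)] unfolding G_def by blast
  have "h * h * G i j (x + s *\<^sub>R axis i 1 + t *\<^sub>R axis j 1) = h * h * G j i (x + s' *\<^sub>R axis j 1 + t' *\<^sub>R axis i 1)"
    using 1(5) 2(5) by (simp add: algebra_simps)
  then have eq: "G i j (x + s *\<^sub>R axis i 1 + t *\<^sub>R axis j 1) = G j i (x + s' *\<^sub>R axis j 1 + t' *\<^sub>R axis i 1)"
    using h(1) by simp
  have "dist (G i j (x + s *\<^sub>R axis i 1 + t *\<^sub>R axis j 1)) (G i j x) < \<epsilon>"
    using near[OF 1(1-4), of i j] h(2) d1(2) by force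
  moreover have "dist (G j i (x + s' *\<^sub>R axis j 1 + t' *\<^sub>R axis i 1)) (G j i x) < \<epsilon>"
    using near[OF 2(1-4), of j i] h(3) d2(2) by force
  ultimately show False using eq unfolding \<epsilon>_def dist_real_def by (smt (verit) field_sum_of_halves)
qed

lemma partial_commute: "smooth f \<Longrightarrow> partial j (partial i f) = partial i (partial j f)"
  using partial_commute_functional[OF _ bounded_linear_Re] partial_commute_functional[OF _ bounded_linear_Im]
  by (intro ext complex_eqI) blast+

lemma test_fun_partial_commute: "test_fun f \<Longrightarrow> partial j (partial i f) = partial i (partial j f)"
  by (simp add: test_fun_def partial_commute)

lemma dist_partial_commute: "dist_partial j (dist_partial i u) = dist_partial i (dist_partial j u)"
proof (transfer, rule ext)
  fix i j and u and \<phi> :: "real^'n \<Rightarrow> complex"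
  show "(if test_fun \<phi> then - (if test_fun (partial j \<phi>) then - u (partial i (partial j \<phi>)) else 0) else 0)
     = (if test_fun \<phi> then - (if test_fun (partial i \<phi>) then - (u (partial j (partial i \<phi>)) :: complex) else 0) else 0)"
    using test_fun_partial_commute[of \<phi> i j] by (simp add: test_fun_partial)
qed

lemma dist_partial_scale: "dist_partial j (dist_scale c u) = dist_scale c (dist_partial j u)"
  by transfer (auto simp: fun_eq_iff)

lemma dist_partial_add: "dist_partial j (u + v) = dist_partial j u + dist_partial j v"
  by transfer (auto simp: fun_eq_iff)

lemma dist_scale_simps:
  "dist_scale c (u + v) = dist_scale c u + dist_scale c v"
  "dist_scale (c + d) u = dist_scale c u + dist_scale d u"
  "dist_scale c (dist_scale d u) = dist_scale (c * d) u"
  "dist_scale 1 u = u"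
  "dist_scale 0 u = 0"
  "dist_scale c 0 = 0"
  by (transfer; simp add: fun_eq_iff algebra_simps)+

lemma dist_D_commute: "dist_D i (dist_D j u) = dist_D j (dist_D i u)"
  by (simp add: dist_D_def dist_partial_scale dist_scale_simps dist_partial_commute)

lemma dist_D_scale: "dist_D i (dist_scale c u) = dist_scale c (dist_D i u)"
  by (simp add: dist_D_def dist_partial_scale dist_scale_simps mult.commute)

lemma dist_D_add: "dist_D i (u + v) = dist_D i u + dist_D i v"
  by (simp add: dist_D_def dist_partial_add dist_scale_simps)

interpretation dist_D: comp_fun_commute dist_D
  by standard (simp add: fun_eq_iff dist_D_commute)


section \<open>The ring of constant coefficient operators and its action\<close>

type_synonym 'v mpoly = "('v \<Rightarrow>\<^sub>0 nat) \<Rightarrow>\<^sub>0 complex"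

text \<open>\<open>\<complex>[D\<^sub>1, \<dots>, D\<^sub>n]\<close>, with the coordinates of \<open>\<real>\<^sup>n\<close> indexed by the type \<open>'n\<close>.\<close>

type_synonym 'n pdo = "'n mpoly"

text \<open>\<open>D\<^sup>\<alpha>\<close> is the product of the commuting operators \<open>D\<^sub>j ^^ \<alpha>\<^sub>j\<close>.\<close>

definition dist_D_power :: "('n::finite \<Rightarrow>\<^sub>0 nat) \<Rightarrow> 'n distribution \<Rightarrow> 'n distribution" where
  "dist_D_power \<alpha> u = Finite_Set.fold (\<lambda>j. dist_D j ^^ Poly_Mapping.lookup \<alpha> j) u UNIV"

definition pdo_act :: "'n::finite pdo \<Rightarrow> 'n distribution \<Rightarrow> 'n distribution" where
  "pdo_act p u = (\<Sum>\<alpha>\<in>Poly_Mapping.keys p. dist_scale (Poly_Mapping.lookup p \<alpha>) (dist_D_power \<alpha> u))"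

lemma dist_D_funpow_commute: "(dist_D j ^^ m) ((dist_D i ^^ k) v) = (dist_D i ^^ k) ((dist_D j ^^ m) v)"
proof -
  have "(dist_D j ^^ m) (dist_D i w) = dist_D i ((dist_D j ^^ m) w)" for w
    by (induction m) (simp_all add: dist_D_commute)
  then show ?thesis by (induction k) simp_all
qed

lemma dist_D_power_add: "dist_D_power (\<alpha> + \<beta>) u = dist_D_power \<alpha> (dist_D_power \<beta> u)"
proof -
  interpret a: comp_fun_commute "\<lambda>j. dist_D j ^^ Poly_Mapping.lookup \<alpha> j"
    by (rule dist_D.comp_fun_commute_funpow)
  interpret b: comp_fun_commute "\<lambda>j. dist_D j ^^ Poly_Mapping.lookup \<beta> j"
    by (rule dist_D.comp_fun_commute_funpow)
  interpret ab: comp_fun_commute "\<lambda>j. dist_D j ^^ Poly_Mapping.lookup (\<alpha> + \<beta>) j"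
    by (rule dist_D.comp_fun_commute_funpow)
  have comm': "finite J \<Longrightarrow> (dist_D j ^^ m) (Finite_Set.fold (\<lambda>j. dist_D j ^^ Poly_Mapping.lookup \<alpha> j) v J)
      = Finite_Set.fold (\<lambda>j. dist_D j ^^ Poly_Mapping.lookup \<alpha> j) ((dist_D j ^^ m) v) J" for J j m v
  proof (induction J rule: finite_induct)
    case (insert x J)
    then show ?case by (simp add: dist_D_funpow_commute[of m j _ x])
  qed simp
  have "finite J \<Longrightarrow> Finite_Set.fold (\<lambda>j. dist_D j ^^ Poly_Mapping.lookup (\<alpha> + \<beta>) j) u J
    = Finite_Set.fold (\<lambda>j. dist_D j ^^ Poly_Mapping.lookup \<alpha> j) (Finite_Set.fold (\<lambda>j. dist_D j ^^ Poly_Mapping.lookup \<beta> j) u J) J" for J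
  proof (induction J rule: finite_induct)
    case (insert x J)
    show ?case
      unfolding ab.fold_insert[OF insert.hyps] a.fold_insert[OF insert.hyps] b.fold_insert[OF insert.hyps] insert.IH
      by (simp add: lookup_add funpow_add comm'[OF insert.hyps(1)])
  qed simp
  then show ?thesis by (simp add: dist_D_power_def)
qed

lemma dist_D_power_zero: "dist_D_power 0 u = u"
proof -
  interpret comp_fun_commute "\<lambda>(j::'a) (v::'a distribution). v"
    by standard simp
  have "finite J \<Longrightarrow> Finite_Set.fold (\<lambda>(j::'a) v. v) u J = u" for J
    by (induction J rule: finite_induct) simp_all
  then show ?thesis by (simp add: dist_D_power_def id_def)
qed

lemma dist_D_power_linear:
  "dist_D_power \<alpha> (u + v) = dist_D_power \<alpha> u + dist_D_power \<alpha> v"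
  "dist_D_power \<alpha> (dist_scale c u) = dist_scale c (dist_D_power \<alpha> u)"
proof -
  interpret comp_fun_commute "\<lambda>j. dist_D j ^^ Poly_Mapping.lookup \<alpha> j"
    by (rule dist_D.comp_fun_commute_funpow)
  have a: "(dist_D j ^^ m) (u + v) = (dist_D j ^^ m) u + (dist_D j ^^ m) v" for j m u v
    by (induction m) (simp_all add: dist_D_add)
  have s: "(dist_D j ^^ m) (dist_scale c u) = dist_scale c ((dist_D j ^^ m) u)" for j m u
    by (induction m) (simp_all add: dist_D_scale)
  have "finite J \<Longrightarrow> Finite_Set.fold (\<lambda>j. dist_D j ^^ Poly_Mapping.lookup \<alpha> j) (u + v) J
    = Finite_Set.fold (\<lambda>j. dist_D j ^^ Poly_Mapping.lookup \<alpha> j) u J + Finite_Set.fold (\<lambda>j. dist_D j ^^ Poly_Mapping.lookup \<alpha> j) v J" for J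
    by (induction J rule: finite_induct) (simp_all add: a)
  moreover have "finite J \<Longrightarrow> Finite_Set.fold (\<lambda>j. dist_D j ^^ Poly_Mapping.lookup \<alpha> j) (dist_scale c u) J
    = dist_scale c (Finite_Set.fold (\<lambda>j. dist_D j ^^ Poly_Mapping.lookup \<alpha> j) u J)" for J
    by (induction J rule: finite_induct) (simp_all add: s)
  ultimately show "dist_D_power \<alpha> (u + v) = dist_D_power \<alpha> u + dist_D_power \<alpha> v"
    "dist_D_power \<alpha> (dist_scale c u) = dist_scale c (dist_D_power \<alpha> u)"
    by (simp_all add: dist_D_power_def)
qed

lemma poly_mapping_sum_single: "p = (\<Sum>\<alpha>\<in>Poly_Mapping.keys p. Poly_Mapping.single \<alpha> (Poly_Mapping.lookup p \<alpha>))"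
  by (rule poly_mapping_eqI) (simp add: lookup_sum lookup_single when_def in_keys_iff sum.delta')

lemma additive_eqI:
  fixes B :: "('a \<Rightarrow>\<^sub>0 'b::ab_group_add) \<Rightarrow> 'c::ab_group_add"
  assumes "\<And>p q. B (p + q) = B p + B q" "\<And>p q. B' (p + q) = B' p + B' q"
    and "\<And>\<alpha> c. B (Poly_Mapping.single \<alpha> c) = B' (Poly_Mapping.single \<alpha> c)"
  shows "B p = B' p"
proof -
  have B: "Modules.additive B" and B': "Modules.additive B'" by (simp_all add: Modules.additive_def assms)
  have "B (\<Sum>\<alpha>\<in>Poly_Mapping.keys p. Poly_Mapping.single \<alpha> (Poly_Mapping.lookup p \<alpha>)) = B' (\<Sum>\<alpha>\<in>Poly_Mapping.keys p. Poly_Mapping.single \<alpha> (Poly_Mapping.lookup p \<alpha>))"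
    by (simp add: Modules.additive.sum[OF B] Modules.additive.sum[OF B'] assms(3))
  then show ?thesis by (simp flip: poly_mapping_sum_single)
qed

lemma pdo_act_superset:
  "finite S \<Longrightarrow> Poly_Mapping.keys p \<subseteq> S \<Longrightarrow> pdo_act p u = (\<Sum>\<alpha>\<in>S. dist_scale (Poly_Mapping.lookup p \<alpha>) (dist_D_power \<alpha> u))"
  unfolding pdo_act_def by (rule sum.mono_neutral_left) (auto simp: in_keys_iff dist_scale_simps)

lemma pdo_act_add_left: "pdo_act (p + q) u = pdo_act p u + pdo_act q u"
  using keys_add[of p q]
  by (simp add: pdo_act_superset[of "Poly_Mapping.keys p \<union> Poly_Mapping.keys q"] lookup_add dist_scale_simps sum.distrib)

lemma pdo_act_add_right: "pdo_act p (u + v) = pdo_act p u + pdo_act p v"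
  by (simp add: pdo_act_def dist_D_power_linear dist_scale_simps sum.distrib)

lemma pdo_act_single: "pdo_act (Poly_Mapping.single \<alpha> c) u = dist_scale c (dist_D_power \<alpha> u)"
  by (simp add: pdo_act_superset[of "{\<alpha>}"] lookup_single)

lemma pdo_act_mult: "pdo_act (p * q) u = pdo_act p (pdo_act q u)"
proof (rule additive_eqI[of "\<lambda>p. pdo_act (p * q) u" "\<lambda>p. pdo_act p (pdo_act q u)"])
  fix \<alpha> :: "'a \<Rightarrow>\<^sub>0 nat" and c :: complex
  let ?p = "Poly_Mapping.single \<alpha> c"
  show "pdo_act (?p * q) u = pdo_act ?p (pdo_act q u)"
    by (rule additive_eqI[of "\<lambda>q. pdo_act (?p * q) u" "\<lambda>q. pdo_act ?p (pdo_act q u)"])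
      (simp_all add: distrib_left pdo_act_add_left pdo_act_add_right mult_single pdo_act_single
        dist_D_power_add dist_D_power_linear dist_scale_simps)
qed (simp_all add: distrib_right pdo_act_add_left)

lemma pdo_act_module: "Modules.module pdo_act"
  by unfold_locales
    (simp_all add: pdo_act_add_left pdo_act_add_right pdo_act_mult pdo_act_single dist_D_power_zero
      dist_scale_simps flip: single_one)


section \<open>Injective cogenerators\<close>

definition module_homs ::
  "('a, 'r) ring_scheme \<Rightarrow> ('a, 'b, 's) module_scheme \<Rightarrow> ('a, 'c, 't) module_scheme \<Rightarrow> ('b \<Rightarrow> 'c) set" where
  "module_homs R M N = {h. h \<in> carrier M \<rightarrow> carrier N \<and>
     (\<forall>x\<in>carrier M. \<forall>y\<in>carrier M. h (x \<oplus>\<^bsub>M\<^esub> y) = h x \<oplus>\<^bsub>N\<^esub> h y) \<and>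
     (\<forall>r\<in>carrier R. \<forall>x\<in>carrier M. h (r \<odot>\<^bsub>M\<^esub> x) = r \<odot>\<^bsub>N\<^esub> h x)}"

text \<open>One cannot quantify over the modules on all types. The test modules below have their elements
  in the type \<open>'a set\<close>, where \<open>'a\<close> is the type of scalars. This is no restriction: by Baer's
  criterion injectivity has to be tested on inclusions \<open>I \<subseteq> R\<close> of ideals only, and these have
  copies on the singletons; and every nonzero module contains a nonzero cyclic module, isomorphic to
  some \<open>R / I\<close>, whose elements (cosets) are sets of scalars, so that for an injective module the
  cogenerator property has to be tested on these only.\<close>

definition injective_module :: "('a, 'r) ring_scheme \<Rightarrow> ('a, 'b, 's) module_scheme \<Rightarrow> bool" where
  "injective_module R E \<longleftrightarrow> Module.module R E \<and>
     (\<forall>(M :: ('a, 'a set) module) (N :: ('a, 'a set) module) i g.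
        Module.module R M \<and> Module.module R N \<and> i \<in> module_homs R M N \<and> inj_on i (carrier M) \<and>
        g \<in> module_homs R M E \<longrightarrow>
        (\<exists>h\<in>module_homs R N E. \<forall>x\<in>carrier M. h (i x) = g x))"

definition injective_cogenerator :: "('a, 'r) ring_scheme \<Rightarrow> ('a, 'b, 's) module_scheme \<Rightarrow> bool" where
  "injective_cogenerator R E \<longleftrightarrow> injective_module R E \<and>
     (\<forall>M :: ('a, 'a set) module. Module.module R M \<and> carrier M \<noteq> {\<zero>\<^bsub>M\<^esub>} \<longrightarrow>
        (\<exists>h\<in>module_homs R M E. \<exists>x\<in>carrier M. h x \<noteq> \<zero>\<^bsub>E\<^esub>))"

text \<open>The fields \<^term>\<open>mult\<close> and \<^term>\<open>one\<close> of a module record have no meaning for modules.\<close>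

definition dist_module :: "'n::finite distribution set \<Rightarrow> ('n pdo, 'n distribution) module" where
  "dist_module F = \<lparr>carrier = F, mult = (\<lambda>_ _. 0), one = 0, zero = 0, add = (+), smult = pdo_act\<rparr>"

lemma dist_module_module:
  assumes F: "Modules.module.subspace pdo_act F"
  shows "Module.module ring_of_type_algebra (dist_module F)"
proof -
  interpret Modules.module "pdo_act :: 'a pdo \<Rightarrow> _" by (rule pdo_act_module)
  have "abelian_group (dist_module F)"
  proof (rule abelian_groupI)
    fix x assume "x \<in> carrier (dist_module F)"
    then show "\<exists>y\<in>carrier (dist_module F). y \<oplus>\<^bsub>dist_module F\<^esub> x = \<zero>\<^bsub>dist_module F\<^esub>"
      by (intro bexI[of _ "- x"]) (auto simp: dist_module_def subspace_neg[OF F])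
  qed (auto simp: dist_module_def subspace_add[OF F] subspace_0[OF F] algebra_simps)
  then show ?thesis
    by (intro moduleI cring_from_type_algebra)
      (auto simp: dist_module_def ring_of_type_algebra_def subspace_scale[OF F] algebra_simps)
qed


section \<open>Systems and controllability\<close>

definition kernel :: "'n::finite distribution set \<Rightarrow> ('n pdo ^ 'k::finite) set \<Rightarrow> ('n distribution ^ 'k) set" where
  "kernel F P = {f. (\<forall>j. f $ j \<in> F) \<and> (\<forall>p\<in>P. (\<Sum>j\<in>UNIV. pdo_act (p $ j) (f $ j)) = 0)}"

definition is_system :: "'n::finite distribution set \<Rightarrow> ('n distribution ^ 'k::finite) set \<Rightarrow> bool" where
  "is_system F B \<longleftrightarrow> (\<exists>P. Modules.module.subspace (*s) P \<and> B = kernel F P)"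

definition agree_on :: "(real^'n::finite) set \<Rightarrow> 'n distribution \<Rightarrow> 'n distribution \<Rightarrow> bool" where
  "agree_on W f g \<longleftrightarrow> (\<forall>\<phi>. test_fun \<phi> \<and> support \<phi> \<subseteq> W \<longrightarrow> dist_apply f \<phi> = dist_apply g \<phi>)"

definition agree_near :: "(real^'n::finite) set \<Rightarrow> 'n distribution \<Rightarrow> 'n distribution \<Rightarrow> bool" where
  "agree_near U f g \<longleftrightarrow> (\<exists>W. open W \<and> U \<subseteq> W \<and> agree_on W f g)"

definition vec_agree_near ::
  "(real^'n::finite) set \<Rightarrow> 'n distribution ^ 'k::finite \<Rightarrow> 'n distribution ^ 'k \<Rightarrow> bool" where
  "vec_agree_near U f g \<longleftrightarrow> (\<exists>W. open W \<and> U \<subseteq> W \<and> (\<forall>j. agree_on W (f $ j) (g $ j)))"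

definition admissible :: "'n::finite distribution set \<Rightarrow> (real^'n) set \<Rightarrow> (real^'n) set \<Rightarrow> bool" where
  "admissible F U1 U2 \<longleftrightarrow> U1 \<inter> U2 = {} \<and> closure U1 \<inter> closure U2 = {} \<and>
     (\<forall>f1\<in>F. \<forall>f2\<in>F. \<exists>f\<in>F. agree_near U1 f f1 \<and> agree_near U2 f f2)"

definition controllable :: "'n::finite distribution set \<Rightarrow> ('n distribution ^ 'k::finite) set \<Rightarrow> bool" where
  "controllable F B \<longleftrightarrow> (\<forall>U1 U2. admissible F U1 U2 \<longrightarrow>
     (\<forall>f1\<in>B. \<forall>f2\<in>B. \<exists>f\<in>B. vec_agree_near U1 f f1 \<and> vec_agree_near U2 f f2))"

definition uncontrollable :: "'n::finite distribution set \<Rightarrow> ('n distribution ^ 'k::finite) set \<Rightarrow> bool" where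
  "uncontrollable F B \<longleftrightarrow>
     (\<forall>B'. is_system F B' \<and> B' \<subseteq> B \<and> B' \<noteq> {0} \<longrightarrow> \<not> controllable F B')"

definition cutoff_assumption :: "'n::finite distribution set \<Rightarrow> bool" where
  "cutoff_assumption F \<longleftrightarrow> (\<forall>V. bounded V \<and> interior V \<noteq> {} \<longrightarrow>
     (\<exists>U. U \<noteq> {} \<and> closure U \<subseteq> interior V \<and> admissible F U (UNIV - V)))"


section \<open>Topologies\<close>

subsection \<open>The Zariski topology on an affine space\<close>

definition mpoly_eval :: "'v mpoly \<Rightarrow> ('v \<Rightarrow> complex) \<Rightarrow> complex" where
  "mpoly_eval p x = (\<Sum>m\<in>Poly_Mapping.keys p. Poly_Mapping.lookup p m *
     (\<Prod>v\<in>Poly_Mapping.keys m. x v ^ Poly_Mapping.lookup m v))"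

definition mpolys_in :: "'v set \<Rightarrow> 'v mpoly set" where
  "mpolys_in V = {p. \<forall>m\<in>Poly_Mapping.keys p. Poly_Mapping.keys m \<subseteq> V}"

text \<open>The affine space \<open>\<complex>\<^sup>V\<close> with coordinates \<open>V\<close> is \<^term>\<open>V \<rightarrow>\<^sub>E (UNIV :: complex set)\<close>.\<close>

definition zero_locus :: "'v set \<Rightarrow> 'v mpoly set \<Rightarrow> ('v \<Rightarrow> complex) set" where
  "zero_locus V S = {x \<in> V \<rightarrow>\<^sub>E UNIV. \<forall>p\<in>S. mpoly_eval p x = 0}"

definition zariski :: "'v set \<Rightarrow> ('v \<Rightarrow> complex) topology" where
  "zariski V = topology (\<lambda>W. \<exists>S\<subseteq>mpolys_in V. W = (V \<rightarrow>\<^sub>E UNIV) - zero_locus V S)"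

lemma mpoly_eval_superset:
  "finite S \<Longrightarrow> Poly_Mapping.keys p \<subseteq> S \<Longrightarrow> mpoly_eval p x = (\<Sum>m\<in>S. Poly_Mapping.lookup p m *
     (\<Prod>v\<in>Poly_Mapping.keys m. x v ^ Poly_Mapping.lookup m v))"
  unfolding mpoly_eval_def by (rule sum.mono_neutral_left) (auto simp: in_keys_iff)

lemma mpoly_eval_add: "mpoly_eval (p + q) x = mpoly_eval p x + mpoly_eval q x"
  using keys_add[of p q]
  by (simp add: mpoly_eval_superset[of "Poly_Mapping.keys p \<union> Poly_Mapping.keys q"] lookup_add
      distrib_right sum.distrib)

lemma monom_eval_superset:
  assumes "finite S" "Poly_Mapping.keys m \<subseteq> S"
  shows "(\<Prod>v\<in>Poly_Mapping.keys m. (x v :: complex) ^ Poly_Mapping.lookup m v) = (\<Prod>v\<in>S. x v ^ Poly_Mapping.lookup m v)"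
  using assms by (intro prod.mono_neutral_left) (auto simp: in_keys_iff)

lemma monom_eval_add:
  fixes m m' :: "'v \<Rightarrow>\<^sub>0 nat" and x :: "'v \<Rightarrow> complex"
  shows "(\<Prod>v\<in>Poly_Mapping.keys (m + m'). x v ^ Poly_Mapping.lookup (m + m') v) =
    (\<Prod>v\<in>Poly_Mapping.keys m. x v ^ Poly_Mapping.lookup m v) *
    (\<Prod>v\<in>Poly_Mapping.keys m'. x v ^ Poly_Mapping.lookup m' v)"
proof -
  let ?S = "Poly_Mapping.keys m \<union> Poly_Mapping.keys m'"
  have "(\<Prod>v\<in>Poly_Mapping.keys (m + m'). x v ^ Poly_Mapping.lookup (m + m') v) =
      (\<Prod>v\<in>?S. x v ^ Poly_Mapping.lookup (m + m') v)"
    using keys_add[of m m'] by (intro monom_eval_superset) auto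
  also have "\<dots> = (\<Prod>v\<in>?S. x v ^ Poly_Mapping.lookup m v) * (\<Prod>v\<in>?S. x v ^ Poly_Mapping.lookup m' v)"
    by (simp add: lookup_add power_add prod.distrib)
  also have "(\<Prod>v\<in>?S. x v ^ Poly_Mapping.lookup m v) = (\<Prod>v\<in>Poly_Mapping.keys m. x v ^ Poly_Mapping.lookup m v)"
    by (intro monom_eval_superset[symmetric]) auto
  also have "(\<Prod>v\<in>?S. x v ^ Poly_Mapping.lookup m' v) = (\<Prod>v\<in>Poly_Mapping.keys m'. x v ^ Poly_Mapping.lookup m' v)"
    by (intro monom_eval_superset[symmetric]) auto
  finally show ?thesis .
qed

lemma mpoly_eval_single:
  "mpoly_eval (Poly_Mapping.single m c) x = c * (\<Prod>v\<in>Poly_Mapping.keys m. x v ^ Poly_Mapping.lookup m v)"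
  by (simp add: mpoly_eval_superset[of "{m}"] lookup_single)

lemma mpoly_eval_mult: "mpoly_eval (p * q) x = mpoly_eval p x * mpoly_eval q x"
proof (rule additive_eqI[of "\<lambda>p. mpoly_eval (p * q) x" "\<lambda>p. mpoly_eval p x * mpoly_eval q x"])
  fix m :: "'a \<Rightarrow>\<^sub>0 nat" and c :: complex
  let ?p = "Poly_Mapping.single m c"
  show "mpoly_eval (?p * q) x = mpoly_eval ?p x * mpoly_eval q x"
    by (rule additive_eqI[of "\<lambda>q. mpoly_eval (?p * q) x" "\<lambda>q. mpoly_eval ?p x * mpoly_eval q x"])
      (simp_all add: distrib_left mpoly_eval_add mult_single mpoly_eval_single monom_eval_add)
qed (simp_all add: distrib_right mpoly_eval_add)

lemma mpolys_in_mult: "p \<in> mpolys_in V \<Longrightarrow> q \<in> mpolys_in V \<Longrightarrow> p * q \<in> mpolys_in V"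
proof -
  assume p: "p \<in> mpolys_in V" and q: "q \<in> mpolys_in V"
  have "Poly_Mapping.keys m \<subseteq> V" if m: "m \<in> Poly_Mapping.keys (p * q)" for m
  proof -
    obtain a b where "m = a + b" "a \<in> Poly_Mapping.keys p" "b \<in> Poly_Mapping.keys q"
      using subsetD[OF keys_mult m] by auto
    then show ?thesis using p q keys_add[of a b] unfolding mpolys_in_def by blast
  qed
  then show ?thesis by (simp add: mpolys_in_def)
qed

lemma istopology_zariski: "istopology (\<lambda>W. \<exists>S\<subseteq>mpolys_in V. W = (V \<rightarrow>\<^sub>E UNIV) - zero_locus V S)"
  unfolding istopology_def
proof (intro conjI allI impI)
  fix W W'
  assume "\<exists>S\<subseteq>mpolys_in V. W = (V \<rightarrow>\<^sub>E UNIV) - zero_locus V S" "\<exists>S\<subseteq>mpolys_in V. W' = (V \<rightarrow>\<^sub>E UNIV) - zero_locus V S"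
  then obtain S S' where S: "S \<subseteq> mpolys_in V" "W = (V \<rightarrow>\<^sub>E UNIV) - zero_locus V S"
    "S' \<subseteq> mpolys_in V" "W' = (V \<rightarrow>\<^sub>E UNIV) - zero_locus V S'" by blast
  show "\<exists>T\<subseteq>mpolys_in V. W \<inter> W' = (V \<rightarrow>\<^sub>E UNIV) - zero_locus V T"
  proof (intro exI conjI)
    show "{p * q |p q. p \<in> S \<and> q \<in> S'} \<subseteq> mpolys_in V" using S mpolys_in_mult by blast
    show "W \<inter> W' = (V \<rightarrow>\<^sub>E UNIV) - zero_locus V {p * q |p q. p \<in> S \<and> q \<in> S'}"
      unfolding S zero_locus_def by (auto simp: mpoly_eval_mult) (metis mpoly_eval_mult mult_eq_0_iff)
  qed
next
  fix \<W> assume "\<forall>W\<in>\<W>. \<exists>S\<subseteq>mpolys_in V. W = (V \<rightarrow>\<^sub>E UNIV) - zero_locus V S"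
  then obtain S where S: "\<And>W. W \<in> \<W> \<Longrightarrow> S W \<subseteq> mpolys_in V \<and> W = (V \<rightarrow>\<^sub>E UNIV) - zero_locus V (S W)"
    by metis
  show "\<exists>T\<subseteq>mpolys_in V. \<Union>\<W> = (V \<rightarrow>\<^sub>E UNIV) - zero_locus V T"
  proof (intro exI conjI)
    show "(\<Union>W\<in>\<W>. S W) \<subseteq> mpolys_in V" using S by blast
    have "\<Union>\<W> = (\<Union>W\<in>\<W>. (V \<rightarrow>\<^sub>E UNIV) - zero_locus V (S W))" using S by blast
    also have "\<dots> = (V \<rightarrow>\<^sub>E UNIV) - zero_locus V (\<Union>W\<in>\<W>. S W)" unfolding zero_locus_def by blast
    finally show "\<Union>\<W> = (V \<rightarrow>\<^sub>E UNIV) - zero_locus V (\<Union>W\<in>\<W>. S W)" .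
  qed
qed

lemma openin_zariski:
  "openin (zariski V) W \<longleftrightarrow> (\<exists>S\<subseteq>mpolys_in V. W = (V \<rightarrow>\<^sub>E UNIV) - zero_locus V S)"
  unfolding zariski_def by (simp add: topology_inverse'[OF istopology_zariski])

lemma topspace_zariski: "topspace (zariski V) = V \<rightarrow>\<^sub>E UNIV"
proof
  show "topspace (zariski V) \<subseteq> V \<rightarrow>\<^sub>E UNIV"
    using openin_topspace[of "zariski V"] unfolding openin_zariski by blast
  have "{1} \<subseteq> mpolys_in V" "V \<rightarrow>\<^sub>E UNIV = (V \<rightarrow>\<^sub>E UNIV) - zero_locus V {1}"
    by (auto simp: mpolys_in_def zero_locus_def mpoly_eval_single simp flip: single_one)
  then have "openin (zariski V) (V \<rightarrow>\<^sub>E UNIV)" unfolding openin_zariski by blast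
  then show "V \<rightarrow>\<^sub>E UNIV \<subseteq> topspace (zariski V)" by (rule openin_subset)
qed


subsection \<open>Matrices\<close>

definition multi_degree :: "('n::finite \<Rightarrow>\<^sub>0 nat) \<Rightarrow> nat" where
  "multi_degree \<alpha> = (\<Sum>j\<in>UNIV. Poly_Mapping.lookup \<alpha> j)"

definition bounded_matrices :: "nat \<Rightarrow> ('n::finite pdo ^ 'k::finite ^ 'l::finite) set" where
  "bounded_matrices d = {M. \<forall>i j. \<forall>\<alpha>\<in>Poly_Mapping.keys (M $ i $ j). multi_degree \<alpha> \<le> d}"

definition matrix_indices :: "nat \<Rightarrow> ('l \<times> 'k \<times> ('n::finite \<Rightarrow>\<^sub>0 nat)) set" where
  "matrix_indices d = UNIV \<times> UNIV \<times> {\<alpha>. multi_degree \<alpha> \<le> d}"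

definition matrix_coords ::
  "nat \<Rightarrow> 'n::finite pdo ^ 'k::finite ^ 'l::finite \<Rightarrow> 'l \<times> 'k \<times> ('n \<Rightarrow>\<^sub>0 nat) \<Rightarrow> complex" where
  "matrix_coords d M = (\<lambda>(i, j, \<alpha>)\<in>matrix_indices d. Poly_Mapping.lookup (M $ i $ j) \<alpha>)"

definition bounded_matrix_topology :: "nat \<Rightarrow> ('n::finite pdo ^ 'k::finite ^ 'l::finite) topology" where
  "bounded_matrix_topology d =
     pullback_topology (bounded_matrices d) (matrix_coords d) (zariski (matrix_indices d))"

definition matrix_topology :: "('n::finite pdo ^ 'k::finite ^ 'l::finite) topology" where
  "matrix_topology =
     topology (\<lambda>W. \<forall>d. openin (bounded_matrix_topology d) (W \<inter> bounded_matrices d))"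

lemma bij_betw_matrix_coords:
  "bij_betw (matrix_coords d) (bounded_matrices d :: ('n::finite pdo ^ 'k::finite ^ 'l::finite) set)
     (matrix_indices d \<rightarrow>\<^sub>E UNIV)"
  unfolding bij_betw_def
proof
  show "inj_on (matrix_coords d) (bounded_matrices d :: ('n pdo ^ 'k ^ 'l) set)"
  proof (rule inj_onI)
    fix M N :: "'n pdo ^ 'k ^ 'l"
    assume M: "M \<in> bounded_matrices d" and N: "N \<in> bounded_matrices d"
      and eq: "matrix_coords d M = matrix_coords d N"
    have "Poly_Mapping.lookup (M $ i $ j) \<alpha> = Poly_Mapping.lookup (N $ i $ j) \<alpha>" for i j \<alpha>
    proof (cases "multi_degree \<alpha> \<le> d")
      case True
      then show ?thesis
        using fun_cong[OF eq, of "(i, j, \<alpha>)"] by (simp add: matrix_coords_def matrix_indices_def)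
    next
      case False
      then have "\<alpha> \<notin> Poly_Mapping.keys (M $ i $ j)" "\<alpha> \<notin> Poly_Mapping.keys (N $ i $ j)"
        using M N unfolding bounded_matrices_def by blast+
      then show ?thesis by (simp add: in_keys_iff)
    qed
    then show "M = N" by (simp add: vec_eq_iff poly_mapping_eqI)
  qed
  show "matrix_coords d ` (bounded_matrices d :: ('n pdo ^ 'k ^ 'l) set) = matrix_indices d \<rightarrow>\<^sub>E UNIV"
  proof (intro equalityI subsetI)
    fix x :: "'l \<times> 'k \<times> ('n \<Rightarrow>\<^sub>0 nat) \<Rightarrow> complex" assume x: "x \<in> matrix_indices d \<rightarrow>\<^sub>E UNIV"
    have "{\<alpha>. multi_degree \<alpha> \<le> d} \<subseteq> Poly_Mapping.lookup -` {f :: 'n \<Rightarrow> nat. \<forall>j. f j \<in> {..d}}"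
    proof (clarsimp simp: multi_degree_def)
      fix \<alpha> :: "'n \<Rightarrow>\<^sub>0 nat" and j
      assume "(\<Sum>j\<in>UNIV. Poly_Mapping.lookup \<alpha> j) \<le> d"
      then show "Poly_Mapping.lookup \<alpha> j \<le> d"
        using member_le_sum[of j UNIV "Poly_Mapping.lookup \<alpha>"] by simp
    qed
    moreover have "finite {f :: 'n \<Rightarrow> nat. \<forall>j. f j \<in> {..d}}"
      using finite_PiE[of "UNIV :: 'n set" "\<lambda>_. {..d}"] by (simp add: PiE_def Pi_def extensional_def)
    ultimately have fin: "finite {\<alpha> :: 'n \<Rightarrow>\<^sub>0 nat. multi_degree \<alpha> \<le> d}"
      by (rule finite_subset[OF _ finite_vimageI]) (simp add: inj_def poly_mapping.lookup_inject)
    have fin': "finite {\<alpha>. (if multi_degree \<alpha> \<le> d then x (i, j, \<alpha>) else 0) \<noteq> 0}" for i j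
      by (rule finite_subset[OF _ fin]) auto
    define M :: "'n pdo ^ 'k ^ 'l" where
      "M = (\<chi> i j. Abs_poly_mapping (\<lambda>\<alpha>. if multi_degree \<alpha> \<le> d then x (i, j, \<alpha>) else 0))"
    have M: "Poly_Mapping.lookup (M $ i $ j) \<alpha> = (if multi_degree \<alpha> \<le> d then x (i, j, \<alpha>) else 0)" for i j \<alpha>
      unfolding M_def using fin'[of i j] by (simp add: Abs_poly_mapping_inverse)
    have "M \<in> bounded_matrices d" by (auto simp: bounded_matrices_def in_keys_iff M split: if_splits)
    moreover have "matrix_coords d M = x"
      using x by (auto simp: matrix_coords_def M fun_eq_iff matrix_indices_def PiE_def extensional_def)
    ultimately show "x \<in> matrix_coords d ` bounded_matrices d" by blast
  qed (auto simp: matrix_coords_def)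
qed

lemma topspace_bounded_matrix_topology: "topspace (bounded_matrix_topology d) = bounded_matrices d"
  using bij_betw_matrix_coords[of d]
  by (auto simp: bounded_matrix_topology_def topspace_pullback_topology topspace_zariski bij_betw_def)

lemma istopology_matrix:
  "istopology (\<lambda>W :: ('n::finite pdo ^ 'k::finite ^ 'l::finite) set.
     \<forall>d. openin (bounded_matrix_topology d) (W \<inter> bounded_matrices d))"
  unfolding istopology_def
proof (intro conjI allI impI)
  fix W W' :: "('n pdo ^ 'k ^ 'l) set" and d
  assume "\<forall>d. openin (bounded_matrix_topology d) (W \<inter> bounded_matrices d)"
    "\<forall>d. openin (bounded_matrix_topology d) (W' \<inter> bounded_matrices d)"
  then have "openin (bounded_matrix_topology d) ((W \<inter> bounded_matrices d) \<inter> (W' \<inter> bounded_matrices d))"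
    by blast
  then show "openin (bounded_matrix_topology d) (W \<inter> W' \<inter> bounded_matrices d)"
    by (rule back_subst[of "openin _"]) blast
next
  fix \<W> :: "('n pdo ^ 'k ^ 'l) set set" and d
  assume "\<forall>W\<in>\<W>. \<forall>d. openin (bounded_matrix_topology d) (W \<inter> bounded_matrices d)"
  then have "openin (bounded_matrix_topology d) (\<Union>W\<in>\<W>. W \<inter> bounded_matrices d)" by blast
  then show "openin (bounded_matrix_topology d) (\<Union>\<W> \<inter> bounded_matrices d)"
    by (rule back_subst[of "openin _"]) blast
qed

lemma openin_matrix_topology:
  "openin matrix_topology W \<longleftrightarrow> (\<forall>d. openin (bounded_matrix_topology d) (W \<inter> bounded_matrices d))"
  unfolding matrix_topology_def by (simp add: topology_inverse'[OF istopology_matrix])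

lemma topspace_matrix_topology: "topspace matrix_topology = UNIV"
proof -
  have "openin matrix_topology UNIV"
    by (simp add: openin_matrix_topology flip: topspace_bounded_matrix_topology)
  then show ?thesis using openin_subset by blast
qed


subsection \<open>Submodules and systems\<close>

definition quotient_topology :: "'a topology \<Rightarrow> ('a \<Rightarrow> 'b) \<Rightarrow> 'b topology" where
  "quotient_topology T f =
     topology (\<lambda>W. W \<subseteq> f ` topspace T \<and> openin T {x \<in> topspace T. f x \<in> W})"

lemma istopology_quotient:
  "istopology (\<lambda>W. W \<subseteq> f ` topspace T \<and> openin T {x \<in> topspace T. f x \<in> W})"
  unfolding istopology_def
proof (intro conjI allI impI)
  fix W W'
  assume "W \<subseteq> f ` topspace T \<and> openin T {x \<in> topspace T. f x \<in> W}"
    "W' \<subseteq> f ` topspace T \<and> openin T {x \<in> topspace T. f x \<in> W'}"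
  then have "openin T ({x \<in> topspace T. f x \<in> W} \<inter> {x \<in> topspace T. f x \<in> W'})" "W \<subseteq> f ` topspace T"
    by blast+
  then show "W \<inter> W' \<subseteq> f ` topspace T" "openin T {x \<in> topspace T. f x \<in> W \<inter> W'}"
    by (blast, elim back_subst[of "openin T"], blast)
next
  fix \<W> assume *: "\<forall>W\<in>\<W>. W \<subseteq> f ` topspace T \<and> openin T {x \<in> topspace T. f x \<in> W}"
  then show "\<Union>\<W> \<subseteq> f ` topspace T" by blast
  have "openin T (\<Union>W\<in>\<W>. {x \<in> topspace T. f x \<in> W})" using * by blast
  then show "openin T {x \<in> topspace T. f x \<in> \<Union>\<W>}" by (rule back_subst[of "openin T"]) blast
qed

lemma openin_quotient_topology:
  "openin (quotient_topology T f) W \<longleftrightarrow> W \<subseteq> f ` topspace T \<and> openin T {x \<in> topspace T. f x \<in> W}"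
  unfolding quotient_topology_def by (simp add: topology_inverse'[OF istopology_quotient])

lemma topspace_quotient_topology: "topspace (quotient_topology T f) = f ` topspace T"
proof
  show "topspace (quotient_topology T f) \<subseteq> f ` topspace T"
    using openin_topspace[of "quotient_topology T f"] unfolding openin_quotient_topology by blast
  have "{x \<in> topspace T. f x \<in> f ` topspace T} = topspace T" by blast
  then have "openin (quotient_topology T f) (f ` topspace T)"
    unfolding openin_quotient_topology by simp
  then show "f ` topspace T \<subseteq> topspace (quotient_topology T f)" by (rule openin_subset)
qed

definition row_module :: "'n::finite pdo ^ 'k::finite ^ 'l::finite \<Rightarrow> ('n pdo ^ 'k) set" where
  "row_module M = Modules.module.span (*s) (rows M)"

text \<open>\<open>\<S>\<^sub>\<ell>\<^sub>,\<^sub>k\<close> and \<open>\<B>\<^sub>\<ell>\<^sub>,\<^sub>k\<close>, where \<open>\<ell>\<close> and \<open>k\<close> are the cardinalities of \<open>'l\<close> and \<open>'k\<close>. The topology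
  of \<open>\<B>\<^sub>\<ell>\<^sub>,\<^sub>k\<close> is transported along \<^term>\<open>kernel F\<close>; as this map is a bijection for an injective
  cogenerator \<open>F\<close>, the quotient topology is the transported one.\<close>

definition submodule_topology :: "'l::finite itself \<Rightarrow> ('n::finite pdo ^ 'k::finite) set topology" where
  "submodule_topology _ =
     quotient_topology (matrix_topology :: ('n pdo ^ 'k ^ 'l) topology) row_module"

definition system_topology ::
  "'l::finite itself \<Rightarrow> 'n::finite distribution set \<Rightarrow> ('n distribution ^ 'k::finite) set topology" where
  "system_topology l F = quotient_topology (submodule_topology l) (kernel F)"

lemma topspace_system_topology:
  "topspace (system_topology (l :: 'l::finite itself) F) =
     {kernel F (row_module M) |M :: 'n::finite pdo ^ 'k::finite ^ 'l. True}"
  by (auto simp: system_topology_def submodule_topology_def topspace_quotient_topology topspace_matrix_topology)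

definition uncontrollable_systems ::
  "'l::finite itself \<Rightarrow> 'n::finite distribution set \<Rightarrow> ('n distribution ^ 'k::finite) set set" where
  "uncontrollable_systems l F = {B \<in> topspace (system_topology l F). uncontrollable F B}"

definition generic_in :: "'a topology \<Rightarrow> 'a set \<Rightarrow> bool" where
  "generic_in T S \<longleftrightarrow> S \<subseteq> topspace T \<and> (\<exists>U\<subseteq>S. openin T U \<and> T closure_of U = topspace T)"

end

theory Submission
  imports Defs
begin

text \<open>The system of a matrix \<open>M\<close> is uncontrollable iff \<open>M\<close> has rank \<open>k\<close>, that is, iff some \<open>k \<times> k\<close>
  minor is a nonzero polynomial; that condition is Zariski open, and dense because \<open>\<ell> \<ge> k\<close>.

  If the rank is smaller, a nonzero \<open>q\<close> is orthogonal to all rows, and injectivity identifies the kernel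
  of \<open>{p. p \<cdot> q = 0}\<close> with \<open>q(D)F\<close>, a nonzero sub-system in which patching is done on the potential.

  If some minor \<open>a\<close> is nonzero, it annihilates every component of every element of the system. A nonzero
  sub-system contains, by the Nullstellensatz, a nonzero vector of multiples of one exponential \<open>\<phi>\<close>.
  Were the sub-system controllable, the cutoff assumption would give an element agreeing with this vector
  near a nonempty \<open>U\<close> and vanishing outside a ball. A compactly supported distribution killed by
  \<open>a \<noteq> 0\<close> is zero, because it annihilates all exponentials and these are dense in the smooth functions. So
  \<open>\<phi>\<close> would vanish near \<open>U\<close>; being an eigenvector of all translations it would be zero.\<close>

section \<open>Polynomials and their values\<close>

text \<open>The cutoff assumption provides only some nonempty \<open>U\<close>, whose position in
  the ball is not under control, and an arbitrary element of a system may vanish near it. A vector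
  is therefore needed with a component that cannot vanish on any nonempty open set; a joint
  eigenvector of the operators \<open>D_j\<close> has this property. It is never identified with an
  actual exponential function: only its eigenvalue equations are used, which turn translation along
  an axis into an ordinary differential equation.

  Injectivity of \<open>a\<close> on compactly supported distributions is an argument on the Laplace
  transform. For real \<open>s\<close> the value u(exp(s.x)) is defined through a cutoff, and
  \<open>a u = 0\<close> gives a(\<i> s) u(exp(s.x)) = 0. On a suitable line through
  \<open>s\<close> the polynomial has finitely many zeros, and the transform is continuous along
  that line, so it vanishes at \<open>s\<close> too. Real exponentials span an algebra that
  separates points, which is what Stone-Weierstrass asks for; that theorem controls values only, and
  a convolution turns this into control of all derivatives.\<close>

abbreviation mpoly_const :: "complex \<Rightarrow> 'v mpoly" where
  "mpoly_const c \<equiv> Poly_Mapping.single 0 c"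

abbreviation mpoly_var :: "'v \<Rightarrow> 'v mpoly" where
  "mpoly_var v \<equiv> Poly_Mapping.single (Poly_Mapping.single v (Suc 0)) 1"

lemma mpoly_var_power: "mpoly_var v ^ k = Poly_Mapping.single (Poly_Mapping.single v k) 1"
  by (induction k) (simp_all add: mult_single flip: single_add)

text \<open>Constants and variables generate the polynomials as a ring, so a property stable under
  sums and products is checked on a single \<open>D_j\<close> instead of on monomials.\<close>

lemma mpoly_induct [case_names const var add mult]:
  fixes p :: "'v mpoly"
  assumes const: "\<And>c. P (mpoly_const c)" and var: "\<And>v. P (mpoly_var v)"
    and add: "\<And>p q. P p \<Longrightarrow> P q \<Longrightarrow> P (p + q)" and mult: "\<And>p q. P p \<Longrightarrow> P q \<Longrightarrow> P (p * q)"
  shows "P p"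
proof -
  have one: "P 1" using const[of 1] unfolding single_one .
  have power: "P (p ^ k)" if "P p" for p k
    by (induction k) (simp_all add: one mult that)
  have monom: "P (Poly_Mapping.single m 1)" for m :: "'v \<Rightarrow>\<^sub>0 nat"
  proof (induction m rule: update_induct)
    case const
    show ?case by (simp add: one)
  next
    case (update m v k)
    have "Poly_Mapping.update v k m = Poly_Mapping.single v k + m"
      using update(1) by (intro poly_mapping_eqI) (auto simp: lookup_add lookup_single lookup_update when_def in_keys_iff)
    then have "Poly_Mapping.single (Poly_Mapping.update v k m) 1 = mpoly_var v ^ k * Poly_Mapping.single m (1::complex)"
      by (simp add: mpoly_var_power mult_single)
    then show ?case using mult[OF power[OF var] update(3)] by simp
  qed
  have single: "P (Poly_Mapping.single m c)" for m c
    using mult[OF const[of c] monom[of m]] by (simp add: mult_single)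
  have "P (\<Sum>m\<in>S. Poly_Mapping.single m (Poly_Mapping.lookup p m))" if "finite S" for S
    using that by (induction S rule: finite_induct) (use const[of 0] add single in auto)
  from this[OF finite_keys, of p] show ?thesis by (simp flip: poly_mapping_sum_single)
qed

lemma mpoly_eval_const [simp]: "mpoly_eval (mpoly_const c) x = c"
  by (simp add: mpoly_eval_single)

lemma mpoly_eval_var [simp]: "mpoly_eval (mpoly_var v) x = x v"
  by (simp add: mpoly_eval_single)

lemma mpoly_eval_0 [simp]: "mpoly_eval 0 x = 0"
  by (simp add: mpoly_eval_def)

lemma mpoly_eval_1 [simp]: "mpoly_eval 1 x = 1"
  by (simp flip: single_one)

lemma mpoly_eval_uminus [simp]: "mpoly_eval (- p) x = - mpoly_eval p x"
  using mpoly_eval_add[of p "- p" x] by (simp add: add_eq_0_iff)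

lemma mpoly_eval_diff [simp]: "mpoly_eval (p - q) x = mpoly_eval p x - mpoly_eval q x"
  using mpoly_eval_add[of p "- q" x] by simp

declare mpoly_eval_add [simp] mpoly_eval_mult [simp]

lemma mpoly_eval_sum: "mpoly_eval (\<Sum>i\<in>I. f i) x = (\<Sum>i\<in>I. mpoly_eval (f i) x)"
  by (induction I rule: infinite_finite_induct) auto

lemma mpoly_eval_prod: "mpoly_eval (\<Prod>i\<in>I. f i) x = (\<Prod>i\<in>I. mpoly_eval (f i) x)"
  by (induction I rule: infinite_finite_induct) auto

lemma mpoly_eval_det:
  "mpoly_eval (det (A :: 'v mpoly ^ 'a ^ 'a)) x = det (\<chi> i j. mpoly_eval (A $ i $ j) x)"
proof -
  have [simp]: "mpoly_eval (of_int (sign \<pi>)) x = of_int (sign \<pi>)" for \<pi> :: "'a \<Rightarrow> 'a"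
    by (simp add: sign_def)
  show ?thesis by (simp add: det_def mpoly_eval_sum mpoly_eval_prod)
qed

text \<open>Restriction to a line turns non-vanishing into a question about finitely many roots in
  one variable. Both the density of full rank and the vanishing of the Laplace transform rest on
  this.\<close>

lemma mpoly_eval_line: "\<exists>q :: complex poly. \<forall>t. mpoly_eval p (\<lambda>v. x v + t * y v) = poly q t"
proof (induction p rule: mpoly_induct)
  case (const c)
  show ?case by (intro exI[of _ "[:c:]"]) simp
next
  case (var v)
  show ?case by (intro exI[of _ "[:x v, y v:]"]) simp
next
  case (add p q)
  then obtain a b where "\<forall>t. mpoly_eval p (\<lambda>v. x v + t * y v) = poly a t"
    "\<forall>t. mpoly_eval q (\<lambda>v. x v + t * y v) = poly b t" by blast
  then show ?case by (intro exI[of _ "a + b"]) simp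
next
  case (mult p q)
  then obtain a b where "\<forall>t. mpoly_eval p (\<lambda>v. x v + t * y v) = poly a t"
    "\<forall>t. mpoly_eval q (\<lambda>v. x v + t * y v) = poly b t" by blast
  then show ?case by (intro exI[of _ "a * b"]) simp
qed

text \<open>Digits in base \<open>N\<close> are unique: the lowest one is the residue mod
  \<open>N\<close>, and division by \<open>N\<close> shifts the others down.\<close>

lemma base_expansion_unique:
  fixes a b :: "nat \<Rightarrow> nat"
  assumes "\<And>i. i < m \<Longrightarrow> a i < N" "\<And>i. i < m \<Longrightarrow> b i < N"
    and "(\<Sum>i<m. a i * N ^ i) = (\<Sum>i<m. b i * N ^ i)" "i < m"
  shows "a i = b i"
  using assms
proof (induction m arbitrary: a b i)
  case (Suc m)
  have split: "(\<Sum>i<Suc m. c i * N ^ i) = c 0 + N * (\<Sum>i<m. c (Suc i) * N ^ i)" for c :: "nat \<Rightarrow> nat"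
    by (subst sum.lessThan_Suc_shift) (simp add: sum_distrib_left mult.left_commute)
  have eq: "a 0 + N * (\<Sum>i<m. a (Suc i) * N ^ i) = b 0 + N * (\<Sum>i<m. b (Suc i) * N ^ i)"
    using Suc.prems(3) unfolding split .
  have lt: "a 0 < N" "b 0 < N" using Suc.prems by auto
  have 0: "a 0 = b 0" using arg_cong[OF eq, of "\<lambda>k. k mod N"] lt by simp
  have "N > 0" using lt by simp
  then have "(\<Sum>i<m. a (Suc i) * N ^ i) = (\<Sum>i<m. b (Suc i) * N ^ i)" using eq 0 by simp
  then have "a (Suc i) = b (Suc i)" if "i < m" for i
    using Suc.IH[of "\<lambda>i. a (Suc i)" "\<lambda>i. b (Suc i)" i] Suc.prems(1,2) that by auto
  then show ?case using 0 Suc.prems(4) by (cases i) auto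
qed simp

text \<open>Kronecker substitution: along \<open>x\<^sub>j = c t\<^bsup>N\<^sup>j\<^esup>\<close> with large \<open>N\<close> distinct monomials have
  distinct degrees in \<open>t\<close>.\<close>

lemma mpoly_nonzero_value:
  fixes p :: "'v::finite mpoly"
  assumes "p \<noteq> 0" "c \<noteq> 0"
  obtains r :: "'v \<Rightarrow> real" where "mpoly_eval p (\<lambda>v. c * of_real (r v)) \<noteq> 0"
proof -
  let ?K = "Poly_Mapping.keys p" and ?L = "Poly_Mapping.lookup"
  define n where "n = CARD('v)"
  obtain e :: "nat \<Rightarrow> 'v" where e: "bij_betw e {..<n} UNIV"
    using ex_bij_betw_nat_finite[of "UNIV :: 'v set"] unfolding n_def by (auto simp: lessThan_atLeast0)
  \<comment> \<open>\<open>N\<close> exceeds every exponent occurring in \<open>p\<close>, so the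
    exponents of a monomial are the base \<open>N\<close> digits of its degree
    \<open>d m\<close>.\<close>
  define N where "N = Suc (\<Sum>m\<in>?K. \<Sum>v\<in>UNIV. ?L m v)"
  have N: "?L m v < N" if "m \<in> ?K" for m v
  proof -
    have "?L m v \<le> (\<Sum>v\<in>UNIV. ?L m v)" by (rule member_le_sum) auto
    also have "\<dots> \<le> (\<Sum>m\<in>?K. \<Sum>v\<in>UNIV. ?L m v)" by (rule member_le_sum[OF that]) auto
    finally show ?thesis by (simp add: N_def)
  qed
  define d where "d = (\<lambda>m. \<Sum>i<n. ?L m (e i) * N ^ i)"
  define f where "f = the_inv_into {..<n} e"
  have f: "f (e i) = i" if "i < n" for i
    unfolding f_def by (rule the_inv_into_f_f) (use e that in \<open>auto simp: bij_betw_def\<close>)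
  have inj: "inj_on d ?K"
  proof (rule inj_onI)
    fix m m' assume m: "m \<in> ?K" "m' \<in> ?K" "d m = d m'"
    have "?L m (e i) = ?L m' (e i)" if "i < n" for i
      by (rule base_expansion_unique[where N = N and m = n and a = "\<lambda>i. ?L m (e i)"])
        (use m N that in \<open>auto simp: d_def\<close>)
    moreover have "\<exists>i<n. v = e i" for v using e by (auto simp: bij_betw_def image_iff set_eq_iff)
    ultimately show "m = m'" by (intro poly_mapping_eqI) metis
  qed
  \<comment> \<open>\<open>p\<close> after the substitution, as a polynomial in \<open>t\<close>. As
    \<open>d\<close> is injective on the monomials, no two coefficients are added up, and powers of
    \<open>c\<close> are nonzero.\<close>
  define q where "q = (\<Sum>m\<in>?K. Polynomial.monom (?L p m * c ^ (\<Sum>v\<in>UNIV. ?L m v)) (d m))"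
  obtain m0 where m0: "m0 \<in> ?K" using assms(1) by (metis all_not_in_conv keys_eq_empty)
  have "Polynomial.coeff q (d m0) = (\<Sum>m\<in>?K. if m = m0 then ?L p m * c ^ (\<Sum>v\<in>UNIV. ?L m v) else 0)"
    unfolding q_def coeff_sum coeff_monom
    by (rule sum.cong) (use inj m0 in \<open>auto simp: inj_on_def\<close>)
  then have "Polynomial.coeff q (d m0) \<noteq> 0" using m0 assms(2) by (auto simp: in_keys_iff)
  then have "q \<noteq> 0" by auto
  then have "finite {t. poly q t = 0}" by (rule poly_roots_finite)
  \<comment> \<open>Infinitely many reals against finitely many roots: \<open>t\<close> can be taken
    real, which makes \<open>r\<close> real-valued.\<close>
  then have "\<not> range complex_of_real \<subseteq> {t. poly q t = 0}"
    using infinite_UNIV_char_0 finite_subset finite_imageD[OF _ inj_of_real] by blast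
  then obtain t :: real where t: "poly q (of_real t) \<noteq> 0" by auto
  let ?x = "\<lambda>v. c * of_real (t ^ (N ^ f v))"
  have "mpoly_eval p ?x = poly q (of_real t)"
    unfolding mpoly_eval_def q_def poly_sum poly_monom
  proof (rule sum.cong[OF refl])
    fix m
    have "(\<Prod>v\<in>Poly_Mapping.keys m. ?x v ^ ?L m v) = (\<Prod>v\<in>UNIV. ?x v ^ ?L m v)"
      by (rule monom_eval_superset) auto
    also have "\<dots> = c ^ (\<Sum>v\<in>UNIV. ?L m v) * (\<Prod>v\<in>UNIV. of_real t ^ (?L m v * N ^ f v))"
      by (simp add: power_mult_distrib prod.distrib power_sum mult.commute flip: power_mult)
    also have "(\<Prod>v\<in>UNIV. complex_of_real t ^ (?L m v * N ^ f v)) = (\<Prod>i<n. complex_of_real t ^ (?L m (e i) * N ^ i))"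
      using e by (intro prod.reindex_bij_betw_not_neutral[symmetric, of "{}" "{}", simplified] | subst prod.reindex_bij_betw[OF e, symmetric])+ (simp add: f)
    also have "\<dots> = of_real t ^ d m" by (simp add: d_def power_sum)
    finally show "?L p m * (\<Prod>v\<in>Poly_Mapping.keys m. ?x v ^ ?L m v) = ?L p m * c ^ (\<Sum>v\<in>UNIV. ?L m v) * of_real t ^ d m"
      by simp
  qed
  with t show thesis by (intro that[of "\<lambda>v. t ^ (N ^ f v)"]) simp
qed

lemma mpoly_eqI:
  fixes p :: "'v::finite mpoly"
  assumes "\<And>x. mpoly_eval p x = mpoly_eval q x"
  shows "p = q"
proof (rule ccontr)
  assume "p \<noteq> q"
  then have "p - q \<noteq> 0" by simp
  then obtain r :: "'v \<Rightarrow> real" where "mpoly_eval (p - q) (\<lambda>v. 1 * of_real (r v)) \<noteq> 0"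
    using mpoly_nonzero_value[of "p - q" 1] by auto
  then show False using assms by simp
qed

section \<open>Determinants and injective cogenerators\<close>

lemma module_vec: "Modules.module ((*s) :: 'a::comm_ring_1 \<Rightarrow> 'a ^ 'k \<Rightarrow> 'a ^ 'k)"
  by unfold_locales (simp_all add: vec_eq_iff algebra_simps)

text \<open>Row \<open>i\<close> of the cofactor matrix. Putting unit vectors into row
  \<open>i\<close> makes Laplace expansion an instance of linearity of \<open>det\<close> in that
  row.\<close>

definition cofactors :: "'a::comm_ring_1 ^ 'k ^ 'k::finite \<Rightarrow> 'k \<Rightarrow> 'a ^ 'k" where
  "cofactors N i = (\<chi> l. det (\<chi> i'. if i' = i then axis l 1 else N $ i'))"

lemma det_replace_row:
  "det (\<chi> i'. if i' = i then v else N $ i') = (\<Sum>l\<in>UNIV. v $ l * cofactors N i $ l)"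
proof -
  have v: "(\<Sum>l\<in>UNIV. v $ l *s axis l 1) = v"
    by (simp add: vec_eq_iff axis_def if_distrib [of "\<lambda>x. _ * x"] sum.delta cong: if_cong)
  have "det (\<chi> i'. if i' = i then v else N $ i') = det (\<chi> i'. if i' = i then (\<Sum>l\<in>UNIV. v $ l *s axis l 1) else N $ i')"
    by (simp only: v)
  also have "\<dots> = (\<Sum>l\<in>UNIV. det (\<chi> i'. if i' = i then v $ l *s axis l 1 else N $ i'))"
    by (rule det_linear_row_sum) simp
  also have "\<dots> = (\<Sum>l\<in>UNIV. v $ l * cofactors N i $ l)"
    by (simp add: cofactors_def det_row_mul)
  finally show ?thesis .
qed

text \<open>Row \<open>j\<close> of the identity adj(N) N = det(N) I: entry \<open>l\<close> is the
  determinant of \<open>N\<close> with column \<open>j\<close> replaced by column \<open>l\<close>,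
  which has two equal columns unless l = j.\<close>

lemma cofactor_row_combination:
  fixes N :: "'a::comm_ring_1 ^ 'k ^ 'k::finite"
  shows "(\<Sum>i\<in>UNIV. cofactors (transpose N) j $ i *s (N $ i)) = det N *s axis j 1"
proof (subst vec_eq_iff, rule allI)
  fix l
  have "(\<Sum>i\<in>UNIV. cofactors (transpose N) j $ i *s (N $ i)) $ l
      = (\<Sum>i\<in>UNIV. (\<chi> i. N $ i $ l) $ i * cofactors (transpose N) j $ i)"
    by (simp add: mult.commute)
  also have "\<dots> = det (\<chi> i'. if i' = j then (\<chi> i. N $ i $ l) else transpose N $ i')"
    by (rule det_replace_row[symmetric])
  also have "\<dots> = (det N *s axis j 1) $ l"
  proof (cases "l = j")
    case True
    have "(\<chi> i'. if i' = j then (\<chi> i. N $ i $ l) else transpose N $ i') = transpose N"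
      by (simp add: vec_eq_iff transpose_def True)
    then show ?thesis using True by simp
  next
    case False
    have "det (\<chi> i'. if i' = j then (\<chi> i. N $ i $ l) else transpose N $ i') = 0"
      by (rule det_identical_rows[of j l]) (use False in \<open>auto simp: row_def transpose_def\<close>)
    then show ?thesis using False by (simp add: axis_def)
  qed
  finally show "(\<Sum>i\<in>UNIV. cofactors (transpose N) j $ i *s (N $ i)) $ l = (det N *s axis j 1) $ l" .
qed

text \<open>Read as an equation of the system, this vector says that the minor annihilates component
  \<open>j\<close> of every solution.\<close>

lemma det_axis_in_row_module:
  fixes M :: "'n::finite pdo ^ 'k::finite ^ 'l::finite"
  shows "det (\<chi> i. M $ r i) *s axis j 1 \<in> row_module M"
proof -
  interpret Modules.module "(*s) :: 'n pdo \<Rightarrow> 'n pdo ^ 'k \<Rightarrow> _" by (rule module_vec)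
  let ?N = "(\<chi> i. M $ r i) :: 'n pdo ^ 'k ^ 'k"
  have "M $ r i \<in> span (rows M)" for i
    by (rule span_base) (auto simp: rows_def row_def vec_nth_inverse)
  then have "(\<Sum>i\<in>UNIV. cofactors (transpose ?N) j $ i *s (?N $ i)) \<in> span (rows M)"
    by (intro span_sum span_scale) simp
  then show ?thesis unfolding row_module_def cofactor_row_combination .
qed

text \<open>Among the square matrices of nonzero determinant whose rows are rows of \<open>M\<close> or unit vectors,
  take one with the most rows from \<open>M\<close>: the cofactors of a remaining unit row form a vector
  orthogonal to all rows of \<open>M\<close>.\<close>

lemma full_minor_or_orthogonal_vector:
  fixes M :: "'a::comm_ring_1 ^ 'k::finite ^ 'l::finite"
  assumes minors: "\<And>r. det (\<chi> i. M $ r i) = 0"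
  obtains q where "q \<noteq> 0" "\<And>i. (\<Sum>j\<in>UNIV. M $ i $ j * q $ j) = 0"
proof -
  define N :: "('k \<Rightarrow> 'l + 'k) \<Rightarrow> 'a ^ 'k ^ 'k" where
    "N = (\<lambda>\<rho>. \<chi> i. case \<rho> i of Inl m \<Rightarrow> M $ m | Inr j \<Rightarrow> axis j 1)"
  define c :: "('k \<Rightarrow> 'l + 'k) \<Rightarrow> nat" where "c = (\<lambda>\<rho>. card {i. \<exists>m. \<rho> i = Inl m})"
  have "N Inr = mat 1" by (simp add: N_def mat_def vec_eq_iff axis_def)
  then have "det (N Inr) \<noteq> 0" by simp
  moreover have "\<forall>\<rho>. det (N \<rho>) \<noteq> 0 \<longrightarrow> c \<rho> < Suc CARD('k)"
    unfolding c_def by (auto intro!: card_mono le_imp_less_Suc)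
  ultimately obtain \<rho> where \<rho>: "det (N \<rho>) \<noteq> 0" "\<And>\<sigma>. det (N \<sigma>) \<noteq> 0 \<Longrightarrow> c \<sigma> \<le> c \<rho>"
    using ex_has_greatest_nat[of "\<lambda>\<rho>. det (N \<rho>) \<noteq> 0" Inr c "Suc CARD('k)"] by blast
  have "\<exists>i j. \<rho> i = Inr j"
  proof (rule ccontr)
    assume "\<nexists>i j. \<rho> i = Inr j"
    then have "\<forall>i. \<exists>m. \<rho> i = Inl m" by (metis sum.exhaust)
    then obtain r where "\<And>i. \<rho> i = Inl (r i)" by metis
    then have "N \<rho> = (\<chi> i. M $ r i)" by (simp add: N_def)
    then show False using \<rho>(1) minors by simp
  qed
  then obtain i0 j0 where i0: "\<rho> i0 = Inr j0" by blast
  show thesis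
  proof (rule that[of "cofactors (N \<rho>) i0"])
    have "(\<chi> i'. if i' = i0 then N \<rho> $ i0 else N \<rho> $ i') = N \<rho>" by (simp add: vec_eq_iff)
    then have "det (N \<rho>) = (\<Sum>l\<in>UNIV. N \<rho> $ i0 $ l * cofactors (N \<rho>) i0 $ l)"
      using det_replace_row[of i0 "N \<rho> $ i0" "N \<rho>"] by simp
    then show "cofactors (N \<rho>) i0 \<noteq> 0" using \<rho>(1) by auto
    fix m
    let ?\<sigma> = "\<rho>(i0 := Inl m)"
    have "(\<chi> i'. if i' = i0 then M $ m else N \<rho> $ i') = N ?\<sigma>" by (simp add: vec_eq_iff N_def)
    then have "(\<Sum>j\<in>UNIV. M $ m $ j * cofactors (N \<rho>) i0 $ j) = det (N ?\<sigma>)"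
      using det_replace_row[of i0 "M $ m" "N \<rho>"] by simp
    moreover have "{i. \<exists>m. ?\<sigma> i = Inl m} = insert i0 {i. \<exists>m. \<rho> i = Inl m}" by auto
    then have "c ?\<sigma> = Suc (c \<rho>)" using i0 by (simp add: c_def)
    ultimately show "(\<Sum>j\<in>UNIV. M $ m $ j * cofactors (N \<rho>) i0 $ j) = 0"
      using \<rho>(2)[of ?\<sigma>] by auto
  qed
qed

section \<open>Ideals as test modules for injectivity and the cogenerator property\<close>

definition is_ideal :: "'a::comm_ring_1 set \<Rightarrow> bool" where
  "is_ideal I \<longleftrightarrow> 0 \<in> I \<and> (\<forall>p\<in>I. \<forall>q\<in>I. p + q \<in> I) \<and> (\<forall>p. \<forall>q\<in>I. p * q \<in> I)"

lemma is_ideal_simps: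
  assumes "is_ideal I"
  shows ideal_0: "0 \<in> I" and ideal_add: "p \<in> I \<Longrightarrow> q \<in> I \<Longrightarrow> p + q \<in> I"
    and ideal_mult: "q \<in> I \<Longrightarrow> p * q \<in> I" and ideal_uminus: "q \<in> I \<Longrightarrow> - q \<in> I"
    and ideal_diff: "p \<in> I \<Longrightarrow> q \<in> I \<Longrightarrow> p - q \<in> I"
proof -
  show *: "0 \<in> I" "p \<in> I \<Longrightarrow> q \<in> I \<Longrightarrow> p + q \<in> I" "q \<in> I \<Longrightarrow> p * q \<in> I" for p q
    using assms by (auto simp: is_ideal_def)
  show u: "q \<in> I \<Longrightarrow> - q \<in> I" for q using *(3)[of q "- 1"] by simp
  show "p \<in> I \<Longrightarrow> q \<in> I \<Longrightarrow> p - q \<in> I" using *(2)[of p "- q"] u by simp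
qed

text \<open>A copy of the ideal on singletons, because the test modules have sets of scalars as
  elements; \<open>mult\<close> and \<open>one\<close> are dummies.\<close>

definition singleton_module :: "'a::comm_ring_1 set \<Rightarrow> ('a, 'a set) module" where
  "singleton_module I = \<lparr>carrier = (\<lambda>p. {p}) ` I, mult = (\<lambda>_ _. {}), one = {}, zero = {0},
     add = (\<lambda>S T. {the_elem S + the_elem T}), smult = (\<lambda>r S. {r * the_elem S})\<rparr>"

lemma singleton_module:
  assumes "is_ideal I"
  shows "Module.module ring_of_type_algebra (singleton_module I)"
proof -
  note I = is_ideal_simps[OF assms]
  have "abelian_group (singleton_module I)"
  proof (rule abelian_groupI)
    fix x assume "x \<in> carrier (singleton_module I)"
    then show "\<exists>y\<in>carrier (singleton_module I). y \<oplus>\<^bsub>singleton_module I\<^esub> x = \<zero>\<^bsub>singleton_module I\<^esub>"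
      by (intro bexI[of _ "{- the_elem x}"]) (auto simp: singleton_module_def I)
  qed (auto simp: singleton_module_def I algebra_simps)
  then show ?thesis
    by (intro moduleI cring_from_type_algebra)
      (auto simp: singleton_module_def ring_of_type_algebra_def I algebra_simps)
qed

text \<open>A homomorphism defined on the whole ring is determined by the image of 1. Extending
  \<open>h\<close> from \<open>I\<close> to the ring by injectivity and evaluating at 1 gives
  \<phi>.\<close>

lemma injective_extension:
  fixes F :: "'n::finite distribution set"
  assumes inj: "injective_module ring_of_type_algebra (dist_module F)" and I: "is_ideal I"
    and F: "\<And>p. p \<in> I \<Longrightarrow> h p \<in> F"
    and add: "\<And>p q. p \<in> I \<Longrightarrow> q \<in> I \<Longrightarrow> h (p + q) = h p + h q"
    and mult: "\<And>p q. q \<in> I \<Longrightarrow> h (p * q) = pdo_act p (h q)"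
  obtains \<phi> where "\<phi> \<in> F" "\<And>p. p \<in> I \<Longrightarrow> h p = pdo_act p \<phi>"
proof -
  have U: "is_ideal (UNIV :: 'n pdo set)" by (simp add: is_ideal_def)
  let ?M = "singleton_module I" and ?N = "singleton_module (UNIV :: 'n pdo set)"
  have i: "id \<in> module_homs ring_of_type_algebra ?M ?N"
    by (auto simp: module_homs_def singleton_module_def)
  have g: "(\<lambda>S. h (the_elem S)) \<in> module_homs ring_of_type_algebra ?M (dist_module F)"
    by (auto simp: module_homs_def singleton_module_def dist_module_def F add mult)
  obtain k where k: "k \<in> module_homs ring_of_type_algebra ?N (dist_module F)"
    "\<And>S. S \<in> carrier ?M \<Longrightarrow> k S = h (the_elem S)"
    using inj singleton_module[OF I] singleton_module[OF U] i g
    unfolding injective_module_def by (metis id_apply inj_on_id)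
  have hom: "\<forall>r\<in>carrier ring_of_type_algebra. \<forall>x\<in>carrier ?N. k (r \<odot>\<^bsub>?N\<^esub> x) = r \<odot>\<^bsub>dist_module F\<^esub> k x"
    using k(1) by (simp add: module_homs_def)
  have "k {p * q} = pdo_act p (k {q})" for p q
    using bspec[OF bspec[OF hom, of p], of "{q}"]
    by (simp add: dist_module_def singleton_module_def ring_of_type_algebra_def)
  from this[of _ 1] have "k {p} = pdo_act p (k {1})" for p unfolding mult_1_right .
  moreover have "k {1} \<in> F"
    using k(1) by (auto simp: module_homs_def singleton_module_def dist_module_def)
  moreover have "k {p} = h p" if "p \<in> I" for p
    using k(2)[of "{p}"] that by (simp add: singleton_module_def)
  ultimately show thesis by (intro that[of "k {1}"]) metis+
qed

definition ideal_coset :: "'a::comm_ring_1 set \<Rightarrow> 'a \<Rightarrow> 'a set" where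
  "ideal_coset J p = {q. q - p \<in> J}"

text \<open>The quotient of the ring by \<open>J\<close>. The operations are unions over all
  representatives, which avoids choosing them: for an ideal all members of the union
  coincide.\<close>

definition coset_module :: "'a::comm_ring_1 set \<Rightarrow> ('a, 'a set) module" where
  "coset_module J = \<lparr>carrier = range (ideal_coset J), mult = (\<lambda>_ _. {}), one = {}, zero = ideal_coset J 0,
     add = (\<lambda>S T. \<Union>x\<in>S. \<Union>y\<in>T. ideal_coset J (x + y)), smult = (\<lambda>r S. \<Union>x\<in>S. ideal_coset J (r * x))\<rparr>"

lemma ideal_coset_eq: "is_ideal J \<Longrightarrow> ideal_coset J p = ideal_coset J q \<longleftrightarrow> p - q \<in> J"
proof
  assume J: "is_ideal J"
  note J' = is_ideal_simps[OF J]
  have "p \<in> ideal_coset J p" by (simp add: ideal_coset_def J'(1))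
  then show "ideal_coset J p = ideal_coset J q \<Longrightarrow> p - q \<in> J"
    by (simp add: ideal_coset_def)
  assume *: "p - q \<in> J"
  have "x - p \<in> J \<longleftrightarrow> x - q \<in> J" for x
    using J'(2)[OF _ *, of "x - p"] J'(5)[OF _ *, of "x - q"] by auto
  then show "ideal_coset J p = ideal_coset J q" by (simp add: ideal_coset_def)
qed

lemma coset_module_simps:
  assumes "is_ideal J"
  shows "ideal_coset J p \<oplus>\<^bsub>coset_module J\<^esub> ideal_coset J q = ideal_coset J (p + q)"
    and "r \<odot>\<^bsub>coset_module J\<^esub> ideal_coset J p = ideal_coset J (r * p)"
    and "\<zero>\<^bsub>coset_module J\<^esub> = ideal_coset J 0" and "carrier (coset_module J) = range (ideal_coset J)"
proof -
  note J = is_ideal_simps[OF assms]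
  have self: "p \<in> ideal_coset J p" for p by (simp add: ideal_coset_def J)
  have "ideal_coset J (x + y) = ideal_coset J (p + q)" if "x \<in> ideal_coset J p" "y \<in> ideal_coset J q" for x y
    using that J(2)[of "x - p" "y - q"] by (simp add: ideal_coset_eq[OF assms]) (simp add: ideal_coset_def algebra_simps)
  then have "(\<Union>x\<in>ideal_coset J p. \<Union>y\<in>ideal_coset J q. ideal_coset J (x + y))
      = (\<Union>x\<in>ideal_coset J p. \<Union>y\<in>ideal_coset J q. ideal_coset J (p + q))"
    by (intro SUP_cong refl)
  also have "\<dots> = ideal_coset J (p + q)" using self[of p] self[of q] by blast
  finally show "ideal_coset J p \<oplus>\<^bsub>coset_module J\<^esub> ideal_coset J q = ideal_coset J (p + q)"
    by (simp add: coset_module_def)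
  have "ideal_coset J (r * x) = ideal_coset J (r * p)" if "x \<in> ideal_coset J p" for x
    using that J(3)[of "x - p" r] by (simp add: ideal_coset_eq[OF assms]) (simp add: ideal_coset_def algebra_simps)
  then have "(\<Union>x\<in>ideal_coset J p. ideal_coset J (r * x)) = (\<Union>x\<in>ideal_coset J p. ideal_coset J (r * p))"
    by (intro SUP_cong refl)
  also have "\<dots> = ideal_coset J (r * p)" using self[of p] by blast
  finally show "r \<odot>\<^bsub>coset_module J\<^esub> ideal_coset J p = ideal_coset J (r * p)"
    by (simp add: coset_module_def)
qed (simp_all add: coset_module_def)

lemma coset_module:
  assumes "is_ideal J"
  shows "Module.module ring_of_type_algebra (coset_module J)"
proof -
  note S = coset_module_simps[OF assms]
  have "abelian_group (coset_module J)"
  proof (rule abelian_groupI)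
    fix x assume "x \<in> carrier (coset_module J)"
    then obtain p where "x = ideal_coset J p" by (auto simp: S)
    then show "\<exists>y\<in>carrier (coset_module J). y \<oplus>\<^bsub>coset_module J\<^esub> x = \<zero>\<^bsub>coset_module J\<^esub>"
      by (intro bexI[of _ "ideal_coset J (- p)"]) (auto simp: S)
  qed (auto simp: S algebra_simps)
  then show ?thesis
    by (intro moduleI cring_from_type_algebra) (auto simp: S ring_of_type_algebra_def algebra_simps)
qed

text \<open>The quotient by \<open>J\<close> is nonzero and generated by the coset of 1, so a
  nonzero homomorphism into \<open>F\<close> cannot kill that coset; its image is \<phi>.\<close>

lemma cogenerator_annihilated:
  fixes F :: "'n::finite distribution set"
  assumes cog: "injective_cogenerator ring_of_type_algebra (dist_module F)" and J: "is_ideal J" "1 \<notin> J"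
  obtains \<phi> where "\<phi> \<in> F" "\<phi> \<noteq> 0" "\<And>p. p \<in> J \<Longrightarrow> pdo_act p \<phi> = 0"
proof -
  note S = coset_module_simps[OF J(1)]
  have "ideal_coset J 1 \<noteq> ideal_coset J 0" using J by (simp add: ideal_coset_eq)
  then have "carrier (coset_module J) \<noteq> {\<zero>\<^bsub>coset_module J\<^esub>}" by (auto simp: S)
  then obtain h x where h: "h \<in> module_homs ring_of_type_algebra (coset_module J) (dist_module F)"
    and x: "x \<in> carrier (coset_module J)" "h x \<noteq> \<zero>\<^bsub>dist_module F\<^esub>"
    using cog coset_module[OF J(1)] unfolding injective_cogenerator_def by blast
  have F: "h (ideal_coset J p) \<in> F" for p
    using h by (auto simp: module_homs_def S dist_module_def)
  have smult: "h (ideal_coset J (r * p)) = pdo_act r (h (ideal_coset J p))" for r p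
    using h by (auto simp: module_homs_def S dist_module_def ring_of_type_algebra_def)
  obtain p where p: "x = ideal_coset J p" using x by (auto simp: S)
  show thesis
  proof (rule that[of "h (ideal_coset J 1)"])
    interpret Modules.module "pdo_act :: 'n pdo \<Rightarrow> _" by (rule pdo_act_module)
    show "h (ideal_coset J 1) \<in> F" by (rule F)
    show "h (ideal_coset J 1) \<noteq> 0" using smult[of p 1] x(2) p by (auto simp: dist_module_def)
    show "pdo_act q (h (ideal_coset J 1)) = 0" if "q \<in> J" for q
    proof -
      have "ideal_coset J q = ideal_coset J (0 * 1)" using that J by (simp add: ideal_coset_eq)
      then show ?thesis using smult[of q 1] smult[of 0 1] by simp
    qed
  qed
qed

text \<open>If \<psi> is nonzero and killed by the annihilator of \<open>q\<close>, then p q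
  \<mapsto> p \<psi> is well defined on the ideal generated by \<open>q\<close>. Its extension to
  the ring gives \<phi> with q \<phi> = \<psi>.\<close>

lemma cogenerator_not_annihilated:
  fixes F :: "'n::finite distribution set"
  assumes cog: "injective_cogenerator ring_of_type_algebra (dist_module F)" and q: "q \<noteq> 0"
  obtains \<phi> where "\<phi> \<in> F" "pdo_act q \<phi> \<noteq> 0"
proof -
  interpret Modules.module "pdo_act :: 'n pdo \<Rightarrow> _" by (rule pdo_act_module)
  let ?J = "{p. p * q = 0}"
  have J: "is_ideal ?J" "1 \<notin> ?J" using q by (auto simp: is_ideal_def algebra_simps)
  obtain \<psi> where \<psi>: "\<psi> \<in> F" "\<psi> \<noteq> 0" "\<And>p. p \<in> ?J \<Longrightarrow> pdo_act p \<psi> = 0"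
    by (rule cogenerator_annihilated[OF cog J]) blast
  have sub: "Module.module ring_of_type_algebra (dist_module F)"
    using cog by (auto simp: injective_cogenerator_def injective_module_def)
  \<comment> \<open>The chosen \<open>p\<close> is unique only up to the annihilator of
    \<open>q\<close>, and \<psi> does not see the difference.\<close>
  define h where "h = (\<lambda>a. pdo_act (SOME p. a = p * q) \<psi>)"
  have h: "h (p * q) = pdo_act p \<psi>" for p
  proof -
    let ?p' = "SOME p'. p * q = p' * q"
    have "p * q = ?p' * q" by (rule someI[of _ p]) simp
    then have "(p - ?p') * q = 0" by (simp add: algebra_simps)
    with \<psi>(3)[of "p - ?p'"] show ?thesis by (simp add: h_def scale_left_diff_distrib)
  qed
  have F: "pdo_act p \<psi> \<in> F" for p
    using Module.module.smult_closed[OF sub, of p \<psi>] \<psi>(1) by (simp add: dist_module_def ring_of_type_algebra_def)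
  obtain \<phi> where \<phi>: "\<phi> \<in> F" "\<And>p. p \<in> range (\<lambda>p. p * q) \<Longrightarrow> h p = pdo_act p \<phi>"
  proof (rule injective_extension[of F "range (\<lambda>p. p * q)" h])
    show "injective_module ring_of_type_algebra (dist_module F)"
      using cog by (simp add: injective_cogenerator_def)
    show "is_ideal (range (\<lambda>p. p * q))"
      unfolding is_ideal_def by (auto simp: image_iff) (metis mult_zero_left, metis distrib_right, metis mult.assoc)
    show "h (a + b) = h a + h b" if "a \<in> range (\<lambda>p. p * q)" "b \<in> range (\<lambda>p. p * q)" for a b
      using that by (auto simp: h pdo_act_add_left simp flip: distrib_right)
    show "h (a * b) = pdo_act a (h b)" if "b \<in> range (\<lambda>p. p * q)" for a b
    proof -
      from that obtain p where "b = p * q" by (rule rangeE)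
      then show ?thesis using h[of "a * p"] h[of p] by (simp only: mult.assoc pdo_act_mult)
    qed
  qed (auto simp: h F)
  have "q \<in> range (\<lambda>p. p * q)" by (rule range_eqI[of _ _ 1]) simp
  then have "pdo_act q \<phi> = \<psi>" using \<phi>(2)[of q] h[of 1] by simp
  then show thesis using \<phi>(1) \<psi>(2) by (intro that[of \<phi>]) auto
qed

section \<open>Operators and image representations\<close>

lemma pdo_act_var: "pdo_act (mpoly_var j) u = dist_D j u"
proof -
  let ?\<alpha> = "Poly_Mapping.single j (Suc 0)"
  interpret comp_fun_commute "\<lambda>i. dist_D i ^^ Poly_Mapping.lookup ?\<alpha> i"
    by (rule dist_D.comp_fun_commute_funpow)
  have "j \<notin> J \<Longrightarrow> Finite_Set.fold (\<lambda>i. dist_D i ^^ Poly_Mapping.lookup ?\<alpha> i) u J = u" if "finite J" for J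
    using that by (induction J rule: finite_induct) (simp_all add: lookup_single_not_eq)
  from this[of "UNIV - {j}"]
  have "Finite_Set.fold (\<lambda>i. dist_D i ^^ Poly_Mapping.lookup ?\<alpha> i) u (insert j (UNIV - {j})) = dist_D j u"
    by (subst fold_insert) (simp_all add: lookup_single)
  then have "dist_D_power ?\<alpha> u = dist_D j u" by (simp add: dist_D_power_def insert_absorb)
  then show ?thesis by (simp add: pdo_act_single dist_scale_simps)
qed

lemma pdo_act_const: "pdo_act (mpoly_const c) u = dist_scale c u"
  by (simp add: pdo_act_single dist_D_power_zero)

lemma dist_apply_add: "dist_apply (u + v) \<phi> = dist_apply u \<phi> + dist_apply v \<phi>"
  by transfer simp

lemma dist_apply_scale: "dist_apply (dist_scale c u) \<phi> = c * dist_apply u \<phi>"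
  by transfer simp

lemma dist_apply_zero: "dist_apply 0 \<phi> = 0"
  by transfer simp

lemma dist_apply_D: "test_fun \<phi> \<Longrightarrow> dist_apply (dist_D j u) \<phi> = \<i> * dist_apply u (partial j \<phi>)"
  unfolding dist_D_def dist_apply_scale by transfer (simp add: field_simps)

text \<open>Locality: differentiating a test function does not enlarge its support. The
  distributions are generalized in the induction because the product case applies \<open>p\<close>
  to \<open>pdo_act q f\<close>.\<close>

lemma agree_on_pdo_act:
  assumes "agree_on W f g"
  shows "agree_on W (pdo_act p f) (pdo_act p g)"
  using assms
proof (induction p arbitrary: f g rule: mpoly_induct)
  case (const c)
  then show ?case by (simp add: agree_on_def pdo_act_const dist_apply_scale)
next
  case (var j)
  show ?case
    unfolding agree_on_def pdo_act_var
  proof (intro allI impI)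
    fix \<phi> :: "real ^ 'a \<Rightarrow> complex" assume \<phi>: "test_fun \<phi> \<and> support \<phi> \<subseteq> W"
    then have "test_fun (partial j \<phi>)" "support (partial j \<phi>) \<subseteq> W"
      using test_fun_partial support_partial by blast+
    then show "dist_apply (dist_D j f) \<phi> = dist_apply (dist_D j g) \<phi>"
      using var \<phi> by (simp add: agree_on_def dist_apply_D)
  qed
next
  case (add p q)
  show ?case using add.IH[OF add.prems] by (simp add: agree_on_def pdo_act_add_left dist_apply_add)
next
  case (mult p q)
  then show ?case by (simp add: pdo_act_mult)
qed

lemma kernel_antimono: "P \<subseteq> Q \<Longrightarrow> kernel F Q \<subseteq> kernel F P"
  by (auto simp: kernel_def)

lemma pdo_act_sum_left: "pdo_act (\<Sum>i\<in>I. p i) u = (\<Sum>i\<in>I. pdo_act (p i) u)"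
proof -
  interpret Modules.module "pdo_act :: 'a pdo \<Rightarrow> _" by (rule pdo_act_module)
  show ?thesis by (rule scale_sum_left)
qed

lemma pdo_act_sum_right: "pdo_act p (\<Sum>i\<in>I. u i) = (\<Sum>i\<in>I. pdo_act p (u i))"
proof -
  interpret Modules.module "pdo_act :: 'a pdo \<Rightarrow> _" by (rule pdo_act_module)
  show ?thesis by (rule scale_sum_right)
qed

lemma pdo_act_axis: "(\<Sum>l\<in>UNIV. pdo_act ((a *s axis j 1) $ l) (f $ l)) = pdo_act a (f $ j)"
proof -
  interpret Modules.module "pdo_act :: 'a pdo \<Rightarrow> _" by (rule pdo_act_module)
  have "(\<Sum>l\<in>UNIV. pdo_act ((a *s axis j 1) $ l) (f $ l)) = (\<Sum>l\<in>UNIV. if l = j then pdo_act a (f $ l) else 0)"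
    by (rule sum.cong) (auto simp: axis_def)
  then show ?thesis by simp
qed

text \<open>The quotient of A^k by the vectors orthogonal to \<open>q\<close> is isomorphic to the
  ideal generated by the entries of \<open>q\<close>, through \<open>d\<close> p = p . q. A solution
  \<open>f\<close> gives a map \<open>e\<close> that factors through \<open>d\<close>; extending it
  from the ideal \<open>range d\<close> to the ring yields the potential \<phi>, and unit vectors
  recover the components of \<open>f\<close>.\<close>

lemma kernel_orthogonal:
  fixes F :: "'n::finite distribution set" and q :: "'n pdo ^ 'k::finite"
  assumes sub: "Modules.module.subspace pdo_act F"
    and inj: "injective_module ring_of_type_algebra (dist_module F)"
  shows "kernel F {p. (\<Sum>j\<in>UNIV. p $ j * q $ j) = 0} = (\<lambda>\<phi>. \<chi> j. pdo_act (q $ j) \<phi>) ` F"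
proof (intro equalityI subsetI)
  interpret Modules.module "pdo_act :: 'n pdo \<Rightarrow> _" by (rule pdo_act_module)
  fix f assume "f \<in> (\<lambda>\<phi>. \<chi> j. pdo_act (q $ j) \<phi>) ` F"
  then obtain \<phi> where \<phi>: "\<phi> \<in> F" "f = (\<chi> j. pdo_act (q $ j) \<phi>)" by blast
  have "(\<Sum>j\<in>UNIV. pdo_act (p $ j) (f $ j)) = pdo_act (\<Sum>j\<in>UNIV. p $ j * q $ j) \<phi>" for p
    unfolding pdo_act_sum_left by (simp only: \<phi>(2) vec_lambda_beta pdo_act_mult)
  then show "f \<in> kernel F {p. (\<Sum>j\<in>UNIV. p $ j * q $ j) = 0}"
    using \<phi> by (simp add: kernel_def subspace_scale[OF sub])
next
  interpret Modules.module "pdo_act :: 'n pdo \<Rightarrow> _" by (rule pdo_act_module)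
  fix f assume f: "f \<in> kernel F {p. (\<Sum>j\<in>UNIV. p $ j * q $ j) = 0}"
  define d where "d = (\<lambda>p :: 'n pdo ^ 'k. \<Sum>j\<in>UNIV. p $ j * q $ j)"
  define e where "e = (\<lambda>p :: 'n pdo ^ 'k. \<Sum>j\<in>UNIV. pdo_act (p $ j) (f $ j))"
  have d_add: "d (p + p') = d p + d p'" for p p'
    by (simp add: d_def distrib_right sum.distrib)
  have d_mult: "d (a *s p) = a * d p" for a p
    by (simp add: d_def sum_distrib_left mult.assoc)
  have d_diff: "d (p - p') = d p - d p'" for p p'
    by (simp add: d_def left_diff_distrib sum_subtractf)
  have e_diff: "e (p - p') = e p - e p'" for p p'
    by (simp add: e_def scale_left_diff_distrib sum_subtractf)
  have e0: "e p = 0" if "d p = 0" for p using f that by (simp add: kernel_def d_def e_def)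
  have e_cong: "e p = e p'" if "d p = d p'" for p p'
    using e0[of "p - p'"] that by (simp add: d_diff e_diff)
  define h where "h = (\<lambda>a. e (SOME p. a = d p))"
  have h: "h (d p) = e p" for p
    unfolding h_def by (rule e_cong) (rule someI[of "\<lambda>p'. d p = d p'" p, OF refl, symmetric])
  obtain \<phi> where \<phi>: "\<phi> \<in> F" "\<And>a. a \<in> range d \<Longrightarrow> h a = pdo_act a \<phi>"
  proof (rule injective_extension[OF inj, of "range d" h])
    have "d 0 = 0" by (simp add: d_def)
    then have "0 \<in> range d" by (metis rangeI)
    then show "is_ideal (range d)"
      unfolding is_ideal_def by (auto simp flip: d_add d_mult)
    show "h a \<in> F" if "a \<in> range d" for a
      using that f by (auto simp: h e_def kernel_def intro!: subspace_sum[OF sub] subspace_scale[OF sub])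
    show "h (a + b) = h a + h b" if "a \<in> range d" "b \<in> range d" for a b
    proof -
      from that obtain p p' where "a = d p" "b = d p'" by blast
      then show ?thesis using h[of "p + p'"]
        by (simp add: d_add h) (simp add: e_def pdo_act_add_left sum.distrib)
    qed
    show "h (a * b) = pdo_act a (h b)" if "b \<in> range d" for a b
    proof -
      from that obtain p where p: "b = d p" by blast
      have "e (a *s p) = pdo_act a (e p)"
        unfolding e_def pdo_act_sum_right by (simp only: vector_smult_component pdo_act_mult)
      then show ?thesis using h[of "a *s p"] h[of p] by (simp only: p d_mult)
    qed
  qed blast
  have "f $ j = pdo_act (q $ j) \<phi>" for j
  proof -
    have "d (axis j 1) = q $ j"
    proof -
      have "d (axis j 1) = (\<Sum>l\<in>UNIV. if l = j then q $ l else 0)"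
        unfolding d_def by (rule sum.cong) (auto simp: axis_def)
      then show ?thesis by simp
    qed
    moreover have "e (axis j 1) = f $ j"
      using pdo_act_axis[of 1 j f] by (simp add: e_def)
    ultimately show ?thesis using h[of "axis j 1"] \<phi>(2)[of "q $ j"] by (metis rangeI)
  qed
  then have "f = (\<chi> j. pdo_act (q $ j) \<phi>)" by (simp add: vec_eq_iff)
  then show "f \<in> (\<lambda>\<phi>. \<chi> j. pdo_act (q $ j) \<phi>) ` F" using \<phi>(1) by blast
qed

lemma controllable_image:
  fixes F :: "'n::finite distribution set" and q :: "'n pdo ^ 'k::finite"
  shows "controllable F ((\<lambda>\<phi>. \<chi> j. pdo_act (q $ j) \<phi>) ` F)"
  unfolding controllable_def
proof (intro allI impI ballI)
  fix U1 U2 f1 f2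
  let ?B = "(\<lambda>\<phi>. \<chi> j. pdo_act (q $ j) \<phi>) ` F"
  assume adm: "admissible F U1 U2" and f: "f1 \<in> ?B" "f2 \<in> ?B"
  from f obtain \<phi>1 \<phi>2 where \<phi>: "\<phi>1 \<in> F" "f1 = (\<chi> j. pdo_act (q $ j) \<phi>1)" "\<phi>2 \<in> F" "f2 = (\<chi> j. pdo_act (q $ j) \<phi>2)"
    by blast
  with adm obtain \<phi> where \<phi>': "\<phi> \<in> F" "agree_near U1 \<phi> \<phi>1" "agree_near U2 \<phi> \<phi>2"
    unfolding admissible_def by metis
  have "vec_agree_near U (\<chi> j. pdo_act (q $ j) \<phi>) (\<chi> j. pdo_act (q $ j) \<psi>)" if "agree_near U \<phi> \<psi>" for U \<psi>
    using that agree_on_pdo_act unfolding agree_near_def vec_agree_near_def by fastforce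
  then show "\<exists>f\<in>?B. vec_agree_near U1 f f1 \<and> vec_agree_near U2 f f2"
    using \<phi> \<phi>' by blast
qed

lemma not_uncontrollable_if_orthogonal:
  fixes F :: "'n::finite distribution set" and M :: "'n pdo ^ 'k::finite ^ 'l::finite"
  assumes sub: "Modules.module.subspace pdo_act F"
    and cog: "injective_cogenerator ring_of_type_algebra (dist_module F)"
    and q: "q \<noteq> 0" "\<And>i. (\<Sum>j\<in>UNIV. M $ i $ j * q $ j) = 0"
  shows "\<not> uncontrollable F (kernel F (row_module M))"
proof -
  interpret V: Modules.module "(*s) :: 'n pdo \<Rightarrow> 'n pdo ^ 'k \<Rightarrow> _" by (rule module_vec)
  have inj: "injective_module ring_of_type_algebra (dist_module F)"
    using cog by (simp add: injective_cogenerator_def)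
  let ?P = "{p. (\<Sum>j\<in>UNIV. p $ j * q $ j) = 0}"
  have P: "V.subspace ?P"
    by (simp add: V.subspace_def distrib_right sum.distrib mult.assoc flip: sum_distrib_left)
  have "rows M \<subseteq> ?P" using q(2) by (auto simp: rows_def row_def)
  then have "row_module M \<subseteq> ?P" unfolding row_module_def by (rule V.span_minimal[OF _ P])
  then have le: "kernel F ?P \<subseteq> kernel F (row_module M)" by (rule kernel_antimono)
  \<comment> \<open>The cogenerator property makes the image under one nonzero entry of
    \<open>q\<close> nonzero, hence the sub-system is not {0}.\<close>
  obtain j where "q $ j \<noteq> 0" using q(1) by (auto simp: vec_eq_iff)
  then obtain \<phi> where \<phi>: "\<phi> \<in> F" "pdo_act (q $ j) \<phi> \<noteq> 0"
    using cogenerator_not_annihilated[OF cog] by blast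
  then have "(\<chi> j. pdo_act (q $ j) \<phi>) \<in> kernel F ?P" "(\<chi> j. pdo_act (q $ j) \<phi>) \<noteq> 0"
    by (auto simp: kernel_orthogonal[OF sub inj] vec_eq_iff)
  then have "kernel F ?P \<noteq> {0}" by blast
  moreover have "is_system F (kernel F ?P)" using P by (auto simp: is_system_def)
  moreover have "controllable F (kernel F ?P)"
    unfolding kernel_orthogonal[OF sub inj] by (rule controllable_image)
  ultimately show ?thesis using le unfolding uncontrollable_def by blast
qed

section \<open>The weak Nullstellensatz and eigenvectors in systems\<close>

lemma countable_monomials: "countable (UNIV :: ('n::finite \<Rightarrow>\<^sub>0 nat) set)"
proof (rule countableI)
  show "inj (to_nat \<circ> (Poly_Mapping.lookup :: ('n \<Rightarrow>\<^sub>0 nat) \<Rightarrow> _))"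
    by (rule inj_compose[OF inj_to_nat]) (simp add: inj_def poly_mapping.lookup_inject)
qed

lemma vector_space_mpoly: "vector_space (\<lambda>c (p :: 'v mpoly). mpoly_const c * p)"
  by unfold_locales (simp_all add: distrib_left distrib_right mult_single single_add flip: mult.assoc)

lemma mpoly_span_monomials:
  fixes p :: "'v mpoly"
  assumes "finite K" "Poly_Mapping.keys p \<subseteq> K"
  shows "p \<in> Modules.module.span (\<lambda>c (p :: 'v mpoly). mpoly_const c * p) ((\<lambda>m. Poly_Mapping.single m 1) ` K)"
proof -
  interpret vector_space "\<lambda>c (p :: 'v mpoly). mpoly_const c * p" by (rule vector_space_mpoly)
  have "p = (\<Sum>m\<in>Poly_Mapping.keys p. mpoly_const (Poly_Mapping.lookup p m) * Poly_Mapping.single m 1)"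
    by (subst poly_mapping_sum_single) (simp add: mult_single)
  also have "\<dots> \<in> span ((\<lambda>m. Poly_Mapping.single m 1) ` K)"
    using assms by (intro span_sum span_scale span_base) auto
  finally show ?thesis .
qed

text \<open>There are only countably many finite sets of monomials, so one of them,
  \<open>A\<close>, is the set of monomials of uncountably many members; any
  \<open>Suc (card A)\<close> of these are dependent.\<close>

lemma mpoly_dependent_family:
  fixes b :: "real \<Rightarrow> 'n::finite mpoly"
  obtains S :: "real set" and \<beta> where "finite S" "\<exists>s\<in>S. \<beta> s \<noteq> 0" "(\<Sum>s\<in>S. mpoly_const (\<beta> s) * b s) = 0"
\<comment> \<open>Linear dependence is available for sets rather than families, so a repeated member
  is treated apart: it gives the relation b s - b t = 0.\<close>
proof (cases "inj b")
  case False
  then obtain s t where st: "s \<noteq> t" "b s = b t" by (auto simp: inj_on_def)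
  show thesis
  proof (rule that[of "{s, t}" "\<lambda>r. if r = s then 1 else - 1"])
    have "mpoly_const (- 1) = (- 1 :: 'n mpoly)" unfolding single_one[symmetric] by (simp only: single_uminus)
    then show "(\<Sum>r\<in>{s, t}. mpoly_const (if r = s then 1 else - 1) * b r) = 0"
      using st by simp
  qed (use st in auto)
next
  case True
  interpret vector_space "\<lambda>c (p :: 'n mpoly). mpoly_const c * p" by (rule vector_space_mpoly)
  let ?K = "{A :: ('n \<Rightarrow>\<^sub>0 nat) set. finite A}"
  have "countable ?K" using countable_Collect_finite_subset[OF countable_monomials] by simp
  moreover have "t \<in> (\<Union>A\<in>?K. {t. Poly_Mapping.keys (b t) = A})" for t
    using finite_keys[of "b t"] by blast
  then have "(\<Union>A\<in>?K. {t. Poly_Mapping.keys (b t) = A}) = UNIV" by blast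
  ultimately have "\<not> (\<forall>A\<in>?K. countable {t. Poly_Mapping.keys (b t) = A})"
    using uncountable_UNIV_real countable_UN by metis
  then obtain A where A: "finite A" "\<not> countable {t. Poly_Mapping.keys (b t) = A}" by blast
  then have "infinite {t. Poly_Mapping.keys (b t) = A}" by (auto dest: uncountable_infinite)
  from infinite_arbitrarily_large[OF this, of "Suc (card A)"]
  obtain S where S: "S \<subseteq> {t. Poly_Mapping.keys (b t) = A}" "finite S" "card S = Suc (card A)"
    by blast
  have inj: "inj_on b S" using True by (rule inj_on_subset) simp
  let ?E = "(\<lambda>m. Poly_Mapping.single m (1 :: complex)) ` A"
  have "dependent (b ` S)"
  proof (rule ccontr)
    assume "\<not> dependent (b ` S)"
    moreover have "b ` S \<subseteq> span ?E" using S(1) mpoly_span_monomials[OF A(1)] by blast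
    ultimately have "card (b ` S) \<le> card ?E"
      using independent_span_bound[of ?E "b ` S"] A(1) by blast
    also have "\<dots> \<le> card A" by (rule card_image_le[OF A(1)])
    finally show False using S(3) by (simp add: card_image[OF inj])
  qed
  then obtain u where "\<exists>v\<in>b ` S. u v \<noteq> 0" "(\<Sum>v\<in>b ` S. mpoly_const (u v) * v) = 0"
    using dependent_finite[of "b ` S"] S(2) by auto
  then show thesis
    using S(2) by (intro that[of S "\<lambda>s. u (b s)"]) (auto simp: sum.reindex[OF inj])
qed

definition poly_at_var :: "'v \<Rightarrow> complex poly \<Rightarrow> 'v mpoly" where
  "poly_at_var v U = (\<Sum>i\<le>Polynomial.degree U. mpoly_const (Polynomial.coeff U i) * mpoly_var v ^ i)"

lemma mpoly_eval_power [simp]: "mpoly_eval (p ^ k) x = mpoly_eval p x ^ k"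
  by (induction k) auto

lemma mpoly_eval_poly_at_var [simp]: "mpoly_eval (poly_at_var v U) x = poly U (x v)"
  by (simp add: poly_at_var_def mpoly_eval_sum poly_altdef)

lemma is_ideal_adjoin:
  fixes x :: "'a::comm_ring_1"
  assumes "is_ideal J"
  shows "is_ideal {a + b * x |a b. a \<in> J}"
proof -
  note J = is_ideal_simps[OF assms]
  show ?thesis
    unfolding is_ideal_def
  proof (intro conjI allI ballI)
    have "(0 :: 'a) = 0 + 0 * x" by simp
    then show "0 \<in> {a + b * x |a b. a \<in> J}" using J(1) by blast
    fix p q assume q: "q \<in> {a + b * x |a b. a \<in> J}"
    then obtain c d where cd: "q = c + d * x" "c \<in> J" by blast
    have "p * q = p * c + (p * d) * x" by (simp add: cd(1) algebra_simps)
    then show "p * q \<in> {a + b * x |a b. a \<in> J}" using J(3)[OF cd(2)] by blast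
    assume "p \<in> {a + b * x |a b. a \<in> J}"
    then obtain a b where ab: "p = a + b * x" "a \<in> J" by blast
    have "p + q = (a + c) + (b + d) * x" by (simp add: ab(1) cd(1) algebra_simps)
    then show "p + q \<in> {a + b * x |a b. a \<in> J}" using J(2)[OF ab(2) cd(2)] by blast
  qed
qed

text \<open>If \<open>x\<^sub>v - c\<close> were invertible modulo \<open>J\<close> for every \<open>c\<close>, then uncountably many inverses in a
  space of countable dimension would give a polynomial in \<open>x\<^sub>v\<close> alone that lies in \<open>J\<close>; it would
  also be invertible modulo \<open>J\<close>, being a product of linear factors.\<close>

lemma proper_ideal_adjoin_var:
  fixes J :: "'n::finite mpoly set"
  assumes J: "is_ideal J" "1 \<notin> J"
  obtains c where "1 \<notin> {a + b * (mpoly_var v - mpoly_const c) |a b. a \<in> J}"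
proof (rule ccontr)
  note J' = is_ideal_simps[OF J(1)]
  let ?X = "\<lambda>c. mpoly_var v - mpoly_const c :: 'n mpoly"
  assume "\<not> thesis"
  then have "\<exists>a b. 1 = a + b * ?X c \<and> a \<in> J" for c using that by blast
  then have "\<exists>b. 1 - b * ?X c \<in> J" for c by (metis add_diff_cancel_right')
  then obtain b where b: "\<And>c. 1 - b c * ?X c \<in> J" by metis
  have inv: "\<exists>w. 1 - w * poly_at_var v U \<in> J" if "U \<noteq> 0" for U
    using that
  proof (induction "Polynomial.degree U" arbitrary: U)
    case 0
    then obtain c where c: "U = [:c:]" using Polynomial.degree_eq_zeroE by metis
    have "mpoly_const (1 / c) * poly_at_var v U = 1"
      using 0 by (intro mpoly_eqI) (simp add: c)
    then show ?case using J'(1) by (intro exI[of _ "mpoly_const (1 / c)"]) simp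
  next
    case (Suc n)
    then have "\<not> constant (poly U)" by (simp add: constant_degree)
    then obtain r where "poly U r = 0" using fundamental_theorem_of_algebra by blast
    then obtain V where V: "U = [:- r, 1:] * V" using poly_eq_0_iff_dvd by (metis dvdE)
    have "V \<noteq> 0" using Suc.prems V by auto
    have "Polynomial.degree U = Suc (Polynomial.degree V)" unfolding V by (subst Polynomial.degree_mult_eq) (use \<open>V \<noteq> 0\<close> in auto)
    then obtain w where w: "1 - w * poly_at_var v V \<in> J" using Suc \<open>V \<noteq> 0\<close> by auto
    have eq: "poly_at_var v U = ?X r * poly_at_var v V" by (rule mpoly_eqI) (simp add: V algebra_simps)
    have "1 - (w * b r) * poly_at_var v U
        = (1 - w * poly_at_var v V) + (w * poly_at_var v V) * (1 - b r * ?X r)"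
      unfolding eq by (simp add: algebra_simps)
    then show ?case using J'(2)[OF w J'(3)[OF b]] by metis
  qed
  obtain S :: "real set" and \<beta> where S: "finite S" "\<exists>s\<in>S. \<beta> s \<noteq> 0"
    "(\<Sum>s\<in>S. mpoly_const (\<beta> s) * b (of_real s)) = 0"
    by (rule mpoly_dependent_family[of "\<lambda>s. b (of_real s)"]) blast
  obtain s0 where s0: "s0 \<in> S" "\<beta> s0 \<noteq> 0" using S by blast
  \<comment> \<open>\<open>b s\<close> is an inverse of x_v - s modulo \<open>J\<close>. Clearing
    denominators in the relation between the inverses leads to \<open>U\<close>, which is nonzero
    because only the summand of \<open>s0\<close> survives at \<open>s0\<close>.\<close>
  define U where "U = (\<Sum>s\<in>S. Polynomial.smult (\<beta> s) (\<Prod>t\<in>S - {s}. [:- complex_of_real t, 1:]))"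
  have "poly U (of_real s0) = (\<Sum>s\<in>S. if s = s0 then \<beta> s * (\<Prod>t\<in>S - {s}. of_real s0 - of_real t) else 0)"
    unfolding U_def poly_sum poly_smult poly_prod
    by (rule sum.cong) (use S s0 in \<open>auto intro!: prod_zero\<close>)
  also have "\<dots> = \<beta> s0 * (\<Prod>t\<in>S - {s0}. of_real s0 - of_real t)" using S s0 by simp
  also have "\<dots> \<noteq> 0" using S s0 by simp
  finally have "U \<noteq> 0" by auto
  let ?\<Pi> = "\<lambda>s. \<Prod>t\<in>S - {s}. ?X (of_real t)"
  have "poly_at_var v U = (\<Sum>s\<in>S. mpoly_const (\<beta> s) * ?\<Pi> s)"
    by (rule mpoly_eqI) (simp add: U_def poly_sum poly_prod mpoly_eval_sum mpoly_eval_prod)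
  \<comment> \<open>The subtracted term is zero by the relation; splitting off the factor of
    \<open>s\<close> from its product exhibits 1 - b s (x_v - s), an element of \<open>J\<close>, in
    every summand.\<close>
  also have "\<dots> = (\<Sum>s\<in>S. mpoly_const (\<beta> s) * ?\<Pi> s) - (\<Prod>t\<in>S. ?X (of_real t)) * (\<Sum>s\<in>S. mpoly_const (\<beta> s) * b (of_real s))"
    by (simp add: S(3))
  also have "\<dots> = (\<Sum>s\<in>S. (mpoly_const (\<beta> s) * ?\<Pi> s) * (1 - b (of_real s) * ?X (of_real s)))"
    unfolding sum_distrib_left sum_subtractf[symmetric]
    by (rule sum.cong) (simp_all add: prod.remove[OF S(1)] algebra_simps)
  also have "\<dots> \<in> J"
  proof -
    have "(\<Sum>s\<in>T. (mpoly_const (\<beta> s) * ?\<Pi> s) * (1 - b (of_real s) * ?X (of_real s))) \<in> J" for T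
      by (induction T rule: infinite_finite_induct) (auto intro!: J' b)
    then show ?thesis .
  qed
  finally have U: "poly_at_var v U \<in> J" .
  obtain w where "1 - w * poly_at_var v U \<in> J" using inv[OF \<open>U \<noteq> 0\<close>] by blast
  from J'(2)[OF this J'(3)[OF U, of w]] show False using J(2) by simp
qed

lemma ideal_contains_diff_eval:
  assumes J: "is_ideal J" and var: "\<And>v. mpoly_var v - mpoly_const (x v) \<in> J"
  shows "p - mpoly_const (mpoly_eval p x) \<in> J"
proof (induction p rule: mpoly_induct)
  case (const c)
  show ?case using ideal_0[OF J] by simp
next
  case (var v)
  show ?case using assms(2)[of v] by simp
next
  case (add p q)
  have "(p + q) - mpoly_const (mpoly_eval (p + q) x) = (p - mpoly_const (mpoly_eval p x)) + (q - mpoly_const (mpoly_eval q x))"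
    by (simp add: single_add)
  then show ?case using ideal_add[OF J add] by metis
next
  case (mult p q)
  have "(p * q) - mpoly_const (mpoly_eval (p * q) x)
      = q * (p - mpoly_const (mpoly_eval p x)) + mpoly_const (mpoly_eval p x) * (q - mpoly_const (mpoly_eval q x))"
    by (simp add: algebra_simps mult_single)
  then show ?case using ideal_add[OF J ideal_mult[OF J mult(1)] ideal_mult[OF J mult(2)]] by metis
qed

text \<open>Adjoining some x_v - c for one variable after the other keeps the ideal proper. In the
  end every polynomial is congruent to its value at \<open>x\<close>, and a nonzero value of a
  member of \<open>J\<close> would be a unit in the ideal.\<close>

theorem weak_nullstellensatz:
  fixes J :: "'n::finite mpoly set"
  assumes J: "is_ideal J" "1 \<notin> J"
  obtains x where "\<And>p. p \<in> J \<Longrightarrow> mpoly_eval p x = 0"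
proof -
  have "\<exists>I x. is_ideal I \<and> J \<subseteq> I \<and> 1 \<notin> I \<and> (\<forall>v\<in>V. mpoly_var v - mpoly_const (x v) \<in> I)"
    if "finite V" for V :: "'n set"
    using that
  proof (induction V rule: finite_induct)
    case empty
    show ?case using J by auto
  next
    case (insert v V)
    then obtain I x where I: "is_ideal I" "J \<subseteq> I" "1 \<notin> I" "\<forall>v\<in>V. mpoly_var v - mpoly_const (x v) \<in> I"
      by blast
    obtain c where c: "1 \<notin> {a + b * (mpoly_var v - mpoly_const c) |a b. a \<in> I}"
      by (rule proper_ideal_adjoin_var[OF I(1,3)])
    let ?I = "{a + b * (mpoly_var v - mpoly_const c) |a b. a \<in> I}"
    have "a = a + 0 * (mpoly_var v - mpoly_const c)" for a by simp
    then have 1: "I \<subseteq> ?I" by blast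
    have "mpoly_var v - mpoly_const c = 0 + 1 * (mpoly_var v - mpoly_const c)" by simp
    then have 2: "mpoly_var v - mpoly_const c \<in> ?I" using ideal_0[OF I(1)] by blast
    show ?case
      using I c 1 2 is_ideal_adjoin[OF I(1)] insert.hyps
      by (intro exI[of _ ?I] exI[of _ "x(v := c)"]) (auto; blast)
  qed
  from this[of UNIV] obtain I x where I: "is_ideal I" "J \<subseteq> I" "1 \<notin> I"
    "\<And>v. mpoly_var v - mpoly_const (x v) \<in> I" by auto
  have "mpoly_eval p x = 0" if "p \<in> J" for p
  proof (rule ccontr)
    assume *: "mpoly_eval p x \<noteq> 0"
    have "p - (p - mpoly_const (mpoly_eval p x)) \<in> I"
      by (rule ideal_diff[OF I(1) _ ideal_contains_diff_eval[OF I(1,4)]]) (use that I(2) in blast)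
    then have "mpoly_const (1 / mpoly_eval p x) * mpoly_const (mpoly_eval p x) \<in> I"
      by (intro ideal_mult[OF I(1)]) simp
    then show False using * I(3) by (simp add: mult_single)
  qed
  then show thesis by (rule that)
qed

text \<open>A proper submodule is contained in a maximal one, and the quotient by a maximal one is
  \<open>A / \<mm>\<close> for the ideal \<open>\<mm>\<close> of a point, whose homomorphisms into \<open>F\<close> are the eigenvectors.\<close>

lemma kernel_contains_eigenvector:
  fixes F :: "'n::finite distribution set" and P :: "('n pdo ^ 'k::finite) set"
  assumes sub: "Modules.module.subspace pdo_act F"
    and cog: "injective_cogenerator ring_of_type_algebra (dist_module F)"
    and P: "Modules.module.subspace (*s) P" "P \<noteq> UNIV"
  obtains x c \<phi> j where "\<phi> \<noteq> 0" "\<And>i. dist_D i \<phi> = dist_scale (x i) \<phi>"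
    "(\<chi> l. dist_scale (c l) \<phi>) \<in> kernel F P" "c j = 1"
proof -
  interpret D: Modules.module "pdo_act :: 'n pdo \<Rightarrow> _" by (rule pdo_act_module)
  interpret Modules.module "(*s) :: 'n pdo \<Rightarrow> 'n pdo ^ 'k \<Rightarrow> _" by (rule module_vec)
  let ?e = "\<lambda>j. axis j 1 :: 'n pdo ^ 'k"
  \<comment> \<open>No maximal submodule is built directly. Unit vectors are added to
    \<open>P\<close> as long as the span stays proper; once no further one fits, the quotient by
    \<open>Q T\<close> is cyclic, generated by any remaining unit vector.\<close>
  define Q where "Q = (\<lambda>T. span (P \<union> ?e ` T))"
  have "span P = P" using P(1) by (simp only: span_eq_iff)
  then have "Q {} \<noteq> UNIV" using P(2) unfolding Q_def by (metis image_empty Un_empty_right)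
  moreover have "\<forall>T. Q T \<noteq> UNIV \<longrightarrow> card T < Suc CARD('k)"
    by (auto intro!: card_mono le_imp_less_Suc)
  ultimately obtain T where T: "Q T \<noteq> UNIV" "\<And>T'. Q T' \<noteq> UNIV \<Longrightarrow> card T' \<le> card T"
    using ex_has_greatest_nat[of "\<lambda>T. Q T \<noteq> UNIV" "{}" card "Suc CARD('k)"] by blast
  have e: "?e t \<in> Q T" if "t \<in> T" for t T unfolding Q_def using that by (intro span_base) auto
  have decomp: "p = (\<Sum>l\<in>UNIV. p $ l *s ?e l)" for p
    by (simp add: vec_eq_iff axis_def if_distrib [of "\<lambda>x. _ * x"] sum.delta cong: if_cong)
  have "\<exists>j. j \<notin> T"
  proof (rule ccontr)
    assume "\<nexists>j. j \<notin> T"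
    then have "p \<in> Q T" for p
      using e by (subst decomp) (auto simp: Q_def intro!: span_sum span_scale)
    then show False using T(1) by blast
  qed
  then obtain j where j: "j \<notin> T" by blast
  have "Q (insert j T) = UNIV"
  proof (rule ccontr)
    assume "Q (insert j T) \<noteq> UNIV"
    from T(2)[OF this] j show False by simp
  qed
  moreover have Qj: "Q (insert j T) = {p. \<exists>a. p - a *s ?e j \<in> Q T}"
    by (simp add: Q_def span_insert)
  ultimately have "\<exists>a. ?e l - a *s ?e j \<in> Q T" for l by auto
  \<comment> \<open>Modulo \<open>Q T\<close> every unit vector is a multiple of the
    \<open>j\<close>-th one, with coefficient \<open>b l\<close>. Thus the quotient is the ring
    modulo the ideal \<open>?J\<close> below.\<close>
  then obtain b where b: "\<And>l. ?e l - b l *s ?e j \<in> Q T" by metis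
  let ?J = "{a. a *s ?e j \<in> Q T}"
  have J: "is_ideal ?J"
    unfolding is_ideal_def
  proof (intro conjI allI ballI)
    show "0 \<in> ?J" by (simp add: Q_def span_zero)
    show "p + q \<in> ?J" if "p \<in> ?J" "q \<in> ?J" for p q
      using span_add[of "p *s ?e j" _ "q *s ?e j"] that unfolding Q_def mem_Collect_eq scale_left_distrib .
    show "p * q \<in> ?J" if "q \<in> ?J" for p q
      using span_scale[of "q *s ?e j" _ p] that unfolding Q_def mem_Collect_eq scale_scale .
  qed
  have "1 \<notin> ?J"
  proof
    assume "1 \<in> ?J"
    then have "?e j \<in> Q T" by simp
    obtain p where p: "p \<notin> Q T" using T(1) by blast
    obtain a where "p - a *s ?e j \<in> Q T" using Qj \<open>Q (insert j T) = UNIV\<close> by blast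
    then have "(p - a *s ?e j) + a *s ?e j \<in> Q T"
      using \<open>?e j \<in> Q T\<close> unfolding Q_def by (intro span_add span_scale)
    then show False using p by simp
  qed
  with J obtain x where x: "\<And>p. p \<in> ?J \<Longrightarrow> mpoly_eval p x = 0" using weak_nullstellensatz by blast
  \<comment> \<open>The maximal ideal of the point \<open>x\<close>. Every operator acts on a \<phi>
    killed by it through its value at \<open>x\<close>.\<close>
  let ?I = "{p. mpoly_eval p x = 0}"
  have "is_ideal ?I" "1 \<notin> ?I" by (auto simp: is_ideal_def)
  then obtain \<phi> where \<phi>: "\<phi> \<in> F" "\<phi> \<noteq> 0" "\<And>p. p \<in> ?I \<Longrightarrow> pdo_act p \<phi> = 0"
    by (rule cogenerator_annihilated[OF cog]) blast
  have act: "pdo_act p \<phi> = dist_scale (mpoly_eval p x) \<phi>" for p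
    using \<phi>(3)[of "p - mpoly_const (mpoly_eval p x)"]
    by (simp add: D.scale_left_diff_distrib pdo_act_const)
  show thesis
  proof (rule that[of \<phi> x "\<lambda>l. mpoly_eval (b l) x" j])
    show "dist_D i \<phi> = dist_scale (x i) \<phi>" for i using act[of "mpoly_var i"] by (simp add: pdo_act_var)
    \<comment> \<open>This normalization makes component \<open>j\<close> of the vector equal to
      \<phi> itself.\<close>
    have "1 - b j \<in> ?J"
      using b[of j] unfolding mem_Collect_eq scale_left_diff_distrib scale_one .
    from x[OF this] show "mpoly_eval (b j) x = 1" by simp
    have "(\<Sum>l\<in>UNIV. pdo_act (p $ l) (pdo_act (b l) \<phi>)) = 0" if "p \<in> P" for p
    proof -
      \<comment> \<open>Modulo \<open>Q T\<close> the vector \<open>p\<close> is a multiple of the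
        \<open>j\<close>-th unit vector. For \<open>p\<close> in \<open>P\<close> the coefficient
        therefore lies in \<open>?J\<close> and vanishes at \<open>x\<close>.\<close>
      have "p - (\<Sum>l\<in>UNIV. p $ l * b l) *s ?e j = (\<Sum>l\<in>UNIV. p $ l *s (?e l - b l *s ?e j))"
        by (subst decomp) (simp add: scale_right_diff_distrib sum_subtractf scale_sum_left)
      also have "\<dots> \<in> Q T" using b unfolding Q_def by (intro span_sum span_scale)
      finally have 1: "p - (\<Sum>l\<in>UNIV. p $ l * b l) *s ?e j \<in> Q T" .
      have 2: "p \<in> Q T" unfolding Q_def using that by (intro span_base) auto
      from span_diff[OF 2[unfolded Q_def] 1[unfolded Q_def]]
      have "(\<Sum>l\<in>UNIV. p $ l * b l) *s ?e j \<in> Q T" by (simp add: Q_def)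
      then have "mpoly_eval (\<Sum>l\<in>UNIV. p $ l * b l) x = 0" by (intro x) simp
      then have "pdo_act (\<Sum>l\<in>UNIV. p $ l * b l) \<phi> = 0" by (simp add: act dist_scale_simps)
      then show ?thesis by (simp only: pdo_act_sum_left pdo_act_mult)
    qed
    then show "(\<chi> l. dist_scale (mpoly_eval (b l) x) \<phi>) \<in> kernel F P"
      by (simp add: kernel_def flip: act) (simp add: D.subspace_scale[OF sub] \<phi>(1))
  qed (rule \<phi>(2))
qed

section \<open>Openness and density of full rank\<close>

lemma finite_multi_degree_le: "finite {\<alpha> :: 'n::finite \<Rightarrow>\<^sub>0 nat. multi_degree \<alpha> \<le> d}"
proof (rule finite_subset)
  show "{\<alpha> :: 'n \<Rightarrow>\<^sub>0 nat. multi_degree \<alpha> \<le> d} \<subseteq> Poly_Mapping.lookup -` (UNIV \<rightarrow>\<^sub>E {..d})"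
  proof
    fix \<alpha> :: "'n \<Rightarrow>\<^sub>0 nat" assume \<alpha>: "\<alpha> \<in> {\<alpha>. multi_degree \<alpha> \<le> d}"
    have "Poly_Mapping.lookup \<alpha> v \<le> multi_degree \<alpha>" for v
      unfolding multi_degree_def by (rule member_le_sum) auto
    then show "\<alpha> \<in> Poly_Mapping.lookup -` (UNIV \<rightarrow>\<^sub>E {..d})"
      using \<alpha> order_trans by (auto simp: PiE_def Pi_def extensional_def)
  qed
  show "finite (Poly_Mapping.lookup -` (UNIV \<rightarrow>\<^sub>E {..d}) :: ('n \<Rightarrow>\<^sub>0 nat) set)"
    by (intro finite_vimageI finite_PiE) (auto simp: inj_def poly_mapping.lookup_inject)
qed

lemma mpolys_in_closed:
  shows "mpoly_const c \<in> mpolys_in V" and "v \<in> V \<Longrightarrow> mpoly_var v \<in> mpolys_in V"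
    and "p \<in> mpolys_in V \<Longrightarrow> q \<in> mpolys_in V \<Longrightarrow> p + q \<in> mpolys_in V"
  using keys_add[of p q] by (auto simp: mpolys_in_def)

lemma mpolys_in_sum: "(\<And>i. i \<in> I \<Longrightarrow> f i \<in> mpolys_in V) \<Longrightarrow> (\<Sum>i\<in>I. f i) \<in> mpolys_in V"
  using mpolys_in_closed(1)[of 0 V]
  by (induction I rule: infinite_finite_induct) (auto intro: mpolys_in_closed(3))

lemma mpolys_in_prod: "(\<And>i. i \<in> I \<Longrightarrow> f i \<in> mpolys_in V) \<Longrightarrow> (\<Prod>i\<in>I. f i) \<in> mpolys_in V"
  using mpolys_in_closed(1)[of 1 V]
  by (induction I rule: infinite_finite_induct) (auto intro: mpolys_in_mult)

lemma mpolys_in_det: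
  fixes A :: "'v mpoly ^ 'k ^ 'k::finite"
  assumes "\<And>i j. A $ i $ j \<in> mpolys_in V"
  shows "det A \<in> mpolys_in V"
proof -
  have "mpoly_const (- 1) = (- 1 :: 'v mpoly)"
    unfolding single_one[symmetric] by (simp only: single_uminus)
  then have "of_int (sign \<pi>) \<in> mpolys_in V" for \<pi> :: "'k \<Rightarrow> 'k"
    using mpolys_in_closed(1)[of 1 V] mpolys_in_closed(1)[of "- 1" V] by (auto simp: sign_def)
  then show ?thesis
    unfolding det_def by (intro mpolys_in_sum mpolys_in_mult mpolys_in_prod assms) auto
qed

text \<open>\<open>A\<close> is the generic matrix of degree \<open>d\<close>, with one variable for
  each coefficient of a selected entry, evaluated at the fixed point \<open>x\<close>; its
  determinant is the polynomial in the matrix coordinates.\<close>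

lemma minor_value_polynomial:
  fixes r :: "'k::finite \<Rightarrow> 'l::finite" and x :: "'n::finite \<Rightarrow> complex"
  obtains q where "q \<in> mpolys_in (matrix_indices d :: ('l \<times> 'k \<times> ('n \<Rightarrow>\<^sub>0 nat)) set)"
    "\<And>M :: 'n pdo ^ 'k ^ 'l. M \<in> bounded_matrices d \<Longrightarrow>
       mpoly_eval q (matrix_coords d M) = mpoly_eval (det (\<chi> i. M $ r i)) x"
proof -
  let ?D = "{\<alpha> :: 'n \<Rightarrow>\<^sub>0 nat. multi_degree \<alpha> \<le> d}"
  let ?m = "\<lambda>\<alpha> :: 'n \<Rightarrow>\<^sub>0 nat. \<Prod>v\<in>Poly_Mapping.keys \<alpha>. x v ^ Poly_Mapping.lookup \<alpha> v"
  define A :: "('l \<times> 'k \<times> ('n \<Rightarrow>\<^sub>0 nat)) mpoly ^ 'k ^ 'k" where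
    "A = (\<chi> i j. \<Sum>\<alpha>\<in>?D. mpoly_var (r i, j, \<alpha>) * mpoly_const (?m \<alpha>))"
  show thesis
  proof (rule that[of "det A"])
    show "det A \<in> mpolys_in (matrix_indices d)"
      unfolding A_def
      by (intro mpolys_in_det) (auto simp: matrix_indices_def intro!: mpolys_in_sum mpolys_in_mult mpolys_in_closed)
    fix M :: "'n pdo ^ 'k ^ 'l" assume M: "M \<in> bounded_matrices d"
    have "mpoly_eval (M $ i $ j) x = (\<Sum>\<alpha>\<in>?D. Poly_Mapping.lookup (M $ i $ j) \<alpha> * ?m \<alpha>)" for i j
      by (rule mpoly_eval_superset) (use M in \<open>auto simp: bounded_matrices_def finite_multi_degree_le\<close>)
    then have "mpoly_eval (A $ i $ j) (matrix_coords d M) = mpoly_eval (M $ r i $ j) x" for i j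
      by (simp add: A_def mpoly_eval_sum) (simp add: matrix_coords_def matrix_indices_def)
    then show "mpoly_eval (det A) (matrix_coords d M) = mpoly_eval (det (\<chi> i. M $ r i)) x"
      by (simp add: mpoly_eval_det)
  qed
qed

text \<open>Values of minors rather than minors: each value is a polynomial in the coordinates, so
  failure of full rank is a zero locus in every bounded space. Repetitions in \<open>r\<close> are
  harmless, as they give determinant 0.\<close>

definition full_rank :: "'n::finite pdo ^ 'k::finite ^ 'l::finite \<Rightarrow> bool" where
  "full_rank M \<longleftrightarrow> (\<exists>r x. mpoly_eval (det (\<chi> i. M $ r i)) x \<noteq> 0)"

lemma openin_full_rank: "openin matrix_topology {M :: 'n::finite pdo ^ 'k::finite ^ 'l::finite. full_rank M}"
  unfolding openin_matrix_topology
proof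
  fix d
  let ?V = "matrix_indices d :: ('l \<times> 'k \<times> ('n \<Rightarrow>\<^sub>0 nat)) set"
  let ?B = "bounded_matrices d :: ('n pdo ^ 'k ^ 'l) set"
  have "\<exists>q. q \<in> mpolys_in ?V \<and> (\<forall>M\<in>?B. mpoly_eval q (matrix_coords d M) = mpoly_eval (det (\<chi> i. M $ r i)) x)"
    for r :: "'k \<Rightarrow> 'l" and x :: "'n \<Rightarrow> complex"
    by (rule minor_value_polynomial[of d r x]) blast
  then obtain q where q: "\<And>(r :: 'k \<Rightarrow> 'l) (x :: 'n \<Rightarrow> complex). q r x \<in> mpolys_in ?V"
    "\<And>(r :: 'k \<Rightarrow> 'l) (x :: 'n \<Rightarrow> complex) M. M \<in> ?B \<Longrightarrow>
       mpoly_eval (q r x) (matrix_coords d M) = mpoly_eval (det (\<chi> i. M $ r i)) x" by metis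
  have coords: "matrix_coords d M \<in> ?V \<rightarrow>\<^sub>E UNIV" if "M \<in> ?B" for M
    using bij_betw_apply[OF bij_betw_matrix_coords that] .
  have locus: "matrix_coords d M \<in> zero_locus ?V (range (\<lambda>(r, x). q r x)) \<longleftrightarrow> \<not> full_rank M" if "M \<in> ?B" for M
    using coords[OF that] unfolding full_rank_def zero_locus_def by (simp add: q(2)[OF that])
  have "{M. full_rank M} \<inter> ?B
      = matrix_coords d -` ((?V \<rightarrow>\<^sub>E UNIV) - zero_locus ?V (range (\<lambda>(r, x). q r x))) \<inter> ?B"
  proof (rule Set.set_eqI)
    fix M
    show "M \<in> {M. full_rank M} \<inter> ?B
      \<longleftrightarrow> M \<in> matrix_coords d -` ((?V \<rightarrow>\<^sub>E UNIV) - zero_locus ?V (range (\<lambda>(r, x). q r x))) \<inter> ?B"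
      by (cases "M \<in> ?B") (simp_all add: coords locus)
  qed
  moreover have "openin (zariski ?V) ((?V \<rightarrow>\<^sub>E UNIV) - zero_locus ?V (range (\<lambda>(r, x). q r x)))"
    unfolding openin_zariski
    by (intro exI[of _ "range (\<lambda>(r, x). q r x)"] conjI refl image_subsetI) (simp add: q(1) split_def)
  ultimately show "openin (bounded_matrix_topology d) ({M. full_rank M} \<inter> ?B)"
    unfolding bounded_matrix_topology_def openin_pullback_topology by blast
qed

lemma bounded_matrices_exhaust:
  fixes M :: "'n::finite pdo ^ 'k::finite ^ 'l::finite"
  obtains d where "M \<in> bounded_matrices d"
proof
  let ?s = "\<lambda>i j. \<Sum>\<alpha>\<in>Poly_Mapping.keys (M $ i $ j). multi_degree \<alpha>"
  have "multi_degree \<alpha> \<le> (\<Sum>i\<in>UNIV. \<Sum>j\<in>UNIV. ?s i j)" if "\<alpha> \<in> Poly_Mapping.keys (M $ i $ j)" for i j \<alpha>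
  proof -
    have "multi_degree \<alpha> \<le> ?s i j" by (rule member_le_sum) (use that in auto)
    also have "\<dots> \<le> (\<Sum>j\<in>UNIV. ?s i j)" by (rule member_le_sum) auto
    also have "\<dots> \<le> (\<Sum>i\<in>UNIV. \<Sum>j\<in>UNIV. ?s i j)" by (rule member_le_sum) auto
    finally show ?thesis .
  qed
  then show "M \<in> bounded_matrices (\<Sum>i\<in>UNIV. \<Sum>j\<in>UNIV. ?s i j)" by (simp add: bounded_matrices_def)
qed

text \<open>On the line from a matrix in the open set to one with an identity block, each of the
  two open conditions fails for finitely many parameters only.\<close>

lemma full_rank_dense:
  fixes W :: "('n::finite pdo ^ 'k::finite ^ 'l::finite) set"
  assumes W: "openin matrix_topology W" "W \<noteq> {}" and card: "CARD('k) \<le> CARD('l)"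
  obtains M where "M \<in> W" "full_rank M"
proof -
  obtain M0 where M0: "M0 \<in> W" using W(2) by blast
  obtain d where d: "M0 \<in> bounded_matrices d" by (rule bounded_matrices_exhaust)
  let ?V = "matrix_indices d :: ('l \<times> 'k \<times> ('n \<Rightarrow>\<^sub>0 nat)) set"
  let ?B = "bounded_matrices d :: ('n pdo ^ 'k ^ 'l) set"
  have "openin (bounded_matrix_topology d) (W \<inter> ?B)" using W(1) by (simp add: openin_matrix_topology)
  then obtain S where S: "S \<subseteq> mpolys_in ?V" "W \<inter> ?B = matrix_coords d -` ((?V \<rightarrow>\<^sub>E UNIV) - zero_locus ?V S) \<inter> ?B"
    unfolding bounded_matrix_topology_def openin_pullback_topology openin_zariski by blast
  have coords: "matrix_coords d M \<in> ?V \<rightarrow>\<^sub>E UNIV" if "M \<in> ?B" for M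
    using bij_betw_apply[OF bij_betw_matrix_coords that] .
  have WB: "M \<in> W \<longleftrightarrow> (\<exists>p\<in>S. mpoly_eval p (matrix_coords d M) \<noteq> 0)" if "M \<in> ?B" for M
  proof -
    have "M \<in> W \<longleftrightarrow> M \<in> W \<inter> ?B" using that by blast
    also have "\<dots> \<longleftrightarrow> (\<exists>p\<in>S. mpoly_eval p (matrix_coords d M) \<noteq> 0)"
      unfolding S(2) using that coords[OF that] by (auto simp: zero_locus_def)
    finally show ?thesis .
  qed
  obtain p where p: "p \<in> S" "mpoly_eval p (matrix_coords d M0) \<noteq> 0" using WB[OF d] M0 by blast
  obtain e :: "'k \<Rightarrow> 'l" where e: "inj e"
    using card card_le_inj[of "UNIV :: 'k set" "UNIV :: 'l set"] by auto
  \<comment> \<open>Entries of degree 0 lie in every bounded space. The minor in the rows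
    \<open>e\<close> is 1 at every point, so its value at 0 can serve as the second open
    condition.\<close>
  define M1 :: "'n pdo ^ 'k ^ 'l" where "M1 = (\<chi> i j. if i = e j then 1 else 0)"
  have M1: "M1 \<in> ?B" by (auto simp: M1_def bounded_matrices_def multi_degree_def)
  obtain q where q: "\<And>M :: 'n pdo ^ 'k ^ 'l. M \<in> ?B \<Longrightarrow>
       mpoly_eval q (matrix_coords d M) = mpoly_eval (det (\<chi> i. M $ e i)) (\<lambda>_. 0)"
    by (rule minor_value_polynomial[of d e "\<lambda>_. 0"]) blast
  let ?x = "matrix_coords d M0" and ?y = "\<lambda>v. matrix_coords d M1 v - matrix_coords d M0 v"
  obtain a b where a: "\<And>t. mpoly_eval p (\<lambda>v. ?x v + t * ?y v) = poly a t"
    and b: "\<And>t. mpoly_eval q (\<lambda>v. ?x v + t * ?y v) = poly b t"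
    using mpoly_eval_line[of p ?x ?y] mpoly_eval_line[of q ?x ?y] by blast
  have "(\<chi> i. M1 $ e i) = mat 1"
    using e by (auto simp: M1_def mat_def vec_eq_iff inj_eq)
  then have "poly b 1 = 1" using b[of 1] q[OF M1] by simp
  moreover have "poly a 0 \<noteq> 0" using a[of 0] p(2) by simp
  ultimately have "finite {t. poly (a * b) t = 0}" by (intro poly_roots_finite) auto
  then have "{t. poly (a * b) t = 0} \<noteq> UNIV" using infinite_UNIV_char_0 by metis
  then obtain t where "poly (a * b) t \<noteq> 0" by blast
  then have t: "poly a t \<noteq> 0" "poly b t \<noteq> 0" by simp_all
  \<comment> \<open>The matrix whose coordinates are the point with parameter \<open>t\<close> on
    the line.\<close>
  define M where "M = (\<chi> i j. M0 $ i $ j + mpoly_const t * (M1 $ i $ j - M0 $ i $ j))"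
  have lookup_M: "Poly_Mapping.lookup (M $ i $ j) \<alpha> = Poly_Mapping.lookup (M0 $ i $ j) \<alpha> +
      t * (Poly_Mapping.lookup (M1 $ i $ j) \<alpha> - Poly_Mapping.lookup (M0 $ i $ j) \<alpha>)" for i j \<alpha>
  proof -
    have "Poly_Mapping.lookup (mpoly_const t * f) \<alpha> = t * Poly_Mapping.lookup f \<alpha>" for f :: "'n pdo"
      by (rule additive_eqI[of "\<lambda>f. Poly_Mapping.lookup (mpoly_const t * f) \<alpha>" "\<lambda>f. t * Poly_Mapping.lookup f \<alpha>"])
        (simp_all add: distrib_left lookup_add mult_single lookup_single when_def)
    then show ?thesis by (simp add: M_def lookup_add lookup_minus)
  qed
  have M: "M \<in> ?B"
    unfolding bounded_matrices_def
  proof (intro CollectI allI ballI)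
    fix i j \<alpha> assume "\<alpha> \<in> Poly_Mapping.keys (M $ i $ j)"
    then have "\<alpha> \<in> Poly_Mapping.keys (M0 $ i $ j) \<or> \<alpha> \<in> Poly_Mapping.keys (M1 $ i $ j)"
      by (auto simp: in_keys_iff lookup_M)
    then show "multi_degree \<alpha> \<le> d" using d M1 unfolding bounded_matrices_def by blast
  qed
  have "matrix_coords d M = (\<lambda>v. ?x v + t * ?y v)"
    by (auto simp: matrix_coords_def lookup_M fun_eq_iff)
  then have "mpoly_eval p (matrix_coords d M) \<noteq> 0" "mpoly_eval q (matrix_coords d M) \<noteq> 0"
    using t a b by simp_all
  then show thesis
    using WB[OF M] p(1) q[OF M] by (intro that[of M]) (auto simp: full_rank_def)
qed

section \<open>Transfer from matrices to systems\<close>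

lemma openin_system_topology:
  "openin (system_topology (l :: 'l::finite itself) F) W \<longleftrightarrow>
     W \<subseteq> topspace (system_topology l F) \<and>
     openin matrix_topology {M :: 'n::finite pdo ^ 'k::finite ^ 'l. kernel F (row_module M) \<in> W}"
  unfolding system_topology_def submodule_topology_def openin_quotient_topology
    topspace_quotient_topology topspace_matrix_topology
  by auto

text \<open>By \<open>eq\<close> the preimage of \<open>S\<close> under both quotient maps is
  exactly the set of full rank matrices, so openness and density can be tested on matrices.\<close>

lemma generic_full_rank:
  fixes F :: "'n::finite distribution set"
  assumes eq: "\<And>M :: 'n pdo ^ 'k::finite ^ 'l::finite. kernel F (row_module M) \<in> S \<longleftrightarrow> full_rank M"
    and sub: "S \<subseteq> topspace (system_topology TYPE('l) F)" and card: "CARD('k) \<le> CARD('l)"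
  shows "openin (system_topology TYPE('l) F) S"
    and "system_topology TYPE('l) F closure_of S = topspace (system_topology TYPE('l) F)"
proof -
  show "openin (system_topology TYPE('l) F) S"
    by (simp add: openin_system_topology sub eq openin_full_rank)
  show "system_topology TYPE('l) F closure_of S = topspace (system_topology TYPE('l) F)"
  proof (intro equalityI closure_of_subset_topspace subsetI)
    fix B :: "('n distribution ^ 'k) set" assume B: "B \<in> topspace (system_topology TYPE('l) F)"
    then obtain M0 :: "'n pdo ^ 'k ^ 'l" where M0: "B = kernel F (row_module M0)"
      by (auto simp: topspace_system_topology)
    have "\<exists>C. C \<in> S \<and> C \<in> W" if W: "B \<in> W" "openin (system_topology TYPE('l) F) W" for W
    proof -
      let ?W = "{M :: 'n pdo ^ 'k ^ 'l. kernel F (row_module M) \<in> W}"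
      have "openin matrix_topology ?W" "?W \<noteq> {}" using W M0 by (auto simp: openin_system_topology)
      then obtain M :: "'n pdo ^ 'k ^ 'l" where "M \<in> ?W" "full_rank M" by (rule full_rank_dense[OF _ _ card])
      then show ?thesis using eq by blast
    qed
    then show "B \<in> system_topology TYPE('l) F closure_of S" using B by (auto simp: in_closure_of)
  qed
qed

section \<open>Smooth functions and distributions\<close>

text \<open>Smoothness is shown by exhibiting a family of differentiable functions closed under
  \<open>partial\<close>, with no formula for iterated derivatives.\<close>

lemma smooth_coinduct:
  assumes "f \<in> S" "\<And>f x. f \<in> S \<Longrightarrow> f differentiable at x" "\<And>f j. f \<in> S \<Longrightarrow> partial j f \<in> S"
  shows "smooth f"
proof -
  have "partials js f \<in> S" for js by (induction js) (simp_all add: assms)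
  then show ?thesis unfolding smooth_def differentiable_on_def
    using assms(2) by (simp add: differentiable_at_withinI)
qed

lemma partial_eqI: "(f has_derivative f') (at x) \<Longrightarrow> partial j f x = f' (axis j 1)"
  unfolding partial_def by (metis frechet_derivative_at)

lemma has_derivative_frechet: "smooth f \<Longrightarrow> (f has_derivative frechet_derivative f (at x)) (at x)"
  using smooth_differentiable frechet_derivative_works by blast

text \<open>Only differentiability is assumed because members of \<open>product_sums\<close> are not
  yet known to be smooth where this is applied.\<close>

lemma partial_add_differentiable:
  assumes "\<And>x. f differentiable at x" "\<And>x. g differentiable at x"
  shows "partial j (\<lambda>x. f x + g x) = (\<lambda>x. partial j f x + partial j g x)"
proof
  fix x
  have "((\<lambda>x. f x + g x) has_derivative
      (\<lambda>h. frechet_derivative f (at x) h + frechet_derivative g (at x) h)) (at x)"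
    using assms by (intro has_derivative_add) (auto simp: frechet_derivative_works[symmetric])
  from partial_eqI[OF this]
  show "partial j (\<lambda>x. f x + g x) x = partial j f x + partial j g x" by (simp add: partial_def)
qed

lemma partial_mult:
  assumes "smooth f" "smooth g"
  shows "partial j (\<lambda>x. f x * g x) = (\<lambda>x. f x * partial j g x + partial j f x * g x)"
proof
  fix x
  show "partial j (\<lambda>x. f x * g x) x = f x * partial j g x + partial j f x * g x"
    using partial_eqI[OF has_derivative_mult[OF has_derivative_frechet[OF assms(1)] has_derivative_frechet[OF assms(2)]]]
    by (simp add: partial_def)
qed

text \<open>The smallest convenient family that contains products and is closed under
  \<open>partial\<close> by the Leibniz rule.\<close>

inductive_set product_sums :: "(real ^ 'n::finite \<Rightarrow> complex) set" where
  product: "smooth f \<Longrightarrow> smooth g \<Longrightarrow> (\<lambda>x. f x * g x) \<in> product_sums"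
| sum: "f \<in> product_sums \<Longrightarrow> g \<in> product_sums \<Longrightarrow> (\<lambda>x. f x + g x) \<in> product_sums"

lemma smooth_mult:
  assumes "smooth f" "smooth g"
  shows "smooth (\<lambda>x. f x * g x)"
proof (rule smooth_coinduct[of _ product_sums])
  show "(\<lambda>x. f x * g x) \<in> product_sums" using assms by (rule product)
  show diff: "f differentiable at x" if "f \<in> product_sums" for f :: "real ^ 'a \<Rightarrow> complex" and x
    using that by induction (simp_all add: differentiable_mult smooth_differentiable)
  show "partial j f \<in> product_sums" if "f \<in> product_sums" for f :: "real ^ 'a \<Rightarrow> complex" and j
    using that
  proof induction
    case (product f g)
    then show ?case
      unfolding partial_mult[OF product] by (intro product_sums.intros smooth_partial)
  next
    case (sum f g)
    show ?case
      using sum unfolding partial_add_differentiable[OF diff[OF sum(1)] diff[OF sum(2)]]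
      by (intro product_sums.intros)
  qed
qed

lemma smooth_const: "smooth (\<lambda>x. c)"
proof (rule smooth_coinduct[of _ "range (\<lambda>c x. c)"])
  show "partial j f \<in> range (\<lambda>c x. c)" if "f \<in> range (\<lambda>c x. c)" for f :: "real ^ 'a \<Rightarrow> complex" and j
  proof -
    from that obtain c where "f = (\<lambda>x. c)" by blast
    then have "partial j f = (\<lambda>x. 0)" using partial_eqI[OF has_derivative_const] by auto
    then show ?thesis by blast
  qed
qed auto

lemma smooth_diff: "smooth f \<Longrightarrow> smooth g \<Longrightarrow> smooth (\<lambda>x. f x - g x)"
  using smooth_add[of f "\<lambda>x. - 1 * g x"] smooth_scale[of g "- 1"] by simp

lemma smooth_prod: "(\<And>i. i \<in> I \<Longrightarrow> smooth (f i)) \<Longrightarrow> smooth (\<lambda>x. \<Prod>i\<in>I. f i x)"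
  by (induction I rule: infinite_finite_induct) (auto intro: smooth_const smooth_mult)

text \<open>The closed family consists of the quotients g / f^k: differentiation gives (g' f - k g
  f') / f^(k+1), again of this form.\<close>

lemma smooth_inverse:
  assumes f: "smooth f" and nz: "\<And>x. f x \<noteq> 0"
  shows "smooth (\<lambda>x. inverse (f x))"
proof -
  let ?S = "{\<lambda>x. g x * inverse (f x) ^ k |g k. smooth g}"
  have deriv: "((\<lambda>x. g x * inverse (f x) ^ k) has_derivative
      (\<lambda>h. (frechet_derivative g (at x) h * f x - of_nat k * g x * frechet_derivative f (at x) h)
         * inverse (f x) ^ Suc k)) (at x)" if g: "smooth g" for g k x
  proof (cases k)
    case 0
    then show ?thesis using has_derivative_frechet[OF g] nz[of x] by (auto simp: field_simps)
  next
    case (Suc m)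
    show ?thesis unfolding Suc
      by (rule derivative_eq_intros has_derivative_frechet[OF g] has_derivative_frechet[OF f] refl nz)+
        (use nz[of x] in \<open>simp add: fun_eq_iff field_simps\<close>)
  qed
  have part: "partial j (\<lambda>x. g x * inverse (f x) ^ k) =
      (\<lambda>x. (partial j g x * f x - of_nat k * g x * partial j f x) * inverse (f x) ^ Suc k)"
    if "smooth g" for g k j
    using partial_eqI[OF deriv[OF that]] by (auto simp: partial_def)
  have S: "(\<lambda>x. g x * inverse (f x) ^ k) \<in> ?S" if "smooth g" for g k using that by blast
  have "smooth (\<lambda>x. 1 * inverse (f x) ^ 1)"
  proof (rule smooth_coinduct[of _ ?S])
    show "(\<lambda>x. 1 * inverse (f x) ^ 1) \<in> ?S" by (rule S) (rule smooth_const)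
    show "h differentiable at x" if "h \<in> ?S" for h x
      using that deriv differentiableI by blast
    show "partial j h \<in> ?S" if h: "h \<in> ?S" for h j
    proof -
      from h obtain g k where g: "h = (\<lambda>x. g x * inverse (f x) ^ k)" "smooth g" by blast
      show ?thesis
        unfolding g(1) part[OF g(2)]
        by (intro S smooth_diff smooth_mult smooth_const smooth_partial f g)
    qed
  qed
  then show ?thesis by simp
qed

section \<open>Flat exponentials and smooth cutoffs of cubes\<close>

definition flat_exp :: "real poly \<Rightarrow> real \<Rightarrow> real" where
  "flat_exp P t = (if t > 0 then poly P (1 / t) * exp (- 1 / t) else 0)"

lemma tendsto_poly_exp: "((\<lambda>y :: real. poly P y * exp (- y)) \<longlongrightarrow> 0) at_top"
proof -
  have "((\<lambda>y :: real. \<Sum>i\<le>Polynomial.degree P. Polynomial.coeff P i * (y ^ i / exp y)) \<longlongrightarrow> (\<Sum>i\<le>Polynomial.degree P. Polynomial.coeff P i * 0)) at_top"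
    by (intro tendsto_intros tendsto_power_div_exp_0)
  then show ?thesis by (simp add: poly_altdef sum_distrib_right sum_divide_distrib exp_minus field_simps)
qed

text \<open>With y = 1/t the chain rule produces the factor y^2, which is
  \<open>[:0, 0, 1:]\<close>, so the polynomial parameter keeps the family closed under derivatives.
  At 0 the right difference quotient is y P(y) exp(-y), which tends to 0.\<close>

lemma flat_exp_deriv:
  "(flat_exp P has_real_derivative flat_exp ([:0, 0, 1:] * (P - pderiv P)) t) (at t)"
proof -
  consider "t > 0" | "t < 0" | "t = 0" by linarith
  then show ?thesis
  proof cases
    case 1
    have "((\<lambda>t. poly P (1 / t) * exp (- 1 / t)) has_real_derivative flat_exp ([:0, 0, 1:] * (P - pderiv P)) t) (at t)"
      using 1 by (auto intro!: derivative_eq_intros DERIV_chain2[OF poly_DERIV] simp: flat_exp_def field_simps power2_eq_square)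
    then show ?thesis
      by (rule DERIV_cong_ev[THEN iffD1, rotated 3]) (use 1 in \<open>auto simp: flat_exp_def eventually_nhds intro!: exI[of _ "{0<..}"]\<close>)
  next
    case 2
    have "((\<lambda>t. 0) has_real_derivative flat_exp ([:0, 0, 1:] * (P - pderiv P)) t) (at t)"
      using 2 by (simp add: flat_exp_def)
    then show ?thesis
      by (rule DERIV_cong_ev[THEN iffD1, rotated 3]) (use 2 in \<open>auto simp: flat_exp_def eventually_nhds intro!: exI[of _ "{..<0}"]\<close>)
  next
    case 3
    have "((\<lambda>h. poly (pCons 0 P) (1 / h) * exp (- (1 / h))) \<longlongrightarrow> 0) (at_right 0)"
      by (rule filterlim_compose[OF tendsto_poly_exp]) (simp add: filterlim_inverse_at_top_right divide_inverse)
    then have right: "((\<lambda>h. flat_exp P h / h) \<longlongrightarrow> 0) (at_right 0)"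
      by (rule Lim_transform_eventually) (auto simp: eventually_at_filter flat_exp_def)
    have left: "((\<lambda>h. flat_exp P h / h) \<longlongrightarrow> 0) (at_left 0)"
      by (rule Lim_transform_eventually[OF tendsto_const]) (auto simp: eventually_at_filter flat_exp_def)
    show ?thesis
      using filterlim_split_at[OF left right] by (simp add: DERIV_def 3 flat_exp_def[of _ 0])
  qed
qed

lemma smooth_flat_exp:
  "smooth (\<lambda>x :: real ^ 'n::finite. complex_of_real (flat_exp P (a * (x $ j) + b)))"
proof -
  let ?f = "\<lambda>P (x :: real ^ 'n). complex_of_real (flat_exp P (a * (x $ j) + b))"
  let ?D = "\<lambda>P. [:0, 0, 1:] * (P - pderiv P)"
  have deriv: "(?f P has_derivative (\<lambda>h. of_real (flat_exp (?D P) (a * (x $ j) + b) * (a * (h $ j))))) (at x)" for P x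
  proof -
    have "((\<lambda>x :: real ^ 'n. a * (x $ j) + b) has_derivative (\<lambda>h. a * (h $ j))) (at x)"
      by (auto intro!: derivative_eq_intros bounded_linear_imp_has_derivative bounded_linear_vec_nth)
    from has_derivative_compose[OF this flat_exp_deriv[unfolded has_field_derivative_def]]
    have "((\<lambda>x :: real ^ 'n. flat_exp P (a * (x $ j) + b)) has_derivative
       (\<lambda>h. flat_exp (?D P) (a * (x $ j) + b) * (a * (h $ j)))) (at x)" .
    then show ?thesis by (rule has_derivative_of_real)
  qed
  have part: "partial i (?f P) = (if i = j then ?f (Polynomial.smult a (?D P)) else ?f 0)" for i P
  proof
    fix x
    show "partial i (?f P) x = (if i = j then ?f (Polynomial.smult a (?D P)) else ?f 0) x"
      using partial_eqI[OF deriv[of P x], of i] by (auto simp: flat_exp_def axis_def)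
  qed
  show ?thesis
  proof (rule smooth_coinduct[of _ "range ?f"])
    show "h differentiable at x" if "h \<in> range ?f" for h x
      using that deriv differentiableI by blast
    show "partial i h \<in> range ?f" if "h \<in> range ?f" for h i
      using that part by auto
  qed blast
qed

text \<open>The denominator is positive since t and 1 - t are never both nonpositive.\<close>

definition smooth_step :: "real \<Rightarrow> real" where
  "smooth_step t = flat_exp 1 t / (flat_exp 1 t + flat_exp 1 (1 - t))"

lemma smooth_step_0: "t \<le> 0 \<Longrightarrow> smooth_step t = 0" and smooth_step_1: "t \<ge> 1 \<Longrightarrow> smooth_step t = 1"
  by (auto simp: smooth_step_def flat_exp_def)

lemma smooth_smooth_step:
  "smooth (\<lambda>x :: real ^ 'n::finite. complex_of_real (smooth_step (a * (x $ j) + b)))"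
proof -
  let ?t = "\<lambda>x :: real ^ 'n. a * (x $ j) + b"
  have pos: "flat_exp 1 t + flat_exp 1 (1 - t) > 0" for t
    by (auto simp: flat_exp_def intro!: add_pos_nonneg)
  have smooth2: "smooth (\<lambda>x. complex_of_real (flat_exp 1 (1 - ?t x)))"
    using smooth_flat_exp[of 1 "- a" j "1 - b"] by (simp add: algebra_simps)
  have nz: "complex_of_real (flat_exp 1 t) + complex_of_real (flat_exp 1 (1 - t)) \<noteq> 0" for t
    using pos[of t] by (metis less_irrefl of_real_add of_real_eq_0_iff)
  have "smooth (\<lambda>x. complex_of_real (flat_exp 1 (?t x)) * inverse (complex_of_real (flat_exp 1 (?t x)) + complex_of_real (flat_exp 1 (1 - ?t x))))"
    by (intro smooth_mult smooth_inverse smooth_add smooth_flat_exp smooth2 nz)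
  then show ?thesis by (simp add: smooth_step_def divide_inverse)
qed

text \<open>Equal to 1 on the cube of half-side \<open>R\<close> and to 0 off the one of half-side R
  + 1. The factors 1 and -1 match the affine form a x_j + b of
  \<open>smooth_smooth_step\<close>.\<close>

definition cutoff_fun :: "real \<Rightarrow> real ^ 'n::finite \<Rightarrow> complex" where
  "cutoff_fun R x = (\<Prod>j\<in>UNIV. of_real (smooth_step (1 * (x $ j) + (R + 1))) * of_real (smooth_step ((- 1) * (x $ j) + (R + 1))))"

lemma smooth_cutoff_fun: "smooth (cutoff_fun R)"
  unfolding cutoff_fun_def by (intro smooth_prod smooth_mult smooth_smooth_step)

lemma cutoff_fun_1:
  fixes x :: "real ^ 'n::finite"
  assumes "\<And>j. \<bar>x $ j\<bar> \<le> R" shows "cutoff_fun R x = 1"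
proof -
  have "x $ j + (R + 1) \<ge> 1" "- (x $ j) + (R + 1) \<ge> 1" for j using assms[of j] by linarith+
  then show ?thesis by (simp add: cutoff_fun_def smooth_step_1)
qed

lemma cutoff_fun_0:
  fixes x :: "real ^ 'n::finite"
  assumes "\<bar>x $ j\<bar> \<ge> R + 1" shows "cutoff_fun R x = 0"
proof -
  have "x $ j + (R + 1) \<le> 0 \<or> - (x $ j) + (R + 1) \<le> 0" using assms by linarith
  then have "smooth_step (1 * (x $ j) + (R + 1)) = 0 \<or> smooth_step ((- 1) * (x $ j) + (R + 1)) = 0"
    using smooth_step_0 by auto
  then show ?thesis unfolding cutoff_fun_def by (intro prod_zero) auto
qed

lemma support_subset_closed: "closed K \<Longrightarrow> (\<And>x. f x \<noteq> 0 \<Longrightarrow> x \<in> K) \<Longrightarrow> support f \<subseteq> K"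
  unfolding support_def by (rule closure_minimal) auto

lemma zero_outside_support: "x \<notin> support f \<Longrightarrow> f x = 0"
  using closure_subset[of "{x. f x \<noteq> 0}"] by (auto simp: support_def)

lemma closed_coordinate_slab: "closed {x :: real ^ 'n::finite. \<forall>j\<in>J. \<bar>x $ j - y $ j\<bar> \<le> r}"
proof -
  have "{x :: real ^ 'n. \<forall>j\<in>J. \<bar>x $ j - y $ j\<bar> \<le> r} = (\<Inter>j\<in>J. {x. \<bar>x $ j - y $ j\<bar> \<le> r})" by auto
  moreover have "closed {x :: real ^ 'n. \<bar>x $ j - y $ j\<bar> \<le> r}" for j
    by (intro closed_Collect_le continuous_intros)
  ultimately show ?thesis by auto
qed

lemma test_fun_cutoff_fun: "test_fun (cutoff_fun R :: real ^ 'n::finite \<Rightarrow> complex)"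
proof -
  let ?K = "cbox (\<chi> i. - (R + 1)) (\<chi> i. R + 1) :: (real ^ 'n) set"
  have "support (cutoff_fun R :: real ^ 'n \<Rightarrow> complex) \<subseteq> ?K"
  proof (rule support_subset_closed)
    fix x :: "real ^ 'n" assume "cutoff_fun R x \<noteq> 0"
    then have "\<bar>x $ j\<bar> < R + 1" for j using cutoff_fun_0[of R x j] by linarith
    then have "- (R + 1) \<le> x $ j \<and> x $ j \<le> R + 1" for j using abs_less_iff[of "x $ j" "R + 1"] by (simp add: less_imp_le)
    then show "x \<in> ?K" by (simp add: mem_box_cart)
  qed (rule closed_cbox)
  then have "compact (support (cutoff_fun R :: real ^ 'n \<Rightarrow> complex))"
    using compact_Int_closed[of ?K "support (cutoff_fun R :: real ^ 'n \<Rightarrow> complex)"]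
    by (simp add: inf.absorb2 support_def)
  then show ?thesis by (simp add: test_fun_def smooth_cutoff_fun)
qed

lemma test_fun_mult_smooth:
  assumes "test_fun f" "smooth g"
  shows "test_fun (\<lambda>x. f x * g x)" "support (\<lambda>x. f x * g x) \<subseteq> support f"
proof -
  show "support (\<lambda>x. f x * g x) \<subseteq> support f" unfolding support_def by (rule closure_mono) auto
  then show "test_fun (\<lambda>x. f x * g x)"
    using assms compact_support_subset smooth_mult unfolding test_fun_def by blast
qed

section \<open>Linearity and continuity of distributions\<close>

lemma is_distribution_apply: "is_distribution (dist_apply u)"
  using dist_apply[of u] by simp

lemma dist_apply_fun_add: "test_fun \<phi> \<Longrightarrow> test_fun \<psi> \<Longrightarrow> dist_apply u (\<lambda>x. \<phi> x + \<psi> x) = dist_apply u \<phi> + dist_apply u \<psi>"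
  using is_distribution_apply[of u] by (simp add: is_distribution_def)

lemma dist_apply_fun_scale: "test_fun \<phi> \<Longrightarrow> dist_apply u (\<lambda>x. c * \<phi> x) = c * dist_apply u \<phi>"
  using is_distribution_apply[of u] by (simp add: is_distribution_def)

lemma test_fun_diff: "test_fun f \<Longrightarrow> test_fun g \<Longrightarrow> test_fun (\<lambda>x. f x - g x)"
  using test_fun_add[of f "\<lambda>x. - 1 * g x"] test_fun_scale[of g "- 1"] by simp

lemma dist_apply_fun_diff: "test_fun \<phi> \<Longrightarrow> test_fun \<psi> \<Longrightarrow> dist_apply u (\<lambda>x. \<phi> x - \<psi> x) = dist_apply u \<phi> - dist_apply u \<psi>"
  using dist_apply_fun_add[of \<phi> "\<lambda>x. - 1 * \<psi> x" u] dist_apply_fun_scale[of \<psi> u "- 1"] test_fun_scale[of \<psi> "- 1"] by simp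

lemma test_fun_zero: "test_fun (\<lambda>x. 0)"
  by (simp add: test_fun_def smooth_const support_def)

lemma dist_apply_fun_zero: "dist_apply u (\<lambda>x. 0) = 0"
  using dist_apply_fun_scale[OF test_fun_zero, of u 0] by simp

lemma test_fun_sum: "(\<And>i. i \<in> I \<Longrightarrow> test_fun (f i)) \<Longrightarrow> test_fun (\<lambda>x. \<Sum>i\<in>I. f i x)"
  by (induction I rule: infinite_finite_induct) (auto intro: test_fun_zero test_fun_add)

lemma dist_apply_fun_sum:
  "(\<And>i. i \<in> I \<Longrightarrow> test_fun (f i)) \<Longrightarrow> dist_apply u (\<lambda>x. \<Sum>i\<in>I. f i x) = (\<Sum>i\<in>I. dist_apply u (f i))"
  by (induction I rule: infinite_finite_induct) (auto simp: dist_apply_fun_zero dist_apply_fun_add test_fun_sum)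

lemma distribution_eqI: "(\<And>\<phi>. test_fun \<phi> \<Longrightarrow> dist_apply u \<phi> = dist_apply v \<phi>) \<Longrightarrow> u = v"
  using dist_apply[of u] dist_apply[of v] by (intro dist_apply_inject[THEN iffD1] ext) (metis (mono_tags, lifting) mem_Collect_eq)

text \<open>On the fixed compact set a single seminorm bounds \<open>u\<close>, and that seminorm is
  a finite sum of suprema which tend to 0.\<close>

lemma dist_apply_tendsto_0:
  fixes \<psi> :: "'m \<Rightarrow> real ^ 'n::finite \<Rightarrow> complex"
  assumes K: "compact K" "\<And>m. test_fun (\<psi> m)" "\<And>m. support (\<psi> m) \<subseteq> K"
    and lim: "\<And>js. uniform_limit UNIV (\<lambda>m. partials js (\<psi> m)) (\<lambda>_. 0) F"
  shows "((\<lambda>m. dist_apply u (\<psi> m)) \<longlongrightarrow> 0) F"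
proof -
  obtain C N where C: "C \<ge> 0"
    "\<And>\<phi> M. test_fun \<phi> \<Longrightarrow> support \<phi> \<subseteq> K \<Longrightarrow> N \<le> M \<Longrightarrow> cmod (dist_apply u \<phi>) \<le> C * seminorm M \<phi>"
    using is_distribution_bound[OF is_distribution_apply K(1), of u] by blast
  have sup: "((\<lambda>m. SUP x. cmod (partials js (\<psi> m) x)) \<longlongrightarrow> 0) F" for js
  proof (rule tendstoI)
    fix e :: real assume e: "e > 0"
    then have "\<forall>\<^sub>F m in F. \<forall>x\<in>UNIV. dist (partials js (\<psi> m) x) 0 < e / 2"
      using lim[of js] unfolding uniform_limit_iff by (meson half_gt_zero)
    then show "\<forall>\<^sub>F m in F. dist (SUP x. cmod (partials js (\<psi> m) x)) 0 < e"
    proof (rule eventually_mono)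
      fix m assume *: "\<forall>x\<in>UNIV. dist (partials js (\<psi> m) x) 0 < e / 2"
      have "(SUP x. cmod (partials js (\<psi> m) x)) \<le> e / 2"
        using * by (intro cSUP_least) (auto simp: less_imp_le)
      then show "dist (SUP x. cmod (partials js (\<psi> m) x)) 0 < e"
        using sup_nonneg[OF K(2), of js m] e by simp
    qed
  qed
  have "((\<lambda>m. \<Sum>js | length js \<le> N. SUP x. cmod (partials js (\<psi> m) x)) \<longlongrightarrow> (\<Sum>js\<in>{js :: 'n list. length js \<le> N}. 0)) F"
    by (rule tendsto_sum) (rule sup)
  from tendsto_mult[OF tendsto_const[of C] this, folded seminorm_def]
  have "((\<lambda>m. C * seminorm N (\<psi> m)) \<longlongrightarrow> 0) F" by simp
  then show ?thesis
    by (rule Lim_null_comparison[rotated]) (simp add: C(2) K)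
qed

section \<open>Translations\<close>

definition translate :: "real ^ 'n::finite \<Rightarrow> (real ^ 'n \<Rightarrow> complex) \<Rightarrow> real ^ 'n \<Rightarrow> complex" where
  "translate a f x = f (x - a)"

lemma translate_has_derivative:
  "smooth f \<Longrightarrow> (translate a f has_derivative frechet_derivative f (at (x - a))) (at x)"
proof -
  assume f: "smooth f"
  have "((\<lambda>x. x - a) has_derivative (\<lambda>h. h)) (at x)" by (auto intro!: derivative_eq_intros)
  from has_derivative_compose[OF this has_derivative_frechet[OF f]] show ?thesis
    by (simp add: translate_def[abs_def])
qed

lemma partial_translate: "smooth f \<Longrightarrow> partial j (translate a f) = translate a (partial j f)"
  using partial_eqI[OF translate_has_derivative[of f a]] by (intro ext) (simp add: translate_def partial_def)

lemma partials_translate: "smooth f \<Longrightarrow> partials js (translate a f) = translate a (partials js f)"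
  by (induction js) (simp_all add: partial_translate smooth_partials)

lemma smooth_translate: "smooth f \<Longrightarrow> smooth (translate a f)"
  using translate_has_derivative[OF smooth_partials] partials_translate
  unfolding smooth_def[of "translate a f"] differentiable_on_def by (metis differentiableI differentiable_at_withinI)

lemma support_translate: "support (translate a f) \<subseteq> (+) a ` support f"
proof (rule support_subset_closed)
  show "closed ((+) a ` support f)" unfolding support_def by (intro closed_translation closed_closure)
  show "x \<in> (+) a ` support f" if "translate a f x \<noteq> 0" for x
    using that zero_outside_support[of "x - a" f] by (intro image_eqI[of _ _ "x - a"]) (auto simp: translate_def)
qed

lemma test_fun_support_subset: "smooth f \<Longrightarrow> compact K \<Longrightarrow> support f \<subseteq> K \<Longrightarrow> test_fun f"
  unfolding test_fun_def by (metis closed_closure compact_Int_closed inf.absorb2 support_def)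

lemma test_fun_translate: "test_fun f \<Longrightarrow> test_fun (translate a f)"
  using test_fun_support_subset[OF smooth_translate compact_translation support_translate]
  by (auto simp: test_fun_def)

lemma partials_partial_commute: "smooth f \<Longrightarrow> partials js (partial j f) = partial j (partials js f)"
  by (induction js) (simp_all add: partial_commute smooth_partials)

lemma uniformly_continuous_compact_support:
  fixes f :: "real ^ 'n::finite \<Rightarrow> complex"
  assumes "continuous_on UNIV f" "compact (support f)"
  shows "uniformly_continuous_on UNIV f"
  unfolding uniformly_continuous_on_def
proof (intro allI impI)
  fix e :: real assume e: "e > 0"
  obtain R where R: "\<And>x. x \<in> support f \<Longrightarrow> norm x \<le> R"
    using compact_imp_bounded[OF assms(2)] unfolding bounded_iff by blast
  have "uniformly_continuous_on (cball 0 (R + 1)) f"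
    using assms(1) by (intro compact_uniformly_continuous) (auto intro: continuous_on_subset)
  then obtain d where d: "d > 0" "\<And>x y. x \<in> cball 0 (R + 1) \<Longrightarrow> y \<in> cball 0 (R + 1) \<Longrightarrow> dist y x < d \<Longrightarrow> dist (f y) (f x) < e"
    unfolding uniformly_continuous_on_def using e by metis
  have "dist (f y) (f x) < e" if xy: "dist y x < min d 1" for x y
  proof (cases "x \<in> cball 0 (R + 1) \<and> y \<in> cball 0 (R + 1)")
    case True
    then show ?thesis using d(2) xy by simp
  next
    case False
    then have "norm x > R" "norm y > R"
      using xy norm_triangle_ineq2[of x y] norm_triangle_ineq2[of y x] by (auto simp: dist_norm norm_minus_commute)
    then have "f x = 0" "f y = 0" using R zero_outside_support by fastforce+
    then show ?thesis using e by simp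
  qed
  then show "\<exists>d>0. \<forall>x\<in>UNIV. \<forall>x'\<in>UNIV. dist x' x < d \<longrightarrow> dist (f x') (f x) < e"
    using d(1) by (intro exI[of _ "min d 1"]) auto
qed

text \<open>\<open>translate\<close> evaluates at x - h e_j, hence the plus sign before the
  derivative. The mean value inequality is applied to \<open>g\<close>, whose derivative is a
  difference of values of the uniformly continuous \<open>partial j f\<close>.\<close>

lemma uniform_difference_quotient:
  fixes f :: "real ^ 'n::finite \<Rightarrow> complex"
  assumes f: "test_fun f"
  shows "uniform_limit UNIV (\<lambda>h x. (1 / of_real h) * (translate (h *\<^sub>R axis j 1) f x - f x) + partial j f x) (\<lambda>_. 0) (at 0)"
  unfolding uniform_limit_iff
proof (intro allI impI)
  fix e :: real assume e: "e > 0"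
  have sm: "smooth f" using f by (simp add: test_fun_def)
  have "uniformly_continuous_on UNIV (partial j f)"
    using test_fun_partial[OF f, of j] smooth_continuous
    by (intro uniformly_continuous_compact_support) (auto simp: test_fun_def)
  then obtain d where d: "d > 0" "\<And>x y. dist y x < d \<Longrightarrow> dist (partial j f y) (partial j f x) < e / 2"
    unfolding uniformly_continuous_on_def using e by (metis UNIV_I half_gt_zero)
  have "cmod ((1 / of_real h) * (translate (h *\<^sub>R axis j 1) f x - f x) + partial j f x) < e"
    if h: "h \<noteq> 0" "\<bar>h\<bar> < d" for h x
  proof -
    define g where "g = (\<lambda>s :: real. f (x - s *\<^sub>R axis j 1) + s *\<^sub>R partial j f x)"
    define g' where "g' = (\<lambda>s :: real. partial j f x - partial j f (x - s *\<^sub>R axis j 1))"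
    have deriv: "(g has_derivative (\<lambda>r. r *\<^sub>R g' s)) (at s)" for s
    proof -
      have 1: "((\<lambda>s. x - s *\<^sub>R axis j 1) has_derivative (\<lambda>r. - (r *\<^sub>R axis j 1))) (at s)"
        by (auto intro!: derivative_eq_intros)
      have 2: "linear (frechet_derivative f (at (x - s *\<^sub>R axis j 1)))"
        using has_derivative_frechet[OF sm] by (rule has_derivative_linear)
      show ?thesis
        unfolding g_def g'_def
        by (rule derivative_eq_intros has_derivative_compose[OF 1 has_derivative_frechet[OF sm]] refl)+
          (simp add: fun_eq_iff linear_neg[OF 2] linear_cmul[OF 2] partial_def scaleR_diff_right)
    qed
    have le: "norm (g h - g 0) \<le> (e / 2) * norm (h - 0)"
    proof (rule differentiable_bound[of "ball 0 d"])
      show "(g has_derivative (\<lambda>r. r *\<^sub>R g' s)) (at s within ball 0 d)" for s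
        using deriv by (rule has_derivative_at_withinI)
      show "onorm (\<lambda>r. r *\<^sub>R g' s) \<le> e / 2" if "s \<in> ball 0 d" for s
      proof (rule onorm_bound)
        have "dist (partial j f x) (partial j f (x - s *\<^sub>R axis j 1)) < e / 2"
          using that by (intro d(2)) (simp add: dist_norm)
        then have "norm (g' s) \<le> e / 2" by (simp add: g'_def dist_norm)
        then show "norm (r *\<^sub>R g' s) \<le> e / 2 * norm r" for r
          using mult_left_mono[of "norm (g' s)" "e / 2" "norm r"] by (simp add: mult.commute)
      qed (use e in simp)
    qed (use d h in auto)
    have eq: "(1 / of_real h) * (translate (h *\<^sub>R axis j 1) f x - f x) + partial j f x = (g h - g 0) / of_real h"
      using h(1) by (simp add: g_def translate_def scaleR_conv_of_real field_simps)
    have "cmod ((1 / of_real h) * (translate (h *\<^sub>R axis j 1) f x - f x) + partial j f x) \<le> e / 2"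
      unfolding eq using h(1) le by (simp add: norm_divide field_simps)
    then show ?thesis using e by simp
  qed
  then show "\<forall>\<^sub>F h in at 0. \<forall>x\<in>UNIV. dist ((1 / of_real h) * (translate (h *\<^sub>R axis j 1) f x - f x) + partial j f x) 0 < e"
    unfolding eventually_at using d(1) by (intro exI[of _ d]) (auto simp: dist_norm)
qed

lemma partials_difference_quotient:
  fixes \<phi> :: "real ^ 'n::finite \<Rightarrow> complex"
  assumes s: "smooth \<phi>"
  shows "partials js (\<lambda>x. c * (translate a \<phi> x - \<phi> x) + partial j \<phi> x)
     = (\<lambda>x. c * (translate a (partials js \<phi>) x - partials js \<phi> x) + partial j (partials js \<phi>) x)"
proof -
  have "partials js (\<lambda>x. c * (translate a \<phi> x + - 1 * \<phi> x) + partial j \<phi> x)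
     = (\<lambda>x. c * (translate a (partials js \<phi>) x + - 1 * partials js \<phi> x) + partial j (partials js \<phi>) x)"
    using s by (simp only: partials_add partials_scale smooth_add smooth_scale smooth_translate smooth_partial
        partials_translate partials_partial_commute)
  then show ?thesis by simp
qed

text \<open>\<open>u\<close> may be applied to the limit of difference quotients: they converge with
  all derivatives, and their supports stay in one compact set.\<close>

lemma dist_apply_translate_derivative:
  assumes \<phi>: "test_fun \<phi>"
  shows "((\<lambda>t. dist_apply u (translate (t *\<^sub>R axis j 1) \<phi>)) has_vector_derivative
     - dist_apply u (partial j (translate (t *\<^sub>R axis j 1) \<phi>))) (at t)"
proof -
  define \<psi> where "\<psi> = translate (t *\<^sub>R axis j 1) \<phi>"
  define q where "q = (\<lambda>(h :: real) x. (1 / of_real h) * (translate (h *\<^sub>R axis j 1) \<psi> x - \<psi> x) + partial j \<psi> x)"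
  have \<psi>: "test_fun \<psi>" unfolding \<psi>_def by (rule test_fun_translate[OF \<phi>])
  then have sm: "smooth \<psi>" and cpt: "compact (support \<psi>)" by (auto simp: test_fun_def)
  define K where "K = (\<Union>x\<in>cball 0 1. \<Union>y\<in>support \<psi>. {x + y})"
  have K: "compact K" unfolding K_def by (rule compact_sums'[OF compact_cball cpt])
  have tq: "test_fun (q h)" for h
    unfolding q_def by (intro test_fun_add test_fun_scale test_fun_diff test_fun_translate test_fun_partial \<psi>)
  \<comment> \<open>The support of \<open>q h\<close> is known to lie in \<open>K\<close> only for
    \<bar>h\<bar> \<le> 1; other values of \<open>h\<close> do not matter for the limit at
    0.\<close>
  define q' where "q' = (\<lambda>h :: real. if \<bar>h\<bar> \<le> 1 then q h else (\<lambda>_. 0))"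
  have supp: "support (q' h) \<subseteq> K" for h
  proof (cases "\<bar>h\<bar> \<le> 1")
    case True
    have "support (q h) \<subseteq> K"
    proof (rule support_subset_closed[OF compact_imp_closed[OF K]])
      fix x assume "q h x \<noteq> 0"
      moreover have "q h x = 0" if "x \<notin> support \<psi>" "x - h *\<^sub>R axis j 1 \<notin> support \<psi>"
        using that by (simp add: q_def translate_def zero_outside_support partial_zero_outside)
      ultimately have "x \<in> support \<psi> \<or> x - h *\<^sub>R axis j 1 \<in> support \<psi>" by blast
      then show "x \<in> K"
      proof
        assume "x \<in> support \<psi>"
        then show ?thesis unfolding K_def by (intro UN_I[of 0] UN_I[of x]) auto
      next
        assume "x - h *\<^sub>R axis j 1 \<in> support \<psi>"
        then show ?thesis unfolding K_def using True
          by (intro UN_I[of "h *\<^sub>R axis j 1"] UN_I[of "x - h *\<^sub>R axis j 1"]) auto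
      qed
    qed
    then show ?thesis using True by (simp add: q'_def)
  qed (simp add: q'_def support_def)
  have ev: "\<forall>\<^sub>F h in at 0. q' h = q h"
    unfolding eventually_at by (intro exI[of _ 1]) (auto simp: q'_def)
  have "((\<lambda>h. dist_apply u (q' h)) \<longlongrightarrow> 0) (at 0)"
  proof (rule dist_apply_tendsto_0[OF K _ supp])
    show "test_fun (q' h)" for h by (simp add: q'_def tq test_fun_zero)
    fix js
    have "uniform_limit UNIV (\<lambda>h. partials js (q h)) (\<lambda>_. 0) (at 0)"
      using uniform_difference_quotient[OF test_fun_partials[OF \<psi>]]
      unfolding q_def partials_difference_quotient[OF sm] .
    then show "uniform_limit UNIV (\<lambda>h. partials js (q' h)) (\<lambda>_. 0) (at 0)"
      by (rule uniform_limit_cong[THEN iffD1, rotated 2]) (use ev in \<open>auto elim: eventually_mono\<close>)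
  qed
  then have "((\<lambda>h. dist_apply u (q h)) \<longlongrightarrow> 0) (at 0)"
    by (rule tendsto_cong[THEN iffD1, rotated]) (use ev in \<open>auto elim: eventually_mono\<close>)
  then have "((\<lambda>h. dist_apply u (q h) - dist_apply u (partial j \<psi>)) \<longlongrightarrow> 0 - dist_apply u (partial j \<psi>)) (at 0)"
    by (intro tendsto_intros)
  moreover have "dist_apply u (q h) - dist_apply u (partial j \<psi>) =
      (dist_apply u (translate ((t + h) *\<^sub>R axis j 1) \<phi>) - dist_apply u \<psi>) /\<^sub>R h" for h
  proof -
    have "translate (h *\<^sub>R axis j 1) \<psi> = translate ((t + h) *\<^sub>R axis j 1) \<phi>"
      by (simp add: \<psi>_def translate_def fun_eq_iff scaleR_add_left diff_diff_eq add.commute)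
    then show ?thesis
      unfolding q_def
      by (subst dist_apply_fun_add)
        (simp_all add: test_fun_scale test_fun_diff test_fun_translate test_fun_partial \<psi> \<phi> dist_apply_fun_scale
          dist_apply_fun_diff scaleR_conv_of_real divide_inverse)
  qed
  ultimately have "((\<lambda>h. (dist_apply u (translate ((t + h) *\<^sub>R axis j 1) \<phi>) - dist_apply u \<psi>) /\<^sub>R h)
      \<longlongrightarrow> - dist_apply u (partial j \<psi>)) (at 0)" by simp
  from tendsto_norm_zero[OF LIM_zero[OF this]]
  have lim: "((\<lambda>h. norm (dist_apply u (translate ((t + h) *\<^sub>R axis j 1) \<phi>) - dist_apply u \<psi> - h *\<^sub>R (- dist_apply u (partial j \<psi>))) / norm h) \<longlongrightarrow> 0) (at 0)"
  proof (rule Lim_transform_eventually)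
    show "\<forall>\<^sub>F h in at 0. norm ((dist_apply u (translate ((t + h) *\<^sub>R axis j 1) \<phi>) - dist_apply u \<psi>) /\<^sub>R h - - dist_apply u (partial j \<psi>))
       = norm (dist_apply u (translate ((t + h) *\<^sub>R axis j 1) \<phi>) - dist_apply u \<psi> - h *\<^sub>R (- dist_apply u (partial j \<psi>))) / norm h"
      unfolding eventually_at_filter
    proof (intro always_eventually allI impI)
      fix h :: real assume "h \<noteq> 0"
      then have "v /\<^sub>R h - w = (v - h *\<^sub>R w) /\<^sub>R h" for v w :: complex by (simp add: scaleR_diff_right)
      then show "norm ((dist_apply u (translate ((t + h) *\<^sub>R axis j 1) \<phi>) - dist_apply u \<psi>) /\<^sub>R h - - dist_apply u (partial j \<psi>))
       = norm (dist_apply u (translate ((t + h) *\<^sub>R axis j 1) \<phi>) - dist_apply u \<psi> - h *\<^sub>R (- dist_apply u (partial j \<psi>))) / norm h"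
        by (simp only: norm_scaleR norm_inverse) (simp add: divide_inverse mult.commute)
    qed
  qed
  show ?thesis
    unfolding has_vector_derivative_def has_derivative_at
    by (rule conjI[OF bounded_linear_scaleR_left lim[unfolded \<psi>_def]])
qed

text \<open>As a function of \<open>t\<close>, the value of \<open>u\<close> on the translated test
  function solves f' = \<i> c f. A solution with one zero is identically zero.\<close>

lemma eigendistribution_translate:
  assumes eig: "dist_D j u = dist_scale c u" and \<phi>: "test_fun \<phi>"
    and zero: "dist_apply u (translate (t *\<^sub>R axis j 1) \<phi>) = 0"
  shows "dist_apply u \<phi> = 0"
proof -
  define f where "f = (\<lambda>t. dist_apply u (translate (t *\<^sub>R axis j 1) \<phi>))"
  have part: "dist_apply u (partial j \<psi>) = - \<i> * c * dist_apply u \<psi>" if "test_fun \<psi>" for \<psi>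
    using dist_apply_D[OF that, of j u] unfolding eig dist_apply_scale by (simp add: field_simps)
  have f: "(f has_vector_derivative \<i> * c * f t) (at t)" for t
    using dist_apply_translate_derivative[OF \<phi>, of u j t]
    by (simp add: f_def part[OF test_fun_translate[OF \<phi>]])
  have e: "((\<lambda>t. exp (of_real t * (- \<i> * c))) has_vector_derivative (- \<i> * c) * exp (of_real t * (- \<i> * c))) (at t)" for t
    by (auto intro!: derivative_eq_intros has_vector_derivative_real_field)
  have "((\<lambda>t. exp (of_real t * (- \<i> * c)) * f t) has_vector_derivative 0) (at t within UNIV)" for t
    using has_vector_derivative_mult[OF e f, of t] by (simp add: algebra_simps)
  then obtain k where k: "\<And>t. exp (of_real t * (- \<i> * c)) * f t = k"
    using has_vector_derivative_zero_constant[of UNIV "\<lambda>t. exp (of_real t * (- \<i> * c)) * f t"] by auto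
  from k[of t] zero have "k = 0" by (simp add: f_def)
  with k[of 0] have "f 0 = 0" by simp
  then show ?thesis by (simp add: f_def) (simp add: translate_def[abs_def])
qed

text \<open>Translations spread the zero set to all small cubes. A test function is split into pieces supported
  in such cubes one coordinate at a time, by telescoping sums of smooth steps.\<close>

lemma eigendistribution_zero:
  fixes u :: "'n::finite distribution"
  assumes eig: "\<And>j. dist_D j u = dist_scale (c j) u" and W: "open W" "W \<noteq> {}" and zero: "agree_on W u 0"
  shows "u = 0"
proof -
  let ?slab = "\<lambda>J r y. {x :: real ^ 'n. \<forall>j\<in>J. \<bar>x $ j - y $ j\<bar> \<le> r}"
  obtain y0 where y0: "y0 \<in> W" using W(2) by blast
  then obtain e where e: "e > 0" "ball y0 e \<subseteq> W" using W(1) open_contains_ball by blast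
  \<comment> \<open>The Euclidean norm is at most the sum of the coordinates, so a cube of half-side
    \<open>r\<close> has its points within e/2 of its centre.\<close>
  define r where "r = e / (2 * real CARD('n))"
  have r: "r > 0" using e by (simp add: r_def)
  have sub: "?slab UNIV r y0 \<subseteq> W"
  proof
    fix x assume x: "x \<in> ?slab UNIV r y0"
    have "norm (x - y0) \<le> (\<Sum>j\<in>UNIV. \<bar>(x - y0) $ j\<bar>)" by (rule norm_le_l1_cart)
    also have "\<dots> \<le> (\<Sum>j\<in>(UNIV :: 'n set). r)" using x by (intro sum_mono) auto
    also have "\<dots> < e" using e by (simp add: r_def)
    finally show "x \<in> W" using e(2) by (auto simp: dist_norm norm_minus_commute subset_iff)
  qed
  \<comment> \<open>\<open>J\<close> contains the coordinates in which the centre \<open>y\<close>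
    may differ from \<open>y0\<close>; each is corrected by one translation along its axis.\<close>
  have slab: "dist_apply u \<phi> = 0"
    if "finite J" "\<And>i. i \<notin> J \<Longrightarrow> y $ i = y0 $ i" "test_fun \<phi>" "support \<phi> \<subseteq> ?slab UNIV r y" for J y \<phi>
    using that
  proof (induction J arbitrary: y \<phi> rule: finite_induct)
    case empty
    then have "y = y0" by (simp add: vec_eq_iff)
    then show ?case using zero empty sub unfolding agree_on_def by (auto simp: dist_apply_zero)
  next
    case (insert j J)
    define t where "t = y0 $ j - y $ j"
    show ?case
    proof (rule eigendistribution_translate[OF eig[of j] insert.prems(2), where t = t], rule insert.IH)
      show "test_fun (translate (t *\<^sub>R axis j 1) \<phi>)" by (rule test_fun_translate[OF insert.prems(2)])
      show "(y + t *\<^sub>R axis j 1) $ i = y0 $ i" if "i \<notin> J" for i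
        using insert.prems(1)[of i] that by (auto simp: t_def axis_def)
      show "support (translate (t *\<^sub>R axis j 1) \<phi>) \<subseteq> ?slab UNIV r (y + t *\<^sub>R axis j 1)"
      proof
        fix x assume "x \<in> support (translate (t *\<^sub>R axis j 1) \<phi>)"
        then obtain z where "x = t *\<^sub>R axis j 1 + z" "z \<in> support \<phi>" using support_translate by blast
        then show "x \<in> ?slab UNIV r (y + t *\<^sub>R axis j 1)" using insert.prems(3) by (auto simp: algebra_simps)
      qed
    qed
  qed
  \<comment> \<open>Here \<open>J\<close> contains the coordinates in which the support of \<phi> is
    not yet confined to a short interval.\<close>
  have "dist_apply u \<phi> = 0"
    if "finite J" "test_fun \<phi>" "support \<phi> \<subseteq> ?slab (- J) r y" for J y \<phi>
    using that
  proof (induction J arbitrary: y \<phi> rule: finite_induct)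
    case empty
    from empty(2) have "support \<phi> \<subseteq> ?slab UNIV r y" by simp
    then show ?case by (intro slab[of UNIV y]) (simp_all add: empty)
  next
    case (insert j J)
    have "bounded (support \<phi>)" using insert.prems(1) by (simp add: test_fun_def compact_imp_bounded)
    then obtain B where B: "\<And>x. x \<in> support \<phi> \<Longrightarrow> norm x \<le> B" by (auto simp: bounded_iff)
    \<comment> \<open>The support lies in \<bar>x_j\<bar> \<le> n r, and there \<open>f 0\<close> is
      1 and \<open>f (2 * n + 1)\<close> is 0, so the differences \<eta> sum to 1.\<close>
    obtain n :: nat where n: "B / r \<le> real n" using real_arch_simple by blast
    define f where "f = (\<lambda>(i :: nat) x. smooth_step ((1 / r) * (x $ j) + (real n + 1 - real i)))"
    define \<eta> where "\<eta> = (\<lambda>i x. complex_of_real (f i x) - complex_of_real (f (Suc i) x))"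
    have sm: "smooth (\<eta> i)" for i
      unfolding \<eta>_def f_def by (intro smooth_diff smooth_smooth_step)
    have tf: "test_fun (\<lambda>x. \<phi> x * \<eta> i x)" for i by (rule test_fun_mult_smooth[OF insert.prems(1) sm])
    have "\<phi> x = (\<Sum>i<2 * n + 1. \<phi> x * \<eta> i x)" for x
    proof (cases "x \<in> support \<phi>")
      case True
      have "\<bar>x $ j\<bar> \<le> B" using B[OF True] component_le_norm_cart[of x j] by linarith
      then have "\<bar>x $ j\<bar> / r \<le> real n" using n r divide_right_mono[of "\<bar>x $ j\<bar>" B r] by simp
      then have "\<bar>(1 / r) * (x $ j)\<bar> \<le> real n" using r by (simp add: abs_mult)
      then have x: "- real n \<le> (1 / r) * (x $ j)" "(1 / r) * (x $ j) \<le> real n" by linarith+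
      have "(\<Sum>i<2 * n + 1. \<eta> i x) = complex_of_real (f 0 x) - complex_of_real (f (2 * n + 1) x)"
        unfolding \<eta>_def by (rule sum_lessThan_telescope')
      moreover have "f 0 x = 1" unfolding f_def by (rule smooth_step_1) (use x in auto)
      moreover have "f (2 * n + 1) x = 0" unfolding f_def by (rule smooth_step_0) (use x in auto)
      ultimately have "(\<Sum>i<2 * n + 1. \<eta> i x) = 1" by simp
      then show ?thesis by (simp only: sum_distrib_left[symmetric] mult_1_right)
    qed (simp add: zero_outside_support)
    then have "\<phi> = (\<lambda>x. \<Sum>i<2 * n + 1. \<phi> x * \<eta> i x)" by (rule ext)
    then have "dist_apply u \<phi> = dist_apply u (\<lambda>x. \<Sum>i<2 * n + 1. \<phi> x * \<eta> i x)" by (rule arg_cong)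
    also have "\<dots> = (\<Sum>i<2 * n + 1. dist_apply u (\<lambda>x. \<phi> x * \<eta> i x))"
      using tf by (rule dist_apply_fun_sum)
    also have "\<dots> = 0"
    proof (rule sum.neutral, rule ballI, rule insert.IH[OF tf])
      fix i
      \<comment> \<open>The difference of the steps \<open>i\<close> and \<open>Suc i\<close> is
        nonzero only within distance \<open>r\<close> of this centre in coordinate
        \<open>j\<close>.\<close>
      let ?y = "\<chi> k. if k = j then r * (real i - real n) else y $ k"
      show "support (\<lambda>x. \<phi> x * \<eta> i x) \<subseteq> ?slab (- J) r ?y"
      proof (rule support_subset_closed[OF closed_coordinate_slab])
        fix x assume nz: "\<phi> x * \<eta> i x \<noteq> 0"
        then have x: "x \<in> support \<phi>" using zero_outside_support by fastforce
        let ?t = "(1 / r) * (x $ j) + (real n - real i)"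
        have "?t + 1 > 0 \<and> ?t < 1"
        proof (rule ccontr)
          assume "\<not> (?t + 1 > 0 \<and> ?t < 1)"
          then have "f i x = f (Suc i) x"
            using smooth_step_0[of "?t + 1"] smooth_step_0[of ?t] smooth_step_1[of ?t] smooth_step_1[of "?t + 1"]
            by (auto simp: f_def algebra_simps not_less)
          then show False using nz by (simp add: \<eta>_def)
        qed
        then have "\<bar>?t\<bar> \<le> 1" by linarith
        then have "\<bar>r\<bar> * \<bar>?t\<bar> \<le> r * 1" using r by (intro mult_mono) auto
        moreover have "r * ?t = x $ j - r * (real i - real n)" using r by (simp add: distrib_left right_diff_distrib)
        ultimately have "\<bar>x $ j - r * (real i - real n)\<bar> \<le> r" by (metis abs_mult mult_1_right)
        then show "x \<in> ?slab (- J) r ?y" using x insert.prems(2) by auto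
      qed
    qed
    finally show ?case .
  qed
  from this[of UNIV] have "dist_apply u \<phi> = 0" if "test_fun \<phi>" for \<phi> using that by simp
  then show ?thesis by (intro distribution_eqI) (simp add: dist_apply_zero)
qed

section \<open>Approximation of test functions by exponential sums\<close>

text \<open>Exponentials with real exponents: on them the real form of Stone-Weierstrass applies,
  and \<open>D_j\<close> still acts through a scalar.\<close>

definition exp_fun :: "real ^ 'n::finite \<Rightarrow> real ^ 'n \<Rightarrow> complex" where
  "exp_fun s x = of_real (exp (inner s x))"

lemma exp_fun_has_derivative: "(exp_fun s has_derivative (\<lambda>h. of_real (inner s h) * exp_fun s x)) (at x)"
proof -
  have "((\<lambda>x. exp (inner s x)) has_derivative (\<lambda>h. inner s h * exp (inner s x))) (at x)"
    by (auto intro!: derivative_eq_intros)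
  then have "((\<lambda>x. complex_of_real (exp (inner s x))) has_derivative (\<lambda>h. of_real (inner s h * exp (inner s x)))) (at x)"
    by (rule has_derivative_of_real)
  then show ?thesis by (simp add: exp_fun_def[abs_def])
qed

lemma partial_exp_fun: "partial j (exp_fun s) = (\<lambda>x. of_real (s $ j) * exp_fun s x)"
  using partial_eqI[OF exp_fun_has_derivative] by (auto simp: inner_axis)

lemma smooth_exp_fun: "smooth (exp_fun s)"
proof (rule smooth_coinduct[of _ "range (\<lambda>c x. c * exp_fun s x)"])
  have d: "((\<lambda>x. c * exp_fun s x) has_derivative (\<lambda>h. c * (of_real (inner s h) * exp_fun s x))) (at x)" for c x
    by (rule has_derivative_mult_right[OF exp_fun_has_derivative])
  show "exp_fun s \<in> range (\<lambda>c x. c * exp_fun s x)" by (rule range_eqI[of _ _ 1]) simp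
  show "f differentiable at x" if "f \<in> range (\<lambda>c x. c * exp_fun s x)" for f x
    using that d differentiableI by blast
  show "partial j f \<in> range (\<lambda>c x. c * exp_fun s x)" if f: "f \<in> range (\<lambda>c x. c * exp_fun s x)" for f j
  proof -
    from f obtain c where "f = (\<lambda>x. c * exp_fun s x)" by blast
    then have "partial j f = (\<lambda>x. (c * of_real (s $ j)) * exp_fun s x)"
      using partial_eqI[OF d] by (auto simp: inner_axis)
    then show ?thesis by blast
  qed
qed

lemma partials_exp_fun: "partials js (exp_fun s) = (\<lambda>x. of_real (prod_list (map (($) s) js)) * exp_fun s x)"
proof (induction js)
  case (Cons j js)
  then show ?case by (simp add: partial_scale[OF smooth_exp_fun] partial_exp_fun mult.assoc mult.left_commute)
qed simp

section \<open>Integrals of test functions\<close>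

lemma integrable_compact_support:
  fixes f :: "real ^ 'n::finite \<Rightarrow> 'b::{banach, second_countable_topology}"
  assumes "continuous_on UNIV f" "compact K" "\<And>x. x \<notin> K \<Longrightarrow> f x = 0"
  shows "integrable lborel f"
proof -
  have "integrable lborel (\<lambda>x. indicator K x *\<^sub>R f x)"
    using assms by (intro borel_integrable_compact) (auto intro: continuous_on_subset)
  moreover have "(\<lambda>x. indicator K x *\<^sub>R f x) = f" using assms(3) by (auto simp: indicator_def)
  ultimately show ?thesis by simp
qed

lemma integrable_test_fun_mult:
  assumes "test_fun f" "continuous_on UNIV g"
  shows "integrable lborel (\<lambda>x. f x * g x)"
proof (rule integrable_compact_support)
  show "continuous_on UNIV (\<lambda>x. f x * g x)"
    using assms smooth_continuous by (intro continuous_on_mult) (auto simp: test_fun_def)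
  show "compact (support f)" using assms by (simp add: test_fun_def)
qed (simp add: zero_outside_support)

lemma integrable_test_fun: "test_fun f \<Longrightarrow> integrable lborel f"
  using integrable_test_fun_mult[of f "\<lambda>_. 1"] by simp

lemma lborel_integral_translate:
  fixes f :: "real ^ 'n::finite \<Rightarrow> complex"
  assumes "continuous_on UNIV f"
  shows "(\<integral>x. translate a f x \<partial>lborel) = (\<integral>x. f x \<partial>lborel)"
proof -
  have f: "f \<in> borel_measurable borel" using assms by (rule borel_measurable_continuous_onI)
  have "(\<integral>x. f x \<partial>lborel) = (\<integral>x. f x \<partial>distr lborel borel ((+) (- a)))" by (simp only: lborel_distr_plus)
  also have "\<dots> = (\<integral>x. f (- a + x) \<partial>lborel)" by (rule integral_distr) (use f in auto)
  finally show ?thesis by (simp add: translate_def)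
qed

lemma lborel_integral_reflect:
  fixes f :: "real ^ 'n::finite \<Rightarrow> real"
  assumes "continuous_on UNIV f"
  shows "(\<integral>y. f (x - y) \<partial>lborel) = (\<integral>x. f x \<partial>lborel)"
proof -
  have f: "f \<in> borel_measurable borel" using assms by (rule borel_measurable_continuous_onI)
  have "lborel = distr lborel borel (\<lambda>y :: real ^ 'n. x - y)"
    using lborel_affine[of "- 1" x] by (simp add: density_1)
  then have "(\<integral>x. f x \<partial>lborel) = (\<integral>x. f x \<partial>distr lborel borel (\<lambda>y :: real ^ 'n. x - y))" by metis
  also have "\<dots> = (\<integral>y. f (x - y) \<partial>lborel)" by (rule integral_distr) (use f in auto)
  finally show ?thesis by simp
qed

text \<open>By translation invariance the difference quotient has integral 0, so \<open>q h\<close>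
  has the same integral as the derivative. It is uniformly small and lives on the fixed compact set
  \<open>K\<close>.\<close>

lemma integral_partial_test_fun:
  fixes f :: "real ^ 'n::finite \<Rightarrow> complex"
  assumes f: "test_fun f"
  shows "(\<integral>x. partial j f x \<partial>lborel) = 0"
proof -
  have sm: "smooth f" and cpt: "compact (support f)" using f by (auto simp: test_fun_def)
  define K where "K = (\<Union>x\<in>cball 0 1. \<Union>y\<in>support f. {x + y})"
  have K: "compact K" unfolding K_def by (rule compact_sums'[OF compact_cball cpt])
  define q where "q = (\<lambda>(h :: real) x. (1 / of_real h) * (translate (h *\<^sub>R axis j 1) f x - f x) + partial j f x)"
  have int_q: "(\<integral>x. q h x \<partial>lborel) = (\<integral>x. partial j f x \<partial>lborel)" for h
    unfolding q_def
    by (simp add: integrable_test_fun test_fun_translate test_fun_partial f lborel_integral_translate smooth_continuous[OF sm])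
  have q0: "q h x = 0" if "x \<notin> K" "\<bar>h\<bar> \<le> 1" for h x
  proof -
    have "x \<notin> support f"
    proof
      assume "x \<in> support f"
      then have "x \<in> K" unfolding K_def by (intro UN_I[of 0] UN_I[of x]) auto
      with that show False by blast
    qed
    moreover have "x - h *\<^sub>R axis j 1 \<notin> support f"
    proof
      assume "x - h *\<^sub>R axis j 1 \<in> support f"
      then have "x \<in> K" unfolding K_def using that(2)
        by (intro UN_I[of "h *\<^sub>R axis j 1"] UN_I[of "x - h *\<^sub>R axis j 1"]) auto
      with that show False by blast
    qed
    ultimately show ?thesis by (simp add: q_def translate_def zero_outside_support partial_zero_outside)
  qed
  have "cmod (\<integral>x. partial j f x \<partial>lborel) \<le> e * measure lborel K" if e: "e > 0" for e
  proof -
    have "\<forall>\<^sub>F h in at 0. \<forall>x\<in>UNIV. dist (q h x) 0 < e"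
      using uniform_difference_quotient[OF f, of j] e unfolding uniform_limit_iff q_def by blast
    then obtain d where d: "d > 0" "\<And>h x. h \<noteq> 0 \<Longrightarrow> dist h 0 < d \<Longrightarrow> cmod (q h x) < e"
      unfolding eventually_at by auto
    define h where "h = min (d / 2) 1"
    have h: "h \<noteq> 0" "dist h 0 < d" "\<bar>h\<bar> \<le> 1" using d(1) by (auto simp: h_def)
    have "cmod (\<integral>x. q h x \<partial>lborel) \<le> (\<integral>x. e * indicator K x \<partial>lborel)"
    proof (rule Bochner_Integration.integral_norm_bound_integral)
      show "integrable lborel (q h)"
        unfolding q_def by (intro integrable_test_fun test_fun_add test_fun_scale test_fun_diff test_fun_translate test_fun_partial f)
      show "integrable lborel (\<lambda>x. e * indicator K x)"
        using K emeasure_compact_finite[OF K] by (intro integrable_mult_right integrable_real_indicator) (auto simp: borel_compact)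
      show "cmod (q h x) \<le> e * indicator K x" for x
        using d(2)[OF h(1,2), of x] q0[of x h] h(3) by (auto simp: indicator_def less_imp_le)
    qed
    then show ?thesis using K by (simp add: int_q)
  qed
  note bound = this
  have "cmod (\<integral>x. partial j f x \<partial>lborel) \<le> 0"
  proof (rule field_le_epsilon)
    fix e :: real assume e: "e > 0"
    let ?M = "measure lborel K"
    \<comment> \<open>The summand 1 in the denominator allows for a set \<open>K\<close> of measure
      0.\<close>
    have "cmod (\<integral>x. partial j f x \<partial>lborel) \<le> e / (?M + 1) * ?M"
      using e by (intro bound) (simp add: add_nonneg_pos)
    also have "\<dots> \<le> 0 + e" using e by (simp add: divide_simps add_nonneg_pos)
    finally show "cmod (\<integral>x. partial j f x \<partial>lborel) \<le> 0 + e" .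
  qed
  then show ?thesis by simp
qed

section \<open>Convolution with exponential sums\<close>

definition convolve :: "(real ^ 'n::finite \<Rightarrow> real) \<Rightarrow> (real ^ 'n \<Rightarrow> complex) \<Rightarrow> real ^ 'n \<Rightarrow> complex" where
  "convolve \<kappa> f x = (\<integral>y. f y * of_real (\<kappa> (x - y)) \<partial>lborel)"

inductive exp_sum :: "(real ^ 'n::finite \<Rightarrow> real) \<Rightarrow> bool" where
  exp: "exp_sum (\<lambda>x. c * exp (inner s x))"
| add: "exp_sum f \<Longrightarrow> exp_sum g \<Longrightarrow> exp_sum (\<lambda>x. f x + g x)"

lemma exp_sum_mult: "exp_sum f \<Longrightarrow> exp_sum g \<Longrightarrow> exp_sum (\<lambda>x. f x * g x)"
proof (induction f rule: exp_sum.induct)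
  case (exp c s)
  show ?case using exp(1)
  proof (induction g rule: exp_sum.induct)
    case (exp d t)
    show ?case using exp_sum.exp[of "c * d" "s + t"] by (simp add: inner_add_left exp_add algebra_simps)
  next
    case (add f g)
    show ?case using exp_sum.add[OF add.IH] by (simp add: algebra_simps)
  qed
next
  case (add f g)
  show ?case using exp_sum.add[OF add.IH(1)[OF add.prems] add.IH(2)[OF add.prems]] by (simp add: algebra_simps)
qed

lemma exp_sum_continuous: "exp_sum f \<Longrightarrow> continuous_on S f"
  by (induction rule: exp_sum.induct) (auto intro!: continuous_intros)

lemma exp_sum_dense:
  fixes f :: "real ^ 'n::finite \<Rightarrow> real"
  assumes "compact S" "continuous_on S f" "e > 0"
  obtains \<kappa> where "exp_sum \<kappa>" "\<And>x. x \<in> S \<Longrightarrow> \<bar>f x - \<kappa> x\<bar> < e"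
proof -
  have "\<exists>\<kappa>. exp_sum \<kappa> \<and> (\<forall>x\<in>S. \<bar>f x - \<kappa> x\<bar> < e)"
  proof (rule Stone_Weierstrass_HOL[OF assms(1) _ _ _ _ _ assms(2,3)])
    show "exp_sum (\<lambda>x. c)" for c using exp_sum.exp[of c 0] by simp
    fix x y :: "real ^ 'n" assume "x \<in> S \<and> y \<in> S \<and> x \<noteq> y"
    \<comment> \<open>Separation of points: with exponent vector x - y the two exponents differ by
      the squared distance.\<close>
    then have "inner (x - y) (x - y) \<noteq> 0" by simp
    then have "1 * exp (inner (x - y) x) \<noteq> 1 * exp (inner (x - y) y)" by (simp add: inner_diff_right)
    then show "\<exists>f. exp_sum f \<and> f x \<noteq> f y" using exp_sum.exp by metis
  qed (auto intro: exp_sum_continuous exp_sum.add exp_sum_mult)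
  then show thesis using that by blast
qed

inductive cexp_sum :: "(real ^ 'n::finite \<Rightarrow> complex) \<Rightarrow> bool" where
  exp: "cexp_sum (\<lambda>x. c * exp_fun s x)"
| add: "cexp_sum f \<Longrightarrow> cexp_sum g \<Longrightarrow> cexp_sum (\<lambda>x. f x + g x)"

lemma smooth_cexp_sum: "cexp_sum f \<Longrightarrow> smooth f"
  by (induction rule: cexp_sum.induct) (auto intro: smooth_add smooth_scale smooth_exp_fun)

text \<open>The factorization exp(s.(x - y)) = exp(s.x) exp(-s.y) pulls the dependence on
  \<open>x\<close> out of the integral. This is why convolving a test function with an exponential
  sum gives an exponential sum.\<close>

lemma convolve_exp:
  assumes "test_fun f"
  shows "convolve (\<lambda>x. c * exp (inner s x)) f = (\<lambda>x. (of_real c * (\<integral>y. f y * exp_fun (- s) y \<partial>lborel)) * exp_fun s x)"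
proof
  fix x
  have eq: "f y * of_real (c * exp (inner s (x - y))) = (of_real c * exp_fun s x) * (f y * exp_fun (- s) y)" for y
    by (simp add: exp_fun_def inner_diff_right exp_diff exp_minus divide_inverse algebra_simps)
  then show "convolve (\<lambda>x. c * exp (inner s x)) f x = (of_real c * (\<integral>y. f y * exp_fun (- s) y \<partial>lborel)) * exp_fun s x"
    unfolding convolve_def eq integral_mult_right_zero by (simp only: mult_ac)
qed

lemma convolve_add:
  fixes f :: "real ^ 'n::finite \<Rightarrow> complex"
  assumes "test_fun f" "continuous_on UNIV \<kappa>" "continuous_on UNIV \<kappa>'"
  shows "convolve (\<lambda>x. \<kappa> x + \<kappa>' x) f = (\<lambda>x. convolve \<kappa> f x + convolve \<kappa>' f x)"
proof
  fix x
  have "integrable lborel (\<lambda>y. f y * of_real (\<kappa> (x - y)))" if "continuous_on UNIV \<kappa>" for \<kappa>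
    using that by (intro integrable_test_fun_mult[OF assms(1)] continuous_intros continuous_on_compose2[OF that]) auto
  from this[OF assms(2)] this[OF assms(3)]
  show "convolve (\<lambda>x. \<kappa> x + \<kappa>' x) f x = convolve \<kappa> f x + convolve \<kappa>' f x"
    by (simp add: convolve_def distrib_left)
qed

lemma exp_fun_continuous: "continuous_on UNIV (exp_fun s)"
  by (rule smooth_continuous[OF smooth_exp_fun])

text \<open>Integration by parts: the product has integral of derivative 0, and the exponential
  contributes the factor - s_j.\<close>

lemma integral_partial_exp_fun:
  assumes f: "test_fun f"
  shows "(\<integral>y. partial j f y * exp_fun (- s) y \<partial>lborel) = of_real (s $ j) * (\<integral>y. f y * exp_fun (- s) y \<partial>lborel)"
proof -
  have sm: "smooth f" using f by (simp add: test_fun_def)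
  have "0 = (\<integral>y. partial j (\<lambda>y. f y * exp_fun (- s) y) y \<partial>lborel)"
    by (rule integral_partial_test_fun[symmetric]) (rule test_fun_mult_smooth[OF f smooth_exp_fun])
  also have "\<dots> = (\<integral>y. partial j f y * exp_fun (- s) y - of_real (s $ j) * (f y * exp_fun (- s) y) \<partial>lborel)"
    by (simp add: partial_mult[OF sm smooth_exp_fun] partial_exp_fun algebra_simps)
  also have "\<dots> = (\<integral>y. partial j f y * exp_fun (- s) y \<partial>lborel) - of_real (s $ j) * (\<integral>y. f y * exp_fun (- s) y \<partial>lborel)"
    using integrable_test_fun_mult[OF test_fun_partial[OF f] exp_fun_continuous[of "- s"]]
      integrable_mult_right[OF integrable_test_fun_mult[OF f exp_fun_continuous[of "- s"]]]
    by (subst Bochner_Integration.integral_diff) simp_all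
  finally show ?thesis by simp
qed

lemma convolve_exp_sum:
  assumes "exp_sum \<kappa>" "test_fun f"
  shows cexp_sum_convolve: "cexp_sum (convolve \<kappa> f)"
    and partial_convolve: "partial j (convolve \<kappa> f) = convolve \<kappa> (partial j f)"
proof -
  have "cexp_sum (convolve \<kappa> f) \<and> partial j (convolve \<kappa> f) = convolve \<kappa> (partial j f)"
    using assms(1)
  proof (induction rule: exp_sum.induct)
    case (exp c s)
    show ?case
      unfolding convolve_exp[OF assms(2)] convolve_exp[OF test_fun_partial[OF assms(2)]]
        integral_partial_exp_fun[OF assms(2)] partial_scale[OF smooth_exp_fun] partial_exp_fun
      by (rule conjI, rule cexp_sum.exp) (simp add: mult_ac)
  next
    case (add \<kappa> \<kappa>')
    note cont = exp_sum_continuous[OF add.hyps(1)] exp_sum_continuous[OF add.hyps(2)]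
    have c: "cexp_sum (convolve \<kappa> f)" "cexp_sum (convolve \<kappa>' f)" using add.IH by blast+
    show ?case
      unfolding convolve_add[OF assms(2) cont] convolve_add[OF test_fun_partial[OF assms(2)] cont]
        partial_add[OF c[THEN smooth_cexp_sum]]
      using cexp_sum.add[OF c] add.IH by simp
  qed
  then show "cexp_sum (convolve \<kappa> f)" "partial j (convolve \<kappa> f) = convolve \<kappa> (partial j f)" by blast+
qed

lemma partials_convolve:
  assumes "exp_sum \<kappa>" "test_fun f"
  shows "partials js (convolve \<kappa> f) = convolve \<kappa> (partials js f)"
  by (induction js) (simp_all add: partial_convolve[OF assms(1) test_fun_partials[OF assms(2)]])

text \<open>This approximate identity need not be smooth: it is replaced by an exponential sum that is uniformly
  close to it, and convolution passes derivatives to the test function.\<close>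

definition hat_kernel :: "real \<Rightarrow> real ^ 'n::finite \<Rightarrow> real" where
  "hat_kernel \<delta> z = max 0 (1 - norm z / \<delta>) / (\<integral>z. max 0 (1 - norm z / \<delta>) \<partial>(lborel :: (real ^ 'n) measure))"

lemma hat_kernel:
  fixes x z :: "real ^ 'n::finite"
  assumes \<delta>: "\<delta> > 0"
  shows hat_kernel_continuous: "continuous_on S (hat_kernel \<delta> :: real ^ 'n \<Rightarrow> real)"
    and hat_kernel_nonneg: "hat_kernel \<delta> z \<ge> 0"
    and hat_kernel_zero: "norm z \<ge> \<delta> \<Longrightarrow> hat_kernel \<delta> z = 0"
    and hat_kernel_integral: "(\<integral>y. hat_kernel \<delta> (x - y) \<partial>lborel) = 1"
    and hat_kernel_integrable: "integrable lborel (\<lambda>y. hat_kernel \<delta> (x - y))"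
proof -
  let ?r = "\<lambda>z :: real ^ 'n. max 0 (1 - norm z / \<delta>)"
  have cont: "continuous_on S ?r" for S by (intro continuous_intros) (use \<delta> in auto)
  have z: "?r z = 0" if "norm z \<ge> \<delta>" for z using that \<delta> by (simp add: max_def)
  have int: "integrable lborel ?r"
    by (rule integrable_compact_support[OF cont compact_cball[of 0 \<delta>]]) (simp add: z)
  \<comment> \<open>The unnormalized hat is at least 1/2 on the ball of radius \<delta>/2, so the
    normalizing integral is positive.\<close>
  have "0 < (1 / 2) * measure lborel (ball (0 :: real ^ 'n) (\<delta> / 2))"
    using content_ball_pos[of "\<delta> / 2" "0 :: real ^ 'n"] \<delta> by simp
  also have "\<dots> = (\<integral>z. (1 / 2) * indicator (ball (0 :: real ^ 'n) (\<delta> / 2)) z \<partial>lborel)" by simp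
  also have "\<dots> \<le> (\<integral>z. ?r z \<partial>lborel)"
  proof (rule integral_mono[OF _ int])
    show "integrable lborel (\<lambda>z. (1 / 2) * indicator (ball (0 :: real ^ 'n) (\<delta> / 2)) z :: real)"
      using emeasure_bounded_finite[OF bounded_ball] by (intro integrable_mult_right integrable_real_indicator) auto
    show "(1 / 2) * indicator (ball (0 :: real ^ 'n) (\<delta> / 2)) z \<le> ?r z" for z
      using \<delta> by (auto simp: indicator_def field_simps max_def)
  qed
  finally have c: "(\<integral>z. ?r z \<partial>lborel) > 0" .
  show hc: "continuous_on S (hat_kernel \<delta> :: real ^ 'n \<Rightarrow> real)" for S
    unfolding hat_kernel_def[abs_def] by (intro continuous_on_divide cont continuous_on_const) (use c in auto)
  show "hat_kernel \<delta> z \<ge> 0" using c by (simp add: hat_kernel_def)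
  show z': "norm z \<ge> \<delta> \<Longrightarrow> hat_kernel \<delta> z = 0" for z :: "real ^ 'n" using z by (simp add: hat_kernel_def)
  have "(\<integral>y. hat_kernel \<delta> (x - y) \<partial>lborel) = (\<integral>y. hat_kernel \<delta> (y :: real ^ 'n) \<partial>lborel)"
    by (rule lborel_integral_reflect[OF hc])
  also have "\<dots> = 1" unfolding hat_kernel_def using c by simp
  finally show "(\<integral>y. hat_kernel \<delta> (x - y) \<partial>lborel) = 1" .
  show "integrable lborel (\<lambda>y. hat_kernel \<delta> (x - y))"
  proof (rule integrable_compact_support[OF _ compact_cball[of x \<delta>]])
    show "continuous_on UNIV (\<lambda>y. hat_kernel \<delta> (x - y))"
      by (intro continuous_on_compose2[OF hc] continuous_intros) auto
  qed (simp add: z' dist_norm)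
qed

text \<open>The error splits into the one from replacing the hat kernel by \<kappa>, measured by
  \<eta>, and the one of the approximate identity, measured by \<open>e\<close>. The radius 2 R
  arises because \<open>x\<close> and \<open>y\<close> both have norm at most
  \<open>R\<close>.\<close>

lemma convolve_approx:
  fixes f :: "real ^ 'n::finite \<Rightarrow> complex"
  assumes f: "test_fun f" and d: "\<delta> > 0" "\<eta> > 0" "\<And>x y. dist x y < \<delta> \<Longrightarrow> dist (f x) (f y) \<le> e"
    and R: "\<And>y. y \<in> support f \<Longrightarrow> norm y \<le> R" and x: "norm x \<le> R"
    and \<kappa>: "continuous_on UNIV \<kappa>" "\<And>z. norm z \<le> 2 * R \<Longrightarrow> \<bar>hat_kernel \<delta> z - \<kappa> z\<bar> \<le> \<eta>"
  shows "cmod (convolve \<kappa> f x - f x) \<le> \<eta> * (\<integral>y. cmod (f y) \<partial>lborel) + e"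
proof -
  let ?\<rho> = "\<lambda>y. hat_kernel \<delta> (x - y)"
  have c\<kappa>: "continuous_on UNIV (\<lambda>y. complex_of_real (\<kappa> (x - y)))"
    by (intro continuous_intros continuous_on_compose2[OF \<kappa>(1)]) auto
  have c\<rho>: "continuous_on UNIV (\<lambda>y. complex_of_real (?\<rho> y))"
    by (intro continuous_intros continuous_on_compose2[OF hat_kernel_continuous[OF d(1)], of UNIV]) auto
  note i\<kappa> = integrable_test_fun_mult[OF f c\<kappa>] and i\<rho> = integrable_test_fun_mult[OF f c\<rho>]
  have ix: "integrable lborel (\<lambda>y. f x * complex_of_real (?\<rho> y))"
    by (intro integrable_mult_right integrable_of_real hat_kernel_integrable d)
  have 1: "cmod (\<integral>y. f y * of_real (\<kappa> (x - y)) - f y * of_real (?\<rho> y) \<partial>lborel) \<le> (\<integral>y. \<eta> * cmod (f y) \<partial>lborel)"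
  proof (rule Bochner_Integration.integral_norm_bound_integral)
    show "integrable lborel (\<lambda>y. f y * of_real (\<kappa> (x - y)) - f y * of_real (?\<rho> y))"
      by (rule Bochner_Integration.integrable_diff[OF i\<kappa> i\<rho>])
    show "integrable lborel (\<lambda>y. \<eta> * cmod (f y))"
      by (intro integrable_mult_right integrable_norm integrable_test_fun f)
    show "cmod (f y * of_real (\<kappa> (x - y)) - f y * of_real (?\<rho> y)) \<le> \<eta> * cmod (f y)" for y
    proof (cases "y \<in> support f")
      case True
      have "norm (x - y) \<le> 2 * R" using R[OF True] x norm_triangle_ineq4[of x y] by linarith
      then have *: "\<bar>\<kappa> (x - y) - ?\<rho> y\<bar> \<le> \<eta>" using \<kappa>(2)[of "x - y"] by linarith
      have "f y * of_real (\<kappa> (x - y)) - f y * of_real (?\<rho> y) = f y * of_real (\<kappa> (x - y) - ?\<rho> y)"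
        by (simp add: right_diff_distrib)
      then have "cmod (f y * of_real (\<kappa> (x - y)) - f y * of_real (?\<rho> y)) = cmod (f y) * \<bar>\<kappa> (x - y) - ?\<rho> y\<bar>"
        by (simp only: norm_mult norm_of_real)
      also have "\<dots> \<le> cmod (f y) * \<eta>" by (intro mult_left_mono *) simp
      finally show ?thesis by (simp add: mult.commute)
    qed (simp add: zero_outside_support)
  qed
  have 2: "cmod (\<integral>y. f y * of_real (?\<rho> y) - f x * of_real (?\<rho> y) \<partial>lborel) \<le> (\<integral>y. e * ?\<rho> y \<partial>lborel)"
  proof (rule Bochner_Integration.integral_norm_bound_integral)
    show "integrable lborel (\<lambda>y. f y * of_real (?\<rho> y) - f x * of_real (?\<rho> y))"
      by (rule Bochner_Integration.integrable_diff[OF i\<rho> ix])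
    show "integrable lborel (\<lambda>y. e * ?\<rho> y)" by (intro integrable_mult_right hat_kernel_integrable d)
    show "cmod (f y * of_real (?\<rho> y) - f x * of_real (?\<rho> y)) \<le> e * ?\<rho> y" for y
    proof (cases "norm (x - y) < \<delta>")
      case True
      then have *: "cmod (f y - f x) \<le> e" using d(3)[of y x] by (simp add: dist_norm norm_minus_commute)
      have "f y * of_real (?\<rho> y) - f x * of_real (?\<rho> y) = (f y - f x) * of_real (?\<rho> y)" by (simp add: left_diff_distrib)
      then have "cmod (f y * of_real (?\<rho> y) - f x * of_real (?\<rho> y)) = cmod (f y - f x) * ?\<rho> y"
        by (simp only: norm_mult norm_of_real abs_of_nonneg[OF hat_kernel_nonneg[OF d(1)]])
      also have "\<dots> \<le> e * ?\<rho> y" by (intro mult_right_mono * hat_kernel_nonneg d)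
      finally show ?thesis .
    qed (simp add: hat_kernel_zero d)
  qed
  have "f x = (\<integral>y. f x * of_real (?\<rho> y) \<partial>lborel)" using hat_kernel_integral[OF d(1), of x] by simp
  then have "convolve \<kappa> f x - f x =
      (\<integral>y. f y * of_real (\<kappa> (x - y)) - f y * of_real (?\<rho> y) \<partial>lborel) + (\<integral>y. f y * of_real (?\<rho> y) - f x * of_real (?\<rho> y) \<partial>lborel)"
    unfolding convolve_def Bochner_Integration.integral_diff[OF i\<kappa> i\<rho>] Bochner_Integration.integral_diff[OF i\<rho> ix] by simp
  then have "cmod (convolve \<kappa> f x - f x) \<le>
      cmod (\<integral>y. f y * of_real (\<kappa> (x - y)) - f y * of_real (?\<rho> y) \<partial>lborel) + cmod (\<integral>y. f y * of_real (?\<rho> y) - f x * of_real (?\<rho> y) \<partial>lborel)"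
    by (simp only: norm_triangle_ineq)
  also have "\<dots> \<le> (\<integral>y. \<eta> * cmod (f y) \<partial>lborel) + (\<integral>y. e * ?\<rho> y \<partial>lborel)" by (rule add_mono[OF 1 2])
  also have "\<dots> = \<eta> * (\<integral>y. cmod (f y) \<partial>lborel) + e" using hat_kernel_integral[OF d(1), of x] by simp
  finally show ?thesis .
qed

text \<open>The kernels do not depend on \<open>js\<close>: derivatives pass to the test function,
  so one sequence serves all derivatives.\<close>

lemma exp_sums_approximate_test_fun:
  fixes f :: "real ^ 'n::finite \<Rightarrow> complex"
  assumes f: "test_fun f" and K: "compact K"
  obtains T where "\<And>m. cexp_sum (T m)"
    "\<And>js. uniform_limit K (\<lambda>m. partials js (T m)) (partials js f) sequentially"
proof -
  have "bounded (K \<union> support f)" using f K by (simp add: test_fun_def compact_imp_bounded)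
  then obtain R where R: "\<And>x. x \<in> K \<union> support f \<Longrightarrow> norm x \<le> R" unfolding bounded_iff by blast
  \<comment> \<open>Both the width of the hat and the accuracy of its approximation.\<close>
  let ?\<delta> = "\<lambda>m. inverse (real (Suc m))"
  have "\<exists>\<kappa>. exp_sum \<kappa> \<and> (\<forall>z\<in>cball 0 (2 * R). \<bar>hat_kernel (?\<delta> m) z - \<kappa> (z :: real ^ 'n)\<bar> < ?\<delta> m)" for m
    by (rule exp_sum_dense[OF compact_cball hat_kernel_continuous[of "?\<delta> m"], of "?\<delta> m" 0 "2 * R"]) auto
  then obtain \<kappa> where \<kappa>: "\<And>m. exp_sum (\<kappa> m)"
    "\<And>m z. z \<in> cball 0 (2 * R) \<Longrightarrow> \<bar>hat_kernel (?\<delta> m) z - \<kappa> m (z :: real ^ 'n)\<bar> < ?\<delta> m" by metis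
  show thesis
  proof (rule that[of "\<lambda>m. convolve (\<kappa> m) f"])
    show "cexp_sum (convolve (\<kappa> m) f)" for m by (rule cexp_sum_convolve[OF \<kappa>(1) f])
    fix js
    let ?g = "partials js f"
    have g: "test_fun ?g" by (rule test_fun_partials[OF f])
    have "support ?g \<subseteq> support f" by (induction js) (use support_partial in auto)
    then have Rg: "\<And>y. y \<in> support ?g \<Longrightarrow> norm y \<le> R" using R by blast
    let ?M = "\<integral>y. cmod (?g y) \<partial>lborel"
    have "?M \<ge> 0" by (rule integral_nonneg_AE) simp
    then have M: "?M + 1 > 0" by (rule add_nonneg_pos) simp
    have uc: "uniformly_continuous_on UNIV ?g"
      using g by (intro uniformly_continuous_compact_support smooth_continuous) (auto simp: test_fun_def)
    show "uniform_limit K (\<lambda>m. partials js (convolve (\<kappa> m) f)) ?g sequentially"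
      unfolding uniform_limit_iff
    proof (intro allI impI)
      fix e :: real assume e: "e > 0"
      obtain d where d: "d > 0" "\<And>x y. dist x y < d \<Longrightarrow> dist (?g x) (?g y) < e / 2"
        using uc e unfolding uniformly_continuous_on_def by (metis UNIV_I dist_commute half_gt_zero)
      have pos: "e / (2 * (?M + 1)) > 0" by (intro divide_pos_pos e mult_pos_pos M) simp
      have "\<forall>\<^sub>F m in sequentially. ?\<delta> m < d" "\<forall>\<^sub>F m in sequentially. ?\<delta> m < e / (2 * (?M + 1))"
        by (rule order_tendstoD[OF LIMSEQ_inverse_real_of_nat], use d(1) pos in simp)+
      then show "\<forall>\<^sub>F m in sequentially. \<forall>x\<in>K. dist (partials js (convolve (\<kappa> m) f) x) (?g x) < e"
      proof eventually_elim
        case (elim m)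
        show ?case
        proof
          fix x assume x: "x \<in> K"
          have "cmod (convolve (\<kappa> m) ?g x - ?g x) \<le> ?\<delta> m * ?M + e / 2"
          proof (rule convolve_approx[OF g])
            show "dist (?g x) (?g y) \<le> e / 2" if "dist x y < ?\<delta> m" for x y
              using d(2)[of x y] that elim(1) by simp
            show "\<bar>hat_kernel (?\<delta> m) z - \<kappa> m z\<bar> \<le> ?\<delta> m" if "norm z \<le> 2 * R" for z
              using \<kappa>(2)[of z m] that by simp
          qed (use x R Rg exp_sum_continuous[OF \<kappa>(1)] in auto)
          also have "?\<delta> m * ?M \<le> ?\<delta> m * (?M + 1)" by (intro mult_left_mono) auto
          also have "?\<delta> m * (?M + 1) < e / (2 * (?M + 1)) * (?M + 1)"
            by (intro mult_strict_right_mono elim M)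
          also have "\<dots> = e / 2" using M by (metis nonzero_divide_mult_cancel_right nonzero_mult_div_cancel_right divide_divide_eq_left less_irrefl times_divide_eq_left)
          finally show "dist (partials js (convolve (\<kappa> m) f) x) (?g x) < e"
            by (simp add: partials_convolve[OF \<kappa>(1) f] dist_norm)
        qed
      qed
    qed
  qed
qed

section \<open>Compactly supported distributions\<close>

text \<open>Supports are measured in the maximum norm because \<^const>\<open>cutoff_fun\<close> is a product over the
  coordinates.\<close>

definition outside :: "real \<Rightarrow> (real ^ 'n::finite) set" where
  "outside R = {x. \<exists>j. \<bar>x $ j\<bar> > R}"

lemma compact_support_cutoff_fun: "compact (support (cutoff_fun R :: real ^ 'n::finite \<Rightarrow> complex))"
  using test_fun_cutoff_fun[of R, where 'n = 'n] unfolding test_fun_def by blast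

text \<open>The margin 1 absorbs the closure in \<open>support\<close>: the closed set where some
  \<bar>x_j\<bar> \<ge> R + 1 still lies in \<open>outside R\<close>.\<close>

lemma agree_on_outside_zero:
  fixes \<phi> :: "real ^ 'n::finite \<Rightarrow> complex"
  assumes u: "agree_on (outside R) u 0" and \<phi>: "test_fun \<phi>"
    and zero: "\<And>x. (\<And>j. \<bar>x $ j\<bar> < R + 1) \<Longrightarrow> \<phi> x = 0"
  shows "dist_apply u \<phi> = 0"
proof -
  have "support \<phi> \<subseteq> {x :: real ^ 'n. \<exists>j. R + 1 \<le> \<bar>x $ j\<bar>}"
  proof (rule support_subset_closed)
    have "{x :: real ^ 'n. \<exists>j. R + 1 \<le> \<bar>x $ j\<bar>} = (\<Union>j. {x. R + 1 \<le> \<bar>x $ j\<bar>})" by auto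
    moreover have "closed {x :: real ^ 'n. R + 1 \<le> \<bar>x $ j\<bar>}" for j
      by (intro closed_Collect_le continuous_intros)
    ultimately show "closed {x :: real ^ 'n. \<exists>j. R + 1 \<le> \<bar>x $ j\<bar>}" by auto
    show "x \<in> {x :: real ^ 'n. \<exists>j. R + 1 \<le> \<bar>x $ j\<bar>}" if "\<phi> x \<noteq> 0" for x :: "real ^ 'n"
      using that by (rule contrapos_np) (rule zero, simp add: not_le)
  qed
  also have "\<dots> \<subseteq> outside R"
  proof
    fix x :: "real ^ 'n" assume "x \<in> {x :: real ^ 'n. \<exists>j. R + 1 \<le> \<bar>x $ j\<bar>}"
    then obtain j where "R + 1 \<le> \<bar>x $ j\<bar>" by blast
    then have "R < \<bar>x $ j\<bar>" by linarith
    then show "x \<in> outside R" by (auto simp: outside_def)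
  qed
  finally show ?thesis using u \<phi> by (simp add: agree_on_def dist_apply_zero)
qed

lemma partial_cutoff_fun_zero:
  fixes x :: "real ^ 'n::finite"
  assumes "\<And>j. \<bar>x $ j\<bar> < R"
  shows "partial i (cutoff_fun R) x = 0"
proof -
  let ?S = "\<Inter>j. {x :: real ^ 'n. \<bar>x $ j\<bar> < R}"
  have "open {x :: real ^ 'n. \<bar>x $ j\<bar> < R}" for j
    by (intro open_Collect_less continuous_intros)
  then have op: "open ?S" by (intro open_INT) auto
  have x: "x \<in> ?S" using assms by simp
  have eq: "1 = cutoff_fun R y" if "y \<in> ?S" for y
    using that by (intro cutoff_fun_1[symmetric]) (simp add: less_imp_le)
  have "(cutoff_fun R has_derivative (\<lambda>h. 0)) (at x)"
    by (rule has_derivative_transform_within_open[OF has_derivative_const op x eq])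
  from partial_eqI[OF this] show ?thesis .
qed

text \<open>In the Leibniz rule the derivative of the cutoff vanishes on the cube of half-side R +
  1, so \<open>u\<close> does not see that term. This dictates the radius R + 1 of the
  cutoff.\<close>

lemma dist_D_cutoff:
  fixes u :: "'n::finite distribution"
  assumes u: "agree_on (outside R) u 0" and \<psi>: "smooth \<psi>"
  shows "dist_apply (dist_D j u) (\<lambda>x. cutoff_fun (R + 1) x * \<psi> x) = \<i> * dist_apply u (\<lambda>x. cutoff_fun (R + 1) x * partial j \<psi> x)"
proof -
  let ?\<eta> = "cutoff_fun (R + 1) :: real ^ 'n \<Rightarrow> complex"
  have 1: "test_fun (\<lambda>x. ?\<eta> x * \<psi> x)" "test_fun (\<lambda>x. ?\<eta> x * partial j \<psi> x)" "test_fun (\<lambda>x. partial j ?\<eta> x * \<psi> x)"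
    by (intro test_fun_mult_smooth(1) test_fun_partial test_fun_cutoff_fun \<psi> smooth_partial)+
  have "dist_apply (dist_D j u) (\<lambda>x. ?\<eta> x * \<psi> x) = \<i> * dist_apply u (\<lambda>x. ?\<eta> x * partial j \<psi> x + partial j ?\<eta> x * \<psi> x)"
    by (simp only: dist_apply_D[OF 1(1)] partial_mult[OF smooth_cutoff_fun \<psi>])
  also have "dist_apply u (\<lambda>x. ?\<eta> x * partial j \<psi> x + partial j ?\<eta> x * \<psi> x)
      = dist_apply u (\<lambda>x. ?\<eta> x * partial j \<psi> x) + dist_apply u (\<lambda>x. partial j ?\<eta> x * \<psi> x)"
    by (rule dist_apply_fun_add[OF 1(2,3)])
  also have "dist_apply u (\<lambda>x. partial j ?\<eta> x * \<psi> x) = 0"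
    by (rule agree_on_outside_zero[OF u 1(3)]) (simp add: partial_cutoff_fun_zero)
  finally show ?thesis by simp
qed

text \<open>The Laplace transform turns \<open>a\<close> into multiplication by a(\<i> s):
  transposed to test functions \<open>D_j\<close> is \<i> times the partial derivative, which
  multiplies the exponential by s_j.\<close>

lemma pdo_act_exp:
  fixes u :: "'n::finite distribution"
  assumes "agree_on (outside R) u 0"
  shows "dist_apply (pdo_act a u) (\<lambda>x. cutoff_fun (R + 1) x * exp_fun s x)
     = mpoly_eval a (\<lambda>j. \<i> * of_real (s $ j)) * dist_apply u (\<lambda>x. cutoff_fun (R + 1) x * exp_fun s x)"
  using assms
proof (induction a arbitrary: u rule: mpoly_induct)
  case (const c)
  show ?case by (simp add: pdo_act_const dist_apply_scale)
next
  case (var j)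
  have "(\<lambda>x. cutoff_fun (R + 1) x * (complex_of_real (s $ j) * exp_fun s x)) = (\<lambda>x. of_real (s $ j) * (cutoff_fun (R + 1) x * exp_fun s x))"
    by (simp add: mult_ac)
  then show ?case
    using dist_D_cutoff[OF var smooth_exp_fun, of j s]
    by (simp add: pdo_act_var partial_exp_fun dist_apply_fun_scale test_fun_mult_smooth test_fun_cutoff_fun smooth_exp_fun)
next
  case (add p q)
  show ?case by (simp add: pdo_act_add_left dist_apply_add add.IH[OF add.prems] distrib_right)
next
  case (mult p q)
  interpret Modules.module "pdo_act :: 'n pdo \<Rightarrow> _" by (rule pdo_act_module)
  have "agree_on (outside R) (pdo_act q u) 0"
    using agree_on_pdo_act[OF mult.prems, of q] by simp
  then show ?case by (simp only: pdo_act_mult mult.IH(1) mult.IH(2)[OF mult.prems] mpoly_eval_mult mult.assoc)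
qed

lemma uniform_limit_zero_mult:
  fixes \<psi> :: "'m \<Rightarrow> real ^ 'n::finite \<Rightarrow> complex"
  assumes "test_fun \<eta>" "support \<eta> \<subseteq> K" "\<And>m. smooth (\<psi> m)"
    and "\<And>js. uniform_limit K (\<lambda>m. partials js (\<psi> m)) (\<lambda>_. 0) F"
  shows "uniform_limit UNIV (\<lambda>m. partials js (\<lambda>x. \<eta> x * \<psi> m x)) (\<lambda>_. 0) F"
  using assms
\<comment> \<open>\<open>partials\<close> applies the last index of the list first, so the Leibniz
  rule meets the product at the end of the list; both factors change in the step.\<close>
proof (induction js arbitrary: \<eta> \<psi> rule: rev_induct)
  case Nil
  obtain B where B: "\<And>x. cmod (\<eta> x) \<le> B" using test_fun_bdd[OF Nil(1)] unfolding bdd_above_def by blast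
  then have B0: "B \<ge> 0" using norm_ge_zero order_trans by blast
  show ?case
    unfolding uniform_limit_iff
  proof (intro allI impI)
    fix e :: real assume e: "e > 0"
    have "\<forall>\<^sub>F m in F. \<forall>x\<in>K. dist (partials [] (\<psi> m) x) 0 < e / (B + 1)"
      using Nil(4)[of "[]"] e B0 unfolding uniform_limit_iff by (meson add_nonneg_pos divide_pos_pos zero_less_one)
    then show "\<forall>\<^sub>F m in F. \<forall>x\<in>UNIV. dist (partials [] (\<lambda>x. \<eta> x * \<psi> m x) x) 0 < e"
    proof (rule eventually_mono, intro ballI)
      fix m x assume *: "\<forall>x\<in>K. dist (partials [] (\<psi> m) x) 0 < e / (B + 1)"
      show "dist (partials [] (\<lambda>x. \<eta> x * \<psi> m x) x) 0 < e"
      proof (cases "x \<in> support \<eta>")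
        case True
        then have "cmod (\<psi> m x) < e / (B + 1)" using * Nil(2) by auto
        then have "cmod (\<eta> x * \<psi> m x) \<le> B * (e / (B + 1))"
          unfolding norm_mult using B[of x] B0 by (intro mult_mono) auto
        also have "\<dots> < e" using e B0 by (simp add: field_simps)
        finally show ?thesis by simp
      qed (use e in \<open>simp add: zero_outside_support\<close>)
    qed
  qed
next
  case (snoc j js)
  have sm: "smooth \<eta>" using snoc.prems(1) by (simp add: test_fun_def)
  have eq: "partials (js @ [j]) (\<lambda>x. \<eta> x * \<psi> m x) = (\<lambda>x. partials js (\<lambda>x. \<eta> x * partial j (\<psi> m) x) x + partials js (\<lambda>x. partial j \<eta> x * \<psi> m x) x)" for m
    by (simp add: partial_mult sm snoc.prems(3) partials_add smooth_mult smooth_partial)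
  have 1: "uniform_limit UNIV (\<lambda>m. partials js (\<lambda>x. \<eta> x * partial j (\<psi> m) x)) (\<lambda>_. 0) F"
  proof (rule snoc.IH[OF snoc.prems(1,2)])
    show "uniform_limit K (\<lambda>m. partials is (partial j (\<psi> m))) (\<lambda>_. 0) F" for "is"
      using snoc.prems(4)[of "is @ [j]"] by simp
  qed (rule smooth_partial[OF snoc.prems(3)])
  have 2: "uniform_limit UNIV (\<lambda>m. partials js (\<lambda>x. partial j \<eta> x * \<psi> m x)) (\<lambda>_. 0) F"
    using support_partial[of j \<eta>] snoc.prems(2)
    by (intro snoc.IH[OF test_fun_partial[OF snoc.prems(1)] _ snoc.prems(3,4)]) auto
  show ?case using uniform_limit_add[OF 1 2] unfolding eq by simp
qed

lemma dist_apply_cutoff_tendsto_0: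
  fixes \<psi> :: "'m \<Rightarrow> real ^ 'n::finite \<Rightarrow> complex"
  assumes "\<And>m. smooth (\<psi> m)"
    and "\<And>js. uniform_limit (support (cutoff_fun R :: real ^ 'n \<Rightarrow> complex)) (\<lambda>m. partials js (\<psi> m)) (\<lambda>_. 0) F"
  shows "((\<lambda>m. dist_apply u (\<lambda>x. cutoff_fun R x * \<psi> m x)) \<longlongrightarrow> 0) F"
proof (rule dist_apply_tendsto_0)
  show "compact (support (cutoff_fun R :: real ^ 'n \<Rightarrow> complex))" by (rule compact_support_cutoff_fun)
  show "test_fun (\<lambda>x. cutoff_fun R x * \<psi> m x)" "support (\<lambda>x. cutoff_fun R x * \<psi> m x) \<subseteq> support (cutoff_fun R)" for m
    by (rule test_fun_mult_smooth[OF test_fun_cutoff_fun assms(1)])+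
  show "uniform_limit UNIV (\<lambda>m. partials js (\<lambda>x. cutoff_fun R x * \<psi> m x)) (\<lambda>_. 0) F" for js
    by (rule uniform_limit_zero_mult[OF test_fun_cutoff_fun order_refl assms])
qed

text \<open>Continuity of the Laplace transform along a line: each derivative of the exponential is
  jointly continuous in the parameter and the point, hence uniformly close to its value at parameter
  0 over the compact support.\<close>

lemma exp_fun_line_tendsto:
  fixes u :: "'n::finite distribution"
  shows "((\<lambda>t. dist_apply u (\<lambda>x. cutoff_fun R x * exp_fun (s + t *\<^sub>R v) x)) \<longlongrightarrow> dist_apply u (\<lambda>x. cutoff_fun R x * exp_fun s x)) (at 0)"
proof -
  let ?K = "support (cutoff_fun R :: real ^ 'n \<Rightarrow> complex)"
  have K: "compact ?K" by (rule compact_support_cutoff_fun)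
  have lim: "((\<lambda>t. dist_apply u (\<lambda>x. cutoff_fun R x * (exp_fun (s + t *\<^sub>R v) x - exp_fun s x))) \<longlongrightarrow> 0) (at 0)"
  proof (rule dist_apply_cutoff_tendsto_0)
    show "smooth (\<lambda>x. exp_fun (s + t *\<^sub>R v) x - exp_fun s x)" for t by (intro smooth_diff smooth_exp_fun)
    fix js :: "'n list"
    let ?G = "\<lambda>t x. complex_of_real (prod_list (map (($) (s + t *\<^sub>R v)) js)) * exp_fun (s + t *\<^sub>R v) x"
    have "partials js (\<lambda>x. exp_fun (s + t *\<^sub>R v) x + - 1 * exp_fun s x)
        = (\<lambda>x. partials js (exp_fun (s + t *\<^sub>R v)) x + - 1 * partials js (exp_fun s) x)" for t
      by (simp only: partials_add partials_scale smooth_exp_fun smooth_scale)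
    then have eq: "partials js (\<lambda>x. exp_fun (s + t *\<^sub>R v) x - exp_fun s x) = (\<lambda>x. ?G t x - ?G 0 x)" for t
      by (simp add: partials_exp_fun)
    have pl: "continuous_on A (\<lambda>p :: real \<times> (real ^ 'n). prod_list (map (($) (s + fst p *\<^sub>R v)) js))" for A
      by (induction js) (auto intro!: continuous_intros)
    have cont: "continuous_on (UNIV \<times> ?K) (\<lambda>p. ?G (fst p) (snd p))"
      unfolding exp_fun_def by (intro continuous_intros pl)
    show "uniform_limit ?K (\<lambda>t. partials js (\<lambda>x. exp_fun (s + t *\<^sub>R v) x - exp_fun s x)) (\<lambda>_. 0) (at 0)"
      unfolding uniform_limit_iff eq
    proof (intro allI impI)
      fix e :: real assume e: "e > 0"
      obtain X0 where X0: "0 \<in> X0" "open X0" "\<And>t x. t \<in> X0 \<Longrightarrow> x \<in> ?K \<Longrightarrow> dist (?G t x) (?G 0 x) \<le> e / 2"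
        by (rule continuous_on_prod_compactE[OF cont K, of 0 "e / 2"]) (use e in \<open>simp_all del: add_0_left scaleR_zero_left\<close>)
      then have "\<forall>\<^sub>F t in at 0. t \<in> X0" by (auto simp: eventually_at_topological)
      then show "\<forall>\<^sub>F t in at 0. \<forall>x\<in>?K. dist (?G t x - ?G 0 x) 0 < e"
      proof (rule eventually_mono, intro ballI)
        fix t x assume "t \<in> X0" "x \<in> ?K"
        then have "dist (?G t x) (?G 0 x) \<le> e / 2" by (rule X0(3))
        then show "dist (?G t x - ?G 0 x) 0 < e" using e by (simp add: dist_norm)
      qed
    qed
  qed
  have "dist_apply u (\<lambda>x. cutoff_fun R x * (exp_fun (s + t *\<^sub>R v) x - exp_fun s x))
     = dist_apply u (\<lambda>x. cutoff_fun R x * exp_fun (s + t *\<^sub>R v) x) - dist_apply u (\<lambda>x. cutoff_fun R x * exp_fun s x)" for t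
    by (simp add: right_diff_distrib dist_apply_fun_diff test_fun_mult_smooth test_fun_cutoff_fun smooth_exp_fun)
  then show ?thesis using lim by (simp add: LIM_zero_iff)
qed

text \<open>On the line from \<open>s\<close> towards a point where a(\<i> r) is nonzero, the
  polynomial has finitely many zeros. The transform is thus 0 for all small nonzero parameters, and
  by continuity at \<open>s\<close> itself.\<close>

lemma dist_apply_exp_zero:
  fixes u :: "'n::finite distribution"
  assumes u: "agree_on (outside R) u 0" and a: "a \<noteq> 0" "pdo_act a u = 0"
  shows "dist_apply u (\<lambda>x. cutoff_fun (R + 1) x * exp_fun s x) = 0"
proof -
  let ?L = "\<lambda>s. dist_apply u (\<lambda>x. cutoff_fun (R + 1) x * exp_fun s x)"
  have L: "mpoly_eval a (\<lambda>j. \<i> * of_real (s $ j)) * ?L s = 0" for s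
    using pdo_act_exp[OF u, of a s] a(2) by (simp add: dist_apply_zero)
  obtain r where r: "mpoly_eval a (\<lambda>j. \<i> * of_real (r j)) \<noteq> 0"
    using mpoly_nonzero_value[OF a(1), of \<i>] by auto
  define v where "v = (\<chi> j. r j) - s"
  obtain q where q: "\<And>t. mpoly_eval a (\<lambda>j. \<i> * of_real (s $ j) + t * (\<i> * of_real (v $ j))) = poly q t"
    using mpoly_eval_line[of a "\<lambda>j. \<i> * of_real (s $ j)" "\<lambda>j. \<i> * of_real (v $ j)"] by blast
  have "poly q 1 \<noteq> 0" using q[of 1] r by (simp add: v_def algebra_simps)
  then have "q \<noteq> 0" by auto
  then have "finite {t. poly q t = 0}" by (rule poly_roots_finite)
  then have fin: "finite (complex_of_real -` {t. poly q t = 0})" by (intro finite_vimageI inj_of_real)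
  have "\<forall>\<^sub>F t in at 0. t \<notin> complex_of_real -` {t. poly q t = 0}"
    using finite_imp_closed[OF fin] islimpt_finite[OF fin, of 0]
    by (auto simp: islimpt_iff_eventually)
  then have "\<forall>\<^sub>F t in at 0. ?L (s + t *\<^sub>R v) = 0"
  proof (rule eventually_mono)
    fix t assume "t \<notin> complex_of_real -` {t. poly q t = 0}"
    then have "mpoly_eval a (\<lambda>j. \<i> * of_real ((s + t *\<^sub>R v) $ j)) \<noteq> 0"
      using q[of "of_real t"] by (simp add: algebra_simps)
    then show "?L (s + t *\<^sub>R v) = 0" using L[of "s + t *\<^sub>R v"] by simp
  qed
  then have "((\<lambda>t. ?L (s + t *\<^sub>R v)) \<longlongrightarrow> 0) (at 0)" by (rule tendsto_eventually)
  from tendsto_unique[OF _ exp_fun_line_tendsto this] show ?thesis by simp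
qed

theorem compact_support_pdo_injective:
  fixes u :: "'n::finite distribution"
  assumes u: "agree_on (outside R) u 0" and a: "a \<noteq> 0" "pdo_act a u = 0"
  shows "u = 0"
proof (rule distribution_eqI)
  fix \<phi> :: "real ^ 'n \<Rightarrow> complex" assume \<phi>: "test_fun \<phi>"
  let ?\<eta> = "cutoff_fun (R + 1) :: real ^ 'n \<Rightarrow> complex"
  have K: "compact (support ?\<eta>)" by (rule compact_support_cutoff_fun)
  have sm: "smooth \<phi>" using \<phi> by (simp add: test_fun_def)
  have tf: "test_fun (\<lambda>x. ?\<eta> x * \<psi> x)" if "smooth \<psi>" for \<psi>
    using that by (rule test_fun_mult_smooth[OF test_fun_cutoff_fun])
  obtain T where T: "\<And>m. cexp_sum (T m)"
    "\<And>js. uniform_limit (support ?\<eta>) (\<lambda>m. partials js (T m)) (partials js \<phi>) sequentially"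
    by (rule exp_sums_approximate_test_fun[OF \<phi> K]) blast
  note smT = smooth_cexp_sum[OF T(1)]
  have zero: "dist_apply u (\<lambda>x. ?\<eta> x * f x) = 0" if "cexp_sum f" for f
    using that
  proof (induction rule: cexp_sum.induct)
    case (exp c s)
    have "(\<lambda>x. ?\<eta> x * (c * exp_fun s x)) = (\<lambda>x. c * (?\<eta> x * exp_fun s x))" by (simp add: mult_ac)
    then show ?case using dist_apply_exp_zero[OF u a] by (simp add: dist_apply_fun_scale tf smooth_exp_fun)
  next
    case (add f g)
    then show ?case by (simp add: distrib_left dist_apply_fun_add tf smooth_cexp_sum)
  qed
  have "((\<lambda>m. dist_apply u (\<lambda>x. ?\<eta> x * (T m x - \<phi> x))) \<longlongrightarrow> 0) sequentially"
  proof (rule dist_apply_cutoff_tendsto_0)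
    show "smooth (\<lambda>x. T m x - \<phi> x)" for m by (intro smooth_diff smT sm)
    fix js
    have "partials js (\<lambda>x. T m x + - 1 * \<phi> x) = (\<lambda>x. partials js (T m) x + - 1 * partials js \<phi> x)" for m
      by (simp only: partials_add partials_scale smT sm smooth_scale)
    then show "uniform_limit (support ?\<eta>) (\<lambda>m. partials js (\<lambda>x. T m x - \<phi> x)) (\<lambda>_. 0) sequentially"
      using T(2)[of js] by (simp add: uniform_limit_iff dist_norm)
  qed
  moreover have "dist_apply u (\<lambda>x. ?\<eta> x * (T m x - \<phi> x)) = - dist_apply u (\<lambda>x. ?\<eta> x * \<phi> x)" for m
    by (simp add: right_diff_distrib dist_apply_fun_diff tf smT sm zero[OF T(1)])
  ultimately have "dist_apply u (\<lambda>x. ?\<eta> x * \<phi> x) = 0" by (simp add: LIMSEQ_const_iff)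
  \<comment> \<open>What the cutoff removes from \<phi> vanishes on the cube of half-side R + 1 and
    is invisible to \<open>u\<close>.\<close>
  moreover have "dist_apply u (\<lambda>x. \<phi> x - ?\<eta> x * \<phi> x) = 0"
    by (rule agree_on_outside_zero[OF u]) (auto intro!: test_fun_diff \<phi> tf sm simp: cutoff_fun_1 less_imp_le)
  ultimately show "dist_apply u \<phi> = dist_apply 0 \<phi>"
    by (simp add: dist_apply_fun_diff \<phi> tf sm dist_apply_zero)
qed

section \<open>Uncontrollable systems\<close>

lemma uncontrollable_if_full_rank:
  fixes F :: "'n::finite distribution set" and M :: "'n pdo ^ 'k::finite ^ 'l::finite"
  assumes sub: "Modules.module.subspace pdo_act F"
    and cog: "injective_cogenerator ring_of_type_algebra (dist_module F)"
    and cut: "cutoff_assumption F" and full: "full_rank M"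
  shows "uncontrollable F (kernel F (row_module M))"
  unfolding uncontrollable_def
proof (intro allI impI, elim conjE, rule notI)
  fix B :: "('n distribution ^ 'k) set"
  assume B: "is_system F B" "B \<subseteq> kernel F (row_module M)" "B \<noteq> {0}" and contr: "controllable F B"
  interpret Modules.module "pdo_act :: 'n pdo \<Rightarrow> _" by (rule pdo_act_module)
  obtain P where P: "Modules.module.subspace (*s) P" "B = kernel F P" using B(1) by (auto simp: is_system_def)
  have zero: "0 \<in> B" using subspace_0[OF sub] by (simp add: P(2) kernel_def)
  \<comment> \<open>The full module contains all unit vectors and would force the system to be
    {0}.\<close>
  have "P \<noteq> UNIV"
  proof
    assume "P = UNIV"
    have "f = 0" if "f \<in> B" for f
    proof -
      have "f $ j = 0" for j
      proof -
        have "(\<Sum>l\<in>UNIV. pdo_act ((1 *s axis j 1) $ l) (f $ l)) = 0"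
          using that \<open>P = UNIV\<close> unfolding P(2) kernel_def by blast
        then show ?thesis unfolding pdo_act_axis by simp
      qed
      then show ?thesis by (simp add: vec_eq_iff)
    qed
    then show False using B(3) zero by blast
  qed
  from kernel_contains_eigenvector[OF sub cog P(1) this]
  obtain x c \<phi> j where \<phi>: "\<phi> \<noteq> 0" "\<And>i. dist_D i \<phi> = dist_scale (x i) \<phi>"
    "(\<chi> l. dist_scale (c l) \<phi>) \<in> B" "c j = (1 :: complex)"
    unfolding P(2) by metis
  have "bounded (cball 0 1 :: (real ^ 'n) set)" "interior (cball 0 1 :: (real ^ 'n) set) \<noteq> {}"
    using centre_in_ball[of 0 1] by (auto simp del: centre_in_ball)
  then obtain U where U: "U \<noteq> {}" "admissible F U (UNIV - cball 0 1)"
    using cut unfolding cutoff_assumption_def by blast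
  \<comment> \<open>Controllability patches the eigenvector near \<open>U\<close> with the zero
    solution off the ball.\<close>
  obtain g where g: "g \<in> B" "vec_agree_near U g (\<chi> l. dist_scale (c l) \<phi>)" "vec_agree_near (UNIV - cball 0 1) g 0"
    using contr U(2) \<phi>(3) zero unfolding controllable_def by metis
  obtain r y where "mpoly_eval (det (\<chi> i. M $ r i)) y \<noteq> 0" using full by (auto simp: full_rank_def)
  then have a: "det (\<chi> i. M $ r i) \<noteq> 0" by auto
  have "pdo_act (det (\<chi> i. M $ r i)) (g $ j) = 0"
  proof -
    have "(\<Sum>l\<in>UNIV. pdo_act ((det (\<chi> i. M $ r i) *s axis j 1) $ l) (g $ l)) = 0"
      using g(1) B(2) det_axis_in_row_module[of M r j] unfolding kernel_def by blast
    then show ?thesis unfolding pdo_act_axis .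
  qed
  moreover have "agree_on (outside 1) (g $ j) 0"
  proof -
    obtain W where W: "UNIV - cball 0 1 \<subseteq> W" "agree_on W (g $ j) ((0 :: 'n distribution ^ 'k) $ j)"
      using g(3) unfolding vec_agree_near_def by blast
    have "outside 1 \<subseteq> UNIV - cball (0 :: real ^ 'n) 1"
    proof
      fix z :: "real ^ 'n" assume "z \<in> outside 1"
      then obtain i where "\<bar>z $ i\<bar> > 1" by (auto simp: outside_def)
      then have "norm z > 1" using component_le_norm_cart[of z i] by linarith
      then show "z \<in> UNIV - cball 0 1" by simp
    qed
    then show ?thesis using W unfolding agree_on_def by auto
  qed
  ultimately have gj: "g $ j = 0" using compact_support_pdo_injective a by blast
  \<comment> \<open>Component \<open>j\<close> of \<open>g\<close> is zero everywhere and, as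
    \<open>c j = 1\<close>, agrees with \<phi> on \<open>W\<close>.\<close>
  obtain W where W: "open W" "U \<subseteq> W" "agree_on W (g $ j) (dist_scale (c j) \<phi>)"
    using g(2) unfolding vec_agree_near_def by fastforce
  then have "agree_on W \<phi> 0" by (simp add: gj \<phi>(4) dist_scale_simps agree_on_def)
  moreover have "W \<noteq> {}" using U(1) W(2) by blast
  ultimately have "\<phi> = 0" using eigendistribution_zero[OF \<phi>(2) W(1)] by blast
  then show False using \<phi>(1) by blast
qed

lemma uncontrollable_iff_full_rank:
  fixes F :: "'n::finite distribution set" and M :: "'n pdo ^ 'k::finite ^ 'l::finite"
  assumes sub: "Modules.module.subspace pdo_act F"
    and cog: "injective_cogenerator ring_of_type_algebra (dist_module F)"
    and cut: "cutoff_assumption F"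
  shows "uncontrollable F (kernel F (row_module M)) \<longleftrightarrow> full_rank M"
proof
  assume unc: "uncontrollable F (kernel F (row_module M))"
  show "full_rank M"
  proof (rule ccontr)
    assume "\<not> full_rank M"
    then have "det (\<chi> i. M $ r i) = 0" for r by (intro mpoly_eqI) (simp add: full_rank_def)
    then obtain q where "q \<noteq> 0" "\<And>i. (\<Sum>j\<in>UNIV. M $ i $ j * q $ j) = 0"
      by (rule full_minor_or_orthogonal_vector) blast
    from not_uncontrollable_if_orthogonal[OF sub cog this] unc show False by blast
  qed
qed (rule uncontrollable_if_full_rank[OF sub cog cut])

theorem theorem5p1:
  fixes F :: "'n::finite distribution set"
  assumes "Modules.module.subspace pdo_act F"
    and "injective_cogenerator ring_of_type_algebra (dist_module F)"
    and "cutoff_assumption F"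
    and "CARD('l::finite) \<ge> CARD('k::finite)"
  shows "openin (system_topology TYPE('l) F)
           (uncontrollable_systems TYPE('l) F :: ('n distribution ^ 'k) set set) \<and>
         system_topology TYPE('l) F closure_of
           (uncontrollable_systems TYPE('l) F :: ('n distribution ^ 'k) set set) =
           topspace (system_topology TYPE('l) F) \<and>
         generic_in (system_topology TYPE('l) F)
           (uncontrollable_systems TYPE('l) F :: ('n distribution ^ 'k) set set)"
proof -
  let ?S = "uncontrollable_systems TYPE('l) F :: ('n distribution ^ 'k) set set"
  have eq: "kernel F (row_module M) \<in> ?S \<longleftrightarrow> full_rank M" for M :: "'n pdo ^ 'k ^ 'l"
    using uncontrollable_iff_full_rank[OF assms(1-3), of M]
    by (auto simp: uncontrollable_systems_def topspace_system_topology)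
  have sub: "?S \<subseteq> topspace (system_topology TYPE('l) F)" by (auto simp: uncontrollable_systems_def)
  from generic_full_rank[OF eq sub assms(4)] sub show ?thesis by (auto simp: generic_in_def)
qed

end
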